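(* Let $\eta\in\Upsilon_{z_0}$ (then also $-\eta\in\Upsilon_{z_0}$ and $N_{-\eta}=N_\eta$), and assume both $\mathbf M_\eta$ and $\mathbf M_{-\eta}$ are irreducible. Choose $\epsilon\in\{\pm1\}$ uniformly at random, and let $(u_M,M)\in\widetilde W\times\mathbb Z/N_\eta\mathbb Z$ denote the state of $\widetilde{\mathbf M}_{\epsilon\eta}$ at time $M$. Then (almost surely) there exists $w_*\in W$ such that $\mathcal A u_M\subseteq\mathcal C w_*$ for all sufficiently large $M$, and for each $w\in W$, \[\mathbb P(w_*=w)=\frac{N_\eta}{2}\big(\zeta_\eta(w^{-1}w_\circ,0)+\zeta_{-\eta}(w^{-1}w_\circ,0)\big).\]
   Context: Let $\Phi$ be a finite irreducible crystallographic root system spanning a Euclidean space $V$, with positive roots $\Phi^+$, simple roots $\{\alpha_i:i\in I\}$, highest root $\theta$, Weyl group $W$ with longest element $w_\circ$, and affine Weyl group $\widetilde W$ with simple reflections $s_i$, $i\in\widetilde I=\{0\}\sqcup I$. $Q^\vee$ is the coroot lattice in $V^*$. For $\beta\in\Phi^+$, $k\in\mathbb Z$, let $\mathrm H_\beta^k=\{\gamma\in V^*:\gamma(\beta)=k\}$ and $\mathcal H_{\widetilde W}=\{\mathrm H_\beta^k\}$. $\widetilde W$ acts faithfully on $V^*$ on the right: $s_i$ ($i\in I$) by reflection through $\mathrm H^0_{\alpha_i}$ and $s_0$ by reflection through $\mathrm H^1_\theta$. Fundamental chamber $\mathcal C=\{\gamma:\gamma(\alpha_i)\ge0\ \forall i\in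 I\}$, fundamental alcove $\mathcal A=\{\gamma\in\mathcal C:\gamma(\theta)\le1\}$; $u\mapsto\mathcal A u$ is a bijection from $\widetilde W$ to alcoves and $w\mapsto\mathcal C w$ from $W$ to chambers. $\mathrm H^{(u,s_i)}$ is the hyperplane separating $\mathcal A u$ and $\mathcal A s_iu$. Each $w\in\widetilde W$ factors uniquely as $w=\overline w\tau_\xi$ with $\overline w\in W$, $\xi\in Q^\vee$ ($\tau_\xi$ acting as translation $\gamma\mapsto\gamma-\xi$). $\widehat W=\{w\in\widetilde W:\mathcal A w\subseteq\mathcal C\}$. Fix $z_0$ in the interior of $\mathcal A$ and $p\in(0,1)$. $\Upsilon_{z_0}$ is the set of $\eta\in Q^\vee\setminus\{0\}$ whose ray from $z_0$ avoids intersections of two or more hyperplanes of $\mathcal H_{\widetilde W}$. For such $\eta$, if the ray passes successively through alcoves $\mathcal A u_0=\mathcal A,\mathcal A u_1,\dots$, define $i_j$ by $u_{j+1}=s_{i_j}u_j$; $(i_j)$ is periodic with period $N_\eta$, indices read mod $N_\eta$. $\widetilde{\mathbf M}_\eta$ is the Markov chain on $\widetilde W\times\mathbb Z/N_\eta\mathbb Z$ started at $(\mathbbm 1,0)$ where from $(u,k)$: if $\mathrm H^{(u,s_{i_k})}$ does not separate $\mathcal A u$ from $\mathcal A$, move to $(s_{i_k}u,k+1)$ with probability $p$ and to $(u,k+1)$ with probability $1-p$; otherwise move to $(u,k+1)$. $\widehat{\mathbf M}_\eta$ on $\widehat W\times\mathbb Z/N_\eta\mathbb Z$ is the same except the move to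 $(s_{i_k}u,k+1)$ is allowed only if additionally $\mathcal A s_{i_k}u\subseteq\mathcal C$. The image of $\widehat{\mathbf M}_\eta$ under $(w,k)\mapsto(\overline w,k)$ is a Markov chain $\mathbf M_\eta$ on $W\times\mathbb Z/N_\eta\mathbb Z$; $\zeta_\eta$ is its stationary distribution (when irreducible). *)

theory Defs
  imports "HOL-Analysis.Analysis" "HOL-Probability.Probability"
begin

text \<open>Conventions. V is a Euclidean space 'v; the dual V* is identified with V via
the inner product, so gamma(beta) is written gamma \<bullet> beta. Elements of the affine
Weyl group are represented by the affine maps of V* they induce (the action is
faithful). The action is a right action: the map of a product u v is
(map of v) o (map of u).\<close>

section \<open>Root systems\<close>

definition refl :: "'v::euclidean_space \<Rightarrow> 'v \<Rightarrow> 'v" where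
  "refl \<alpha> x = x - (2 * (x \<bullet> \<alpha>) / (\<alpha> \<bullet> \<alpha>)) *\<^sub>R \<alpha>"

definition coroot :: "'v::euclidean_space \<Rightarrow> 'v" where
  "coroot \<alpha> = (2 / (\<alpha> \<bullet> \<alpha>)) *\<^sub>R \<alpha>"

definition root_system :: "'v::euclidean_space set \<Rightarrow> bool" where
  "root_system \<Phi> \<longleftrightarrow> finite \<Phi> \<and> 0 \<notin> \<Phi> \<and> span \<Phi> = UNIV
     \<and> (\<forall>\<alpha>\<in>\<Phi>. refl \<alpha> ` \<Phi> = \<Phi>)
     \<and> (\<forall>\<alpha>\<in>\<Phi>. \<forall>c::real. c *\<^sub>R \<alpha> \<in> \<Phi> \<longrightarrow> c = 1 \<or> c = -1)"

definition crystallographic :: "'v::euclidean_space set \<Rightarrow> bool" where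
  "crystallographic \<Phi> \<longleftrightarrow> (\<forall>\<alpha>\<in>\<Phi>. \<forall>\<beta>\<in>\<Phi>. 2 * (\<alpha> \<bullet> \<beta>) / (\<alpha> \<bullet> \<alpha>) \<in> \<int>)"

definition irreducible_rs :: "'v::euclidean_space set \<Rightarrow> bool" where
  "irreducible_rs \<Phi> \<longleftrightarrow> \<Phi> \<noteq> {} \<and>
     \<not> (\<exists>A B. A \<noteq> {} \<and> B \<noteq> {} \<and> A \<union> B = \<Phi> \<and> A \<inter> B = {}
              \<and> (\<forall>a\<in>A. \<forall>b\<in>B. a \<bullet> b = 0))"

text \<open>Nonnegative real combinations of the simple roots.\<close>
definition nonneg_comb :: "'v::euclidean_space set \<Rightarrow> 'v \<Rightarrow> bool" where
  "nonneg_comb \<Delta> x \<longleftrightarrow> (\<exists>c::'v \<Rightarrow> real. (\<forall>\<alpha>\<in>\<Delta>. c \<alpha> \<ge> 0) \<and> x = (\<Sum>\<alpha>\<in>\<Delta>. c \<alpha> *\<^sub>R \<alpha>))"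

text \<open>A simple system (base) of the root system.\<close>
definition simple_system :: "'v::euclidean_space set \<Rightarrow> 'v set \<Rightarrow> bool" where
  "simple_system \<Phi> \<Delta> \<longleftrightarrow> \<Delta> \<subseteq> \<Phi> \<and> independent \<Delta> \<and>
     (\<forall>\<beta>\<in>\<Phi>. nonneg_comb \<Delta> \<beta> \<or> nonneg_comb \<Delta> (- \<beta>))"

definition pos_roots :: "'v::euclidean_space set \<Rightarrow> 'v set \<Rightarrow> 'v set" where
  "pos_roots \<Phi> \<Delta> = {\<beta>\<in>\<Phi>. nonneg_comb \<Delta> \<beta>}"

text \<open>Highest root: the largest root for the dominance order given by the base.\<close>
definition highest_root :: "'v::euclidean_space set \<Rightarrow> 'v set \<Rightarrow> 'v" where
  "highest_root \<Phi> \<Delta> = (THE \<theta>. \<theta> \<in> \<Phi> \<and> (\<forall>\<beta>\<in>\<Phi>. nonneg_comb \<Delta> (\<theta> - \<beta>)))"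

text \<open>Coroot lattice: integer span of the coroots.\<close>
definition coroot_lattice :: "'v::euclidean_space set \<Rightarrow> 'v set" where
  "coroot_lattice \<Phi> = {x. \<exists>c::'v \<Rightarrow> int. x = (\<Sum>\<alpha>\<in>\<Phi>. of_int (c \<alpha>) *\<^sub>R coroot \<alpha>)}"

section \<open>Hyperplanes, reflections, Weyl groups\<close>

definition hyp :: "'v::euclidean_space \<Rightarrow> int \<Rightarrow> 'v set" where
  "hyp \<beta> k = {\<gamma>. \<gamma> \<bullet> \<beta> = of_int k}"

definition hyps :: "'v::euclidean_space set \<Rightarrow> 'v set \<Rightarrow> 'v set set" where
  "hyps \<Phi> \<Delta> = {hyp \<beta> k | \<beta> k. \<beta> \<in> pos_roots \<Phi> \<Delta>}"

text \<open>Affine reflection through the hyperplane gamma(beta) = k.\<close>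
definition aff_refl :: "'v::euclidean_space \<Rightarrow> int \<Rightarrow> 'v \<Rightarrow> 'v" where
  "aff_refl \<beta> k \<gamma> = \<gamma> - (\<gamma> \<bullet> \<beta> - of_int k) *\<^sub>R coroot \<beta>"

text \<open>Group generated (under composition) by a set of maps.\<close>
inductive_set gen_group :: "('v \<Rightarrow> 'v) set \<Rightarrow> ('v \<Rightarrow> 'v) set" for G where
  gen_id: "id \<in> gen_group G"
| gen_step: "u \<in> gen_group G \<Longrightarrow> g \<in> G \<Longrightarrow> g \<circ> u \<in> gen_group G"

text \<open>Finite Weyl group: generated by the reflections s_beta (acting on V* = V).\<close>
definition weyl :: "'v::euclidean_space set \<Rightarrow> ('v \<Rightarrow> 'v) set" where
  "weyl \<Phi> = gen_group {aff_refl \<beta> 0 | \<beta>. \<beta> \<in> \<Phi>}"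

text \<open>Affine Weyl group: generated by the reflections through all hyperplanes H_beta^k.\<close>
definition aff_weyl :: "'v::euclidean_space set \<Rightarrow> ('v \<Rightarrow> 'v) set" where
  "aff_weyl \<Phi> = gen_group {aff_refl \<beta> k | \<beta> k. \<beta> \<in> \<Phi>}"

text \<open>Index set of affine simple reflections: None stands for 0, Some alpha for the
simple root alpha.\<close>
definition aff_index :: "'v set \<Rightarrow> 'v option set" where
  "aff_index \<Delta> = insert None (Some ` \<Delta>)"

fun sref :: "'v::euclidean_space set \<Rightarrow> 'v set \<Rightarrow> 'v option \<Rightarrow> 'v \<Rightarrow> 'v" where
  "sref \<Phi> \<Delta> None = aff_refl (highest_root \<Phi> \<Delta>) 1"
| "sref \<Phi> \<Delta> (Some \<alpha>) = aff_refl \<alpha> 0"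

text \<open>Group operations in the right-action encoding.\<close>
definition gmult :: "('v \<Rightarrow> 'v) \<Rightarrow> ('v \<Rightarrow> 'v) \<Rightarrow> ('v \<Rightarrow> 'v)" where
  "gmult u v = v \<circ> u"

definition ginv :: "('v \<Rightarrow> 'v) \<Rightarrow> ('v \<Rightarrow> 'v)" where
  "ginv u = inv u"

text \<open>s_i u\<close>
definition sleft :: "'v::euclidean_space set \<Rightarrow> 'v set \<Rightarrow> 'v option \<Rightarrow> ('v \<Rightarrow> 'v) \<Rightarrow> ('v \<Rightarrow> 'v)" where
  "sleft \<Phi> \<Delta> i u = gmult (sref \<Phi> \<Delta> i) u"

text \<open>Finite part: w = wbar tau_xi, where gamma tau_xi = gamma - xi.\<close>
definition wbar :: "('v::euclidean_space \<Rightarrow> 'v) \<Rightarrow> ('v \<Rightarrow> 'v)" where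
  "wbar w = (\<lambda>\<gamma>. w \<gamma> - w 0)"

text \<open>Length w.r.t. simple reflections and longest element of W.\<close>
fun word_map :: "'v::euclidean_space list \<Rightarrow> 'v \<Rightarrow> 'v" where
  "word_map [] = id"
| "word_map (a # xs) = gmult (aff_refl a 0) (word_map xs)"

definition weyl_length :: "'v::euclidean_space set \<Rightarrow> ('v \<Rightarrow> 'v) \<Rightarrow> nat" where
  "weyl_length \<Delta> w = (LEAST n. \<exists>xs. set xs \<subseteq> \<Delta> \<and> length xs = n \<and> word_map xs = w)"

definition longest :: "'v::euclidean_space set \<Rightarrow> 'v set \<Rightarrow> ('v \<Rightarrow> 'v)" where
  "longest \<Phi> \<Delta> = (THE w. w \<in> weyl \<Phi> \<and> (\<forall>v\<in>weyl \<Phi>. weyl_length \<Delta> v \<le> weyl_length \<Delta> w))"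

section \<open>Chambers and alcoves\<close>

definition fund_chamber :: "'v::euclidean_space set \<Rightarrow> 'v set" where
  "fund_chamber \<Delta> = {\<gamma>. \<forall>\<alpha>\<in>\<Delta>. \<gamma> \<bullet> \<alpha> \<ge> 0}"

definition fund_alcove :: "'v::euclidean_space set \<Rightarrow> 'v set \<Rightarrow> 'v set" where
  "fund_alcove \<Phi> \<Delta> = {\<gamma>\<in>fund_chamber \<Delta>. \<gamma> \<bullet> highest_root \<Phi> \<Delta> \<le> 1}"

definition alcove :: "'v::euclidean_space set \<Rightarrow> 'v set \<Rightarrow> ('v \<Rightarrow> 'v) \<Rightarrow> 'v set" where
  "alcove \<Phi> \<Delta> u = u ` fund_alcove \<Phi> \<Delta>"

definition chamber :: "'v::euclidean_space set \<Rightarrow> ('v \<Rightarrow> 'v) \<Rightarrow> 'v set" where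
  "chamber \<Delta> w = w ` fund_chamber \<Delta>"

text \<open>W-hat: elements whose alcove lies in the fundamental chamber.\<close>
definition dom_weyl :: "'v::euclidean_space set \<Rightarrow> 'v set \<Rightarrow> ('v \<Rightarrow> 'v) set" where
  "dom_weyl \<Phi> \<Delta> = {w\<in>aff_weyl \<Phi>. alcove \<Phi> \<Delta> w \<subseteq> fund_chamber \<Delta>}"

text \<open>The hyperplane H_beta^k (given by the pair (beta,k)) separates X from Y.\<close>
definition separates :: "'v::euclidean_space \<times> int \<Rightarrow> 'v set \<Rightarrow> 'v set \<Rightarrow> bool" where
  "separates H X Y \<longleftrightarrow>
     (X \<subseteq> {\<gamma>. \<gamma> \<bullet> fst H \<le> of_int (snd H)} \<and> Y \<subseteq> {\<gamma>. \<gamma> \<bullet> fst H \<ge> of_int (snd H)}) \<or>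
     (X \<subseteq> {\<gamma>. \<gamma> \<bullet> fst H \<ge> of_int (snd H)} \<and> Y \<subseteq> {\<gamma>. \<gamma> \<bullet> fst H \<le> of_int (snd H)})"

text \<open>H^(u,s_i): the hyperplane of the arrangement separating A u and A s_i u.\<close>
definition sep_hyp :: "'v::euclidean_space set \<Rightarrow> 'v set \<Rightarrow> ('v \<Rightarrow> 'v) \<Rightarrow> 'v option \<Rightarrow> 'v \<times> int" where
  "sep_hyp \<Phi> \<Delta> u i = (THE H. fst H \<in> pos_roots \<Phi> \<Delta> \<and>
       separates H (alcove \<Phi> \<Delta> u) (alcove \<Phi> \<Delta> (sleft \<Phi> \<Delta> i u)))"

section \<open>Rays and the periodic word\<close>

definition Upsilon :: "'v::euclidean_space set \<Rightarrow> 'v set \<Rightarrow> 'v \<Rightarrow> 'v set" where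
  "Upsilon \<Phi> \<Delta> z0 = {\<eta>\<in>coroot_lattice \<Phi> - {0}.
     \<forall>t\<ge>0. \<not> (\<exists>H1\<in>hyps \<Phi> \<Delta>. \<exists>H2\<in>hyps \<Phi> \<Delta>. H1 \<noteq> H2 \<and> z0 + t *\<^sub>R \<eta> \<in> H1 \<and> z0 + t *\<^sub>R \<eta> \<in> H2)}"

text \<open>u is the sequence of alcoves A u_0 = A, A u_1, ... successively visited by the ray
from z0 in direction eta: there are times 0 = t_0 < t_1 < ... such that the segment
of the ray between t_j and t_(j+1) lies in A u_j, and consecutive alcoves differ.\<close>
definition ray_seq :: "'v::euclidean_space set \<Rightarrow> 'v set \<Rightarrow> 'v \<Rightarrow> 'v \<Rightarrow> (nat \<Rightarrow> 'v \<Rightarrow> 'v) \<Rightarrow> bool" where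
  "ray_seq \<Phi> \<Delta> z0 \<eta> u \<longleftrightarrow> u 0 = id \<and> (\<forall>j. u j \<in> aff_weyl \<Phi>) \<and>
     (\<exists>t::nat \<Rightarrow> real. t 0 = 0 \<and> strict_mono t \<and>
        (\<forall>j. \<forall>s\<in>{t j..t (Suc j)}. z0 + s *\<^sub>R \<eta> \<in> alcove \<Phi> \<Delta> (u j))) \<and>
     (\<forall>j. alcove \<Phi> \<Delta> (u (Suc j)) \<noteq> alcove \<Phi> \<Delta> (u j))"

definition ray_alcoves :: "'v::euclidean_space set \<Rightarrow> 'v set \<Rightarrow> 'v \<Rightarrow> 'v \<Rightarrow> nat \<Rightarrow> 'v \<Rightarrow> 'v" where
  "ray_alcoves \<Phi> \<Delta> z0 \<eta> = (THE u. ray_seq \<Phi> \<Delta> z0 \<eta> u)"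

text \<open>i_j, defined by u_(j+1) = s_(i_j) u_j.\<close>
definition ray_word :: "'v::euclidean_space set \<Rightarrow> 'v set \<Rightarrow> 'v \<Rightarrow> 'v \<Rightarrow> nat \<Rightarrow> 'v option" where
  "ray_word \<Phi> \<Delta> z0 \<eta> j = (THE i. i \<in> aff_index \<Delta> \<and>
      ray_alcoves \<Phi> \<Delta> z0 \<eta> (Suc j) = sleft \<Phi> \<Delta> i (ray_alcoves \<Phi> \<Delta> z0 \<eta> j))"

text \<open>N_eta: the (minimal) period of the sequence (i_j).\<close>
definition period :: "'v::euclidean_space set \<Rightarrow> 'v set \<Rightarrow> 'v \<Rightarrow> 'v \<Rightarrow> nat" where
  "period \<Phi> \<Delta> z0 \<eta> = (LEAST n. n > 0 \<and> (\<forall>j. ray_word \<Phi> \<Delta> z0 \<eta> (j + n) = ray_word \<Phi> \<Delta> z0 \<eta> j))"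

section \<open>The Markov chains\<close>

text \<open>The chain tilde-M_eta, realised from i.i.d. coins c_0, c_1, ... with
P(c_M = True) = p: at time M, in state (u, M mod N), with i = i_(M mod N), if the move
is allowed the chain moves to s_i u iff c_M is True. Returns u_M.\<close>
fun walk :: "'v::euclidean_space set \<Rightarrow> 'v set \<Rightarrow> 'v \<Rightarrow> 'v \<Rightarrow> (nat \<Rightarrow> bool) \<Rightarrow> nat \<Rightarrow> 'v \<Rightarrow> 'v" where
  "walk \<Phi> \<Delta> z0 \<eta> c 0 = id"
| "walk \<Phi> \<Delta> z0 \<eta> c (Suc M) =
    (let u = walk \<Phi> \<Delta> z0 \<eta> c M;
         i = ray_word \<Phi> \<Delta> z0 \<eta> (M mod period \<Phi> \<Delta> z0 \<eta>)
     in if \<not> separates (sep_hyp \<Phi> \<Delta> u i) (alcove \<Phi> \<Delta> u) (fund_alcove \<Phi> \<Delta>) \<and> c M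
        then sleft \<Phi> \<Delta> i u else u)"

text \<open>Whether hat-M_eta may move from (w,k) (w in W-hat).\<close>
definition hat_allowed :: "'v::euclidean_space set \<Rightarrow> 'v set \<Rightarrow> 'v \<Rightarrow> 'v \<Rightarrow> ('v \<Rightarrow> 'v) \<Rightarrow> nat \<Rightarrow> bool" where
  "hat_allowed \<Phi> \<Delta> z0 \<eta> w k \<longleftrightarrow>
     (let i = ray_word \<Phi> \<Delta> z0 \<eta> k in
       \<not> separates (sep_hyp \<Phi> \<Delta> w i) (alcove \<Phi> \<Delta> w) (fund_alcove \<Phi> \<Delta>) \<and>
       alcove \<Phi> \<Delta> (sleft \<Phi> \<Delta> i w) \<subseteq> fund_chamber \<Delta>)"

text \<open>Transition probabilities of M_eta on W x Z/N (Z/N represented by {0..<N}):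
the image of the transition of hat-M_eta from a lift w in W-hat of v.\<close>
definition M_trans :: "'v::euclidean_space set \<Rightarrow> 'v set \<Rightarrow> 'v \<Rightarrow> real \<Rightarrow> 'v \<Rightarrow>
    ('v \<Rightarrow> 'v) \<times> nat \<Rightarrow> ('v \<Rightarrow> 'v) \<times> nat \<Rightarrow> real" where
  "M_trans \<Phi> \<Delta> z0 p \<eta> x y =
     (let (v, k) = x; (v', k') = y; N = period \<Phi> \<Delta> z0 \<eta>;
          w = (SOME w. w \<in> dom_weyl \<Phi> \<Delta> \<and> wbar w = v);
          i = ray_word \<Phi> \<Delta> z0 \<eta> k
      in if k' \<noteq> Suc k mod N then 0
         else if hat_allowed \<Phi> \<Delta> z0 \<eta> w k
         then p * (if wbar (sleft \<Phi> \<Delta> i w) = v' then 1 else 0)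
              + (1 - p) * (if v' = v then 1 else 0)
         else (if v' = v then 1 else 0))"

definition M_states :: "'v::euclidean_space set \<Rightarrow> 'v set \<Rightarrow> 'v \<Rightarrow> 'v \<Rightarrow> (('v \<Rightarrow> 'v) \<times> nat) set" where
  "M_states \<Phi> \<Delta> z0 \<eta> = weyl \<Phi> \<times> {..<period \<Phi> \<Delta> z0 \<eta>}"

definition M_irreducible :: "'v::euclidean_space set \<Rightarrow> 'v set \<Rightarrow> 'v \<Rightarrow> real \<Rightarrow> 'v \<Rightarrow> bool" where
  "M_irreducible \<Phi> \<Delta> z0 p \<eta> \<longleftrightarrow>
     (let S = M_states \<Phi> \<Delta> z0 \<eta>;
          R = {(x, y). x \<in> S \<and> y \<in> S \<and> M_trans \<Phi> \<Delta> z0 p \<eta> x y > 0}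
      in \<forall>x\<in>S. \<forall>y\<in>S. (x, y) \<in> R\<^sup>*)"

definition M_stationary :: "'v::euclidean_space set \<Rightarrow> 'v set \<Rightarrow> 'v \<Rightarrow> real \<Rightarrow> 'v \<Rightarrow>
    (('v \<Rightarrow> 'v) \<times> nat \<Rightarrow> real) \<Rightarrow> bool" where
  "M_stationary \<Phi> \<Delta> z0 p \<eta> \<zeta> \<longleftrightarrow>
     (let S = M_states \<Phi> \<Delta> z0 \<eta> in
       (\<forall>x. \<zeta> x \<ge> 0) \<and> (\<forall>x. x \<notin> S \<longrightarrow> \<zeta> x = 0) \<and> (\<Sum>x\<in>S. \<zeta> x) = 1 \<and>
       (\<forall>y\<in>S. (\<Sum>x\<in>S. \<zeta> x * M_trans \<Phi> \<Delta> z0 p \<eta> x y) = \<zeta> y))"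

definition zeta :: "'v::euclidean_space set \<Rightarrow> 'v set \<Rightarrow> 'v \<Rightarrow> real \<Rightarrow> 'v \<Rightarrow> ('v \<Rightarrow> 'v) \<times> nat \<Rightarrow> real" where
  "zeta \<Phi> \<Delta> z0 p \<eta> = (THE \<zeta>. M_stationary \<Phi> \<Delta> z0 p \<eta> \<zeta>)"

text \<open>Probability space: a fair coin for epsilon (True means epsilon = +1) together with
i.i.d. Bernoulli(p) coins driving the walk.\<close>
definition coin_space :: "real \<Rightarrow> (bool \<times> (nat \<Rightarrow> bool)) measure" where
  "coin_space p = measure_pmf (bernoulli_pmf (1/2)) \<Otimes>\<^sub>M (\<Pi>\<^sub>M n\<in>(UNIV::nat set). measure_pmf (bernoulli_pmf p))"

definition eps_walk :: "'v::euclidean_space set \<Rightarrow> 'v set \<Rightarrow> 'v \<Rightarrow> 'v \<Rightarrow> bool \<times> (nat \<Rightarrow> bool) \<Rightarrow> nat \<Rightarrow> 'v \<Rightarrow> 'v" where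
  "eps_walk \<Phi> \<Delta> z0 \<eta> \<omega> = walk \<Phi> \<Delta> z0 (if fst \<omega> then \<eta> else - \<eta>) (snd \<omega>)"

end

theory Submission
  imports Defs
begin

text \<open>The walk is a Demazure product of a random subword, and reversing a word inverts its Demazure
  product; since the word of \<open>- \<eta>\<close> is the reversed word of \<open>\<eta>\<close>, after a multiple of the period
  the walk for \<open>\<eta>\<close> is distributed as the inverse of the walk for \<open>- \<eta>\<close>. Write an element as
  \<open>v \<circ> h\<close> with \<open>v\<close> in the Weyl group and \<open>h\<close> dominant; then \<open>h\<close> performs the dominant
  walk, and once its translation part is regular the chamber of the inverse is
  \<open>inv (wbar h) \<circ> w\<close> with \<open>w\<close> the longest element. No hyperplane is crossed twice, so chambers stabilise
  surely, and irreducibility forces every hyperplane direction to be crossed, so regularity holds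
  eventually almost surely. Hence the law of \<open>wbar h\<close> converges along multiples of the period, and its limit
  has to be the stationary distribution.\<close>

section \<open>Irreducible root systems\<close>

text \<open>The chamber of a walk settles, while the finite part of its dominant factor keeps
  moving, so the stationary law says nothing direct about the limit. Inversion exchanges the two
  roles: with \<open>u = v o h\<close>, the factor \<open>v\<close> moves the base point of
  \<open>inv u\<close> only by a bounded amount and the translation part of \<open>h\<close> decides
  the chamber. Inversion is compatible with the walk because Demazure steps on the two sides of an
  element commute, and with the probability because independent coins may be read backwards.

  The chain on pairs is periodic in its second coordinate, so its laws cannot converge at all times.
  Existence of the limit is taken from the settling of the chamber instead, and only uniqueness of
  the stationary vector and a maximum principle are required of the chain. Each of the
  \<open>N\<close> slices carries stationary mass \<open>1 / N\<close>; this is where the factor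
  \<open>N\<close> comes from. The limit law for \<eta> alone is \<open>N\<close> times the
  stationary law of \<open>- \<eta>\<close>, and the random sign averages the two
  directions.\<close>

lemma aff_refl_0: "aff_refl \<beta> 0 = refl \<beta>"
  by (auto simp: aff_refl_def refl_def coroot_def fun_eq_iff)

lemma refl_self: "\<alpha> \<noteq> 0 \<Longrightarrow> refl \<alpha> \<alpha> = - \<alpha>"
  by (simp add: refl_def scaleR_2)

lemma refl_neg: "refl (- \<alpha>) = refl \<alpha>"
  by (auto simp: refl_def fun_eq_iff)

lemma inner_refl_refl: "\<alpha> \<noteq> 0 \<Longrightarrow> refl \<alpha> x \<bullet> refl \<alpha> y = x \<bullet> y"
  by (simp add: refl_def inner_diff inner_commute field_simps)

lemma refl_refl: "\<alpha> \<noteq> 0 \<Longrightarrow> refl \<alpha> (refl \<alpha> x) = x"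
  by (simp add: refl_def inner_diff algebra_simps flip: scaleR_add_left)

lemma linear_refl: "linear (refl \<alpha>)"
  by (auto intro!: linearI simp: refl_def algebra_simps inner_add_left add_divide_distrib)

locale irreducible_root_system =
  fixes \<Phi> \<Delta> :: "'v::euclidean_space set"
  assumes root_system: "root_system \<Phi>" and crystallographic: "crystallographic \<Phi>"
    and irreducible: "irreducible_rs \<Phi>" and simple: "simple_system \<Phi> \<Delta>"
begin

abbreviation "Pos \<equiv> pos_roots \<Phi> \<Delta>"
abbreviation "cf \<equiv> representation \<Delta>"

lemma finite_roots: "finite \<Phi>" and zero_not_root: "0 \<notin> \<Phi>" and span_roots: "span \<Phi> = UNIV"
  using root_system by (auto simp: root_system_def)

lemma refl_root: "\<alpha> \<in> \<Phi> \<Longrightarrow> \<beta> \<in> \<Phi> \<Longrightarrow> refl \<alpha> \<beta> \<in> \<Phi>"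
  using root_system by (auto simp: root_system_def)

lemma root_scale: "\<alpha> \<in> \<Phi> \<Longrightarrow> c *\<^sub>R \<alpha> \<in> \<Phi> \<Longrightarrow> c = 1 \<or> c = -1"
  using root_system by (auto simp: root_system_def)

lemma root_nonzero: "\<alpha> \<in> \<Phi> \<Longrightarrow> \<alpha> \<noteq> 0"
  using zero_not_root by auto

lemma neg_root: "\<alpha> \<in> \<Phi> \<Longrightarrow> - \<alpha> \<in> \<Phi>"
  using refl_root[of \<alpha> \<alpha>] refl_self[of \<alpha>] root_nonzero[of \<alpha>] by auto

lemma simple_roots: "\<Delta> \<subseteq> \<Phi>" and independent_simple: "independent \<Delta>"
  using simple by (auto simp: simple_system_def)

lemma finite_simple: "finite \<Delta>"
  using simple_roots finite_roots finite_subset by auto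

lemma pos_root: "\<beta> \<in> Pos \<Longrightarrow> \<beta> \<in> \<Phi>"
  by (auto simp: pos_roots_def)

lemma span_simple: "span \<Delta> = UNIV"
proof -
  have "\<beta> \<in> span \<Delta>" if "\<beta> \<in> \<Phi>" for \<beta>
  proof -
    have *: "x \<in> span \<Delta>" if "nonneg_comb \<Delta> x" for x
      using that by (auto simp: nonneg_comb_def intro!: span_sum intro: span_scale span_base)
    then show ?thesis
      using simple that span_neg[of "- \<beta>" \<Delta>] by (fastforce simp: simple_system_def)
  qed
  then have "span \<Phi> \<subseteq> span \<Delta>" by (intro span_minimal) auto
  then show ?thesis using span_roots by auto
qed

section \<open>Coordinates in the base and signs of roots\<close>

lemma cf_add [simp]: "cf (x + y) \<alpha> = cf x \<alpha> + cf y \<alpha>"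
  and cf_diff [simp]: "cf (x - y) \<alpha> = cf x \<alpha> - cf y \<alpha>"
  and cf_scale [simp]: "cf (c *\<^sub>R x) \<alpha> = c * cf x \<alpha>"
  and cf_neg [simp]: "cf (- x) \<alpha> = - cf x \<alpha>"
  using representation_add[OF independent_simple] representation_diff[OF independent_simple]
    representation_scale[OF independent_simple] representation_neg[OF independent_simple]
  by (auto simp: span_simple)

lemma cf_sum: "cf (sum f A) \<alpha> = (\<Sum>i\<in>A. cf (f i) \<alpha>)"
  using representation_sum[OF independent_simple, of A f] by (simp add: span_simple)

lemma cf_simple: "\<alpha> \<in> \<Delta> \<Longrightarrow> cf \<alpha> \<gamma> = (if \<gamma> = \<alpha> then 1 else 0)"
  using representation_basis[OF independent_simple, of \<alpha>] by simp

lemma sum_cf: "(\<Sum>\<alpha>\<in>\<Delta>. cf x \<alpha> *\<^sub>R \<alpha>) = x"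
  using sum_representation_eq[OF independent_simple _ finite_simple order_refl] by (simp add: span_simple)

lemma cf_eqI: "(\<And>\<alpha>. \<alpha> \<in> \<Delta> \<Longrightarrow> cf x \<alpha> = cf y \<alpha>) \<Longrightarrow> x = y"
  using sum_cf[of x] sum_cf[of y] by (metis (mono_tags, lifting) sum.cong)

lemma nonneg_comb_iff: "nonneg_comb \<Delta> x \<longleftrightarrow> (\<forall>\<alpha>\<in>\<Delta>. cf x \<alpha> \<ge> 0)"
proof
  assume "nonneg_comb \<Delta> x"
  then obtain c where c: "\<forall>\<alpha>\<in>\<Delta>. c \<alpha> \<ge> (0::real)" "x = (\<Sum>\<alpha>\<in>\<Delta>. c \<alpha> *\<^sub>R \<alpha>)"
    by (auto simp: nonneg_comb_def)
  have "cf x \<gamma> = c \<gamma>" if "\<gamma> \<in> \<Delta>" for \<gamma>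
  proof -
    have "cf x \<gamma> = (\<Sum>\<alpha>\<in>\<Delta>. c \<alpha> * (if \<gamma> = \<alpha> then 1 else 0))"
      unfolding c(2) cf_sum by (rule sum.cong) (auto simp: cf_simple)
    then show ?thesis using that finite_simple by (simp add: if_distrib cong: if_cong)
  qed
  then show "\<forall>\<alpha>\<in>\<Delta>. cf x \<alpha> \<ge> 0" using c by auto
next
  assume "\<forall>\<alpha>\<in>\<Delta>. cf x \<alpha> \<ge> 0"
  then show "nonneg_comb \<Delta> x"
    unfolding nonneg_comb_def by (intro exI[of _ "cf x"]) (auto simp: sum_cf)
qed

lemma inner_cf: "x \<bullet> y = (\<Sum>\<alpha>\<in>\<Delta>. cf x \<alpha> * (\<alpha> \<bullet> y))"
  by (subst sum_cf[of x, symmetric]) (simp add: inner_sum_left)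

lemma pos_cf: "\<beta> \<in> Pos \<Longrightarrow> \<alpha> \<in> \<Delta> \<Longrightarrow> cf \<beta> \<alpha> \<ge> 0"
  by (auto simp: pos_roots_def nonneg_comb_iff)

lemma pos_or_neg: "\<beta> \<in> \<Phi> \<Longrightarrow> \<beta> \<in> Pos \<or> - \<beta> \<in> Pos"
  using simple neg_root by (auto simp: pos_roots_def simple_system_def)

lemma not_pos_and_neg: "\<beta> \<in> Pos \<Longrightarrow> - \<beta> \<notin> Pos"
proof
  assume "\<beta> \<in> Pos" "- \<beta> \<in> Pos"
  then have "\<beta> = 0" using pos_cf[of \<beta>] pos_cf[of "- \<beta>"] 
    by (intro cf_eqI) (force simp: representation_zero)
  then show False using \<open>\<beta> \<in> Pos\<close> pos_root root_nonzero by auto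
qed

lemma neg_pos_iff: "\<beta> \<in> \<Phi> \<Longrightarrow> - \<beta> \<in> Pos \<longleftrightarrow> \<beta> \<notin> Pos"
  using pos_or_neg not_pos_and_neg by auto

lemma simple_pos: "\<alpha> \<in> \<Delta> \<Longrightarrow> \<alpha> \<in> Pos"
  using simple_roots by (auto simp: pos_roots_def nonneg_comb_iff cf_simple)

text \<open>All coordinates of a root have the same weak sign, so a single positive one settles
  it.\<close>

lemma pos_rootI: "\<beta> \<in> \<Phi> \<Longrightarrow> \<alpha> \<in> \<Delta> \<Longrightarrow> cf \<beta> \<alpha> > 0 \<Longrightarrow> \<beta> \<in> Pos"
  using pos_or_neg[of \<beta>] pos_cf[of "- \<beta>" \<alpha>] by auto

lemma ex_pos_cf: assumes "\<beta> \<in> Pos" shows "\<exists>\<alpha>\<in>\<Delta>. cf \<beta> \<alpha> > 0"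
proof (rule ccontr)
  assume "\<not> ?thesis"
  then have "\<beta> = 0" using pos_cf[OF assms] by (intro cf_eqI) (force simp: representation_zero)
  then show False using assms pos_root root_nonzero by auto
qed

lemma cf_refl: "\<alpha> \<in> \<Delta> \<Longrightarrow> cf (refl \<alpha> \<beta>) \<gamma> = cf \<beta> \<gamma> - (if \<gamma> = \<alpha> then 2 * (\<beta> \<bullet> \<alpha>) / (\<alpha> \<bullet> \<alpha>) else 0)"
  by (simp add: refl_def cf_simple)

text \<open>The reflection changes only the coordinate at \<alpha>. A positive root other than
  \<alpha> has a second positive coordinate, since otherwise it would be a multiple of \<alpha>, and
  that coordinate survives.\<close>

lemma refl_simple_pos:
  assumes "\<alpha> \<in> \<Delta>" "\<beta> \<in> Pos" "\<beta> \<noteq> \<alpha>" shows "refl \<alpha> \<beta> \<in> Pos"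
proof -
  have "\<exists>\<gamma>\<in>\<Delta>. \<gamma> \<noteq> \<alpha> \<and> cf \<beta> \<gamma> > 0"
  proof (rule ccontr)
    assume "\<not> ?thesis"
    then have z: "cf \<beta> \<gamma> = 0" if "\<gamma> \<in> \<Delta>" "\<gamma> \<noteq> \<alpha>" for \<gamma> using pos_cf[OF assms(2)] that by force
    have eq: "\<beta> = cf \<beta> \<alpha> *\<^sub>R \<alpha>"
      by (rule cf_eqI) (use assms(1) z in \<open>auto simp: cf_simple\<close>)
    then have "cf \<beta> \<alpha> = 1 \<or> cf \<beta> \<alpha> = -1"
      using root_scale[of \<alpha> "cf \<beta> \<alpha>"] assms simple_roots pos_root by auto
    then have "cf \<beta> \<alpha> = 1" using pos_cf[OF assms(2,1)] by auto
    then show False using eq assms(3) by auto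
  qed
  then obtain \<gamma> where "\<gamma> \<in> \<Delta>" "\<gamma> \<noteq> \<alpha>" "cf \<beta> \<gamma> > 0" by auto
  then show ?thesis
    using assms simple_roots pos_root by (intro pos_rootI[of _ \<gamma>] refl_root) (auto simp: cf_refl)
qed

section \<open>Angles between roots and connectedness of the base\<close>

lemma pairing_int: "\<alpha> \<in> \<Phi> \<Longrightarrow> \<beta> \<in> \<Phi> \<Longrightarrow> 2 * (\<beta> \<bullet> \<alpha>) / (\<alpha> \<bullet> \<alpha>) \<in> \<int>"
  using crystallographic by (auto simp: crystallographic_def inner_commute)

text \<open>Both Cartan integers are negative. If both were at most -2, the squared norm of the sum
  would be nonpositive; so one of them is -1 and the corresponding reflection produces the
  sum.\<close>

lemma add_root:
  assumes "\<alpha> \<in> \<Phi>" "\<beta> \<in> \<Phi>" "\<alpha> \<bullet> \<beta> < 0" "\<alpha> \<noteq> - \<beta>" shows "\<alpha> + \<beta> \<in> \<Phi>"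
proof -
  obtain m where m: "2 * (\<beta> \<bullet> \<alpha>) / (\<alpha> \<bullet> \<alpha>) = of_int m" using pairing_int[OF assms(1,2)] by (auto elim: Ints_cases)
  obtain n where n: "2 * (\<alpha> \<bullet> \<beta>) / (\<beta> \<bullet> \<beta>) = of_int n" using pairing_int[OF assms(2,1)] by (auto elim: Ints_cases)
  have pa: "\<alpha> \<bullet> \<alpha> > 0" and pb: "\<beta> \<bullet> \<beta> > 0" using assms(1,2) root_nonzero by auto
  have mn: "m < 0" "n < 0"
  proof -
    have "2 * (\<beta> \<bullet> \<alpha>) / (\<alpha> \<bullet> \<alpha>) < 0" using pa assms(3) by (simp add: divide_neg_pos inner_commute)
    then show "m < 0" using m by auto
    have "2 * (\<alpha> \<bullet> \<beta>) / (\<beta> \<bullet> \<beta>) < 0" using pb assms(3) by (simp add: divide_neg_pos)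
    then show "n < 0" using n by auto
  qed
  have "m = -1 \<or> n = -1"
  proof (rule ccontr)
    assume "\<not> ?thesis"
    then have "m \<le> -2" "n \<le> -2" using mn by auto
    then have le: "2 * (\<beta> \<bullet> \<alpha>) / (\<alpha> \<bullet> \<alpha>) \<le> -2" "2 * (\<alpha> \<bullet> \<beta>) / (\<beta> \<bullet> \<beta>) \<le> -2" unfolding m n by auto
    then have "\<alpha> \<bullet> \<beta> \<le> - (\<alpha> \<bullet> \<alpha>)" "\<alpha> \<bullet> \<beta> \<le> - (\<beta> \<bullet> \<beta>)" using pa pb by (auto simp: field_simps inner_commute)
    then have "(\<alpha> + \<beta>) \<bullet> (\<alpha> + \<beta>) \<le> 0" by (simp add: inner_add inner_commute)
    then have "\<alpha> + \<beta> = 0" by (metis inner_eq_zero_iff inner_ge_zero order_antisym)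
    then show False using assms(4) by (simp add: eq_neg_iff_add_eq_0)
  qed
  then show ?thesis
  proof
    assume "m = -1"
    then have "refl \<alpha> \<beta> = \<beta> + \<alpha>" using m by (simp add: refl_def)
    then show ?thesis using refl_root[OF assms(1,2)] by (simp add: add.commute)
  next
    assume "n = -1"
    then have "refl \<beta> \<alpha> = \<alpha> + \<beta>" using n by (simp add: refl_def)
    then show ?thesis using refl_root[OF assms(2,1)] by simp
  qed
qed

text \<open>At an acute angle the difference would be a root with coordinates of both signs.\<close>

lemma simple_obtuse:
  assumes "\<alpha> \<in> \<Delta>" "\<gamma> \<in> \<Delta>" "\<alpha> \<noteq> \<gamma>" shows "\<alpha> \<bullet> \<gamma> \<le> 0"
proof (rule ccontr)
  assume "\<not> ?thesis"
  then have "\<alpha> + (- \<gamma>) \<in> \<Phi>"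
    using assms simple_roots neg_root by (intro add_root) auto
  then show False
    using pos_rootI[of "\<alpha> - \<gamma>" \<alpha>] pos_cf[of "\<alpha> - \<gamma>" \<gamma>] assms by (auto simp: cf_simple)
qed

definition ht :: "'v \<Rightarrow> real" where "ht x = (\<Sum>\<alpha>\<in>\<Delta>. cf x \<alpha>)"

lemma ht_add: "ht (x + y) = ht x + ht y" and ht_neg: "ht (- x) = - ht x"
  by (auto simp: ht_def sum.distrib sum_negf)

lemma ht_simple: "\<alpha> \<in> \<Delta> \<Longrightarrow> ht \<alpha> = 1"
  using finite_simple by (simp add: ht_def cf_simple)

lemma ht_pos: assumes "\<beta> \<in> Pos" shows "ht \<beta> > 0"
proof -
  obtain \<alpha> where "\<alpha> \<in> \<Delta>" "cf \<beta> \<alpha> > 0" using ex_pos_cf[OF assms] by auto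
  then show ?thesis unfolding ht_def using pos_cf[OF assms] finite_simple by (intro sum_pos2) auto
qed

text \<open>Minimal counterexample by height: a mixed positive root pairs positively with some
  simple root, and reflecting there gives a lower positive root that is still mixed.\<close>

lemma orthogonal_split_roots:
  assumes J: "J \<subseteq> \<Delta>" and orth: "\<forall>\<alpha>\<in>J. \<forall>\<gamma>\<in>\<Delta> - J. \<alpha> \<bullet> \<gamma> = 0" and b: "\<beta> \<in> Pos"
  shows "(\<forall>\<alpha>\<in>J. cf \<beta> \<alpha> = 0) \<or> (\<forall>\<alpha>\<in>\<Delta> - J. cf \<beta> \<alpha> = 0)"
proof (rule ccontr)
  define mixed where "mixed x \<longleftrightarrow> (\<exists>\<alpha>\<in>J. cf x \<alpha> \<noteq> 0) \<and> (\<exists>\<alpha>\<in>\<Delta> - J. cf x \<alpha> \<noteq> 0)" for x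
  assume "\<not> ?thesis"
  then have ne: "{\<beta>\<in>Pos. mixed \<beta>} \<noteq> {}" using b by (auto simp: mixed_def)
  have "finite {\<beta>\<in>Pos. mixed \<beta>}" using finite_roots pos_root by (auto intro: finite_subset[of _ \<Phi>])
  then obtain \<delta> where \<delta>: "\<delta> \<in> Pos" "mixed \<delta>" and min: "\<And>\<epsilon>. \<epsilon> \<in> Pos \<Longrightarrow> mixed \<epsilon> \<Longrightarrow> ht \<delta> \<le> ht \<epsilon>"
    using arg_min_if_finite[OF _ ne, of ht] by (smt (verit) mem_Collect_eq)
  have "\<exists>\<alpha>\<in>\<Delta>. \<delta> \<bullet> \<alpha> > 0"
  proof (rule ccontr)
    assume "\<not> ?thesis"
    then have "(\<Sum>\<alpha>\<in>\<Delta>. cf \<delta> \<alpha> * (\<alpha> \<bullet> \<delta>)) \<le> 0"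
      using pos_cf[OF \<delta>(1)] by (intro sum_nonpos mult_nonneg_nonpos) (auto simp: inner_commute not_less)
    then have "\<delta> \<bullet> \<delta> \<le> 0" using inner_cf[of \<delta> \<delta>] by simp
    then show False using root_nonzero[OF pos_root[OF \<delta>(1)]] by (simp add: not_le flip: not_less)
  qed
  then obtain \<alpha> where \<alpha>: "\<alpha> \<in> \<Delta>" "\<delta> \<bullet> \<alpha> > 0" by auto
  have aa: "\<alpha> \<bullet> \<alpha> > 0" using \<alpha> simple_roots root_nonzero by auto
  \<comment> \<open>The argument is symmetric in the two blocks; \<open>K\<close> is the one
    containing \<alpha>.\<close>
  obtain K where K: "K = J \<or> K = \<Delta> - J" "\<alpha> \<in> K" using \<alpha> by auto
  have orthK: "\<gamma> \<bullet> \<alpha> = 0" if "\<gamma> \<in> \<Delta> - K" for \<gamma>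
    using K orth that J by (metis DiffD1 DiffD2 DiffI inner_commute subsetD)
  have mixK: "(\<exists>\<alpha>\<in>K. cf x \<alpha> \<noteq> 0) \<and> (\<exists>\<alpha>\<in>\<Delta> - K. cf x \<alpha> \<noteq> 0) \<longleftrightarrow> mixed x" for x
    using K J by (auto simp: mixed_def) 
  have ne: "\<delta> \<noteq> \<alpha>"
    using \<delta>(2) K(2) \<alpha>(1) unfolding mixK[symmetric] by (auto simp: cf_simple split: if_splits)
  have rp: "refl \<alpha> \<delta> \<in> Pos" using refl_simple_pos[OF \<alpha>(1) \<delta>(1) ne] .
  have ht: "ht (refl \<alpha> \<delta>) = ht \<delta> - 2 * (\<delta> \<bullet> \<alpha>) / (\<alpha> \<bullet> \<alpha>)"
    unfolding ht_def using \<alpha>(1) finite_simple by (simp add: cf_refl sum_subtractf)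
  \<comment> \<open>The part outside \<open>K\<close> is untouched. If nothing were left inside
    \<open>K\<close>, the reflected root would be orthogonal to \<alpha>, hence fixed by the
    reflection, although its height has dropped.\<close>
  have "mixed (refl \<alpha> \<delta>)"
  proof (rule ccontr)
    assume n: "\<not> mixed (refl \<alpha> \<delta>)"
    have "\<exists>\<gamma>\<in>\<Delta> - K. cf (refl \<alpha> \<delta>) \<gamma> \<noteq> 0"
      using \<delta>(2) K(2) unfolding mixK[symmetric] by (auto simp: cf_refl \<alpha>)
    then have z: "\<forall>\<gamma>\<in>K. cf (refl \<alpha> \<delta>) \<gamma> = 0" using n unfolding mixK[symmetric] by auto
    have "refl \<alpha> \<delta> \<bullet> \<alpha> = 0"
      unfolding inner_cf[of "refl \<alpha> \<delta>"] using z orthK by (intro sum.neutral) auto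
    then have "refl \<alpha> (refl \<alpha> \<delta>) = refl \<alpha> \<delta>" by (simp add: refl_def[of \<alpha> "refl \<alpha> \<delta>"])
    then have "\<delta> = refl \<alpha> \<delta>" using refl_refl[of \<alpha> \<delta>] aa by auto
    then have "ht \<delta> = ht \<delta> - 2 * (\<delta> \<bullet> \<alpha>) / (\<alpha> \<bullet> \<alpha>)" using ht by simp
    then show False using \<alpha> aa by simp
  qed
  then show False using min[OF rp] ht \<alpha> aa by (simp add: field_simps)
qed

text \<open>Irreducibility speaks of splittings of all roots. This transfers it to the base: the
  Dynkin diagram is connected.\<close>

lemma simple_connected:
  assumes J: "J \<subseteq> \<Delta>" and orth: "\<forall>\<alpha>\<in>J. \<forall>\<gamma>\<in>\<Delta> - J. \<alpha> \<bullet> \<gamma> = 0" and ne: "J \<noteq> {}"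
  shows "J = \<Delta>"
proof (rule ccontr)
  assume neq: "J \<noteq> \<Delta>"
  define A where "A = {\<beta>\<in>\<Phi>. \<forall>\<alpha>\<in>\<Delta> - J. cf \<beta> \<alpha> = 0}"
  define B where "B = {\<beta>\<in>\<Phi>. \<forall>\<alpha>\<in>J. cf \<beta> \<alpha> = 0}"
  have "A \<union> B = \<Phi>"
  proof -
    have "\<beta> \<in> A \<union> B" if "\<beta> \<in> \<Phi>" for \<beta>
      using pos_or_neg[OF that] orthogonal_split_roots[OF J orth, of \<beta>]
        orthogonal_split_roots[OF J orth, of "- \<beta>"] that by (auto simp: A_def B_def)
    then show ?thesis by (auto simp: A_def B_def)
  qed
  moreover have "A \<inter> B = {}"
  proof -
    have "\<beta> = 0" if "\<beta> \<in> A" "\<beta> \<in> B" for \<beta>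
      using that by (intro cf_eqI) (auto simp: A_def B_def representation_zero)
    then show ?thesis using zero_not_root by (auto simp: A_def)
  qed
  moreover have "\<forall>a\<in>A. \<forall>b\<in>B. a \<bullet> b = 0"
  proof (intro ballI)
    fix a b assume ab: "a \<in> A" "b \<in> B"
    have "a \<bullet> b = (\<Sum>\<alpha>\<in>\<Delta>. \<Sum>\<gamma>\<in>\<Delta>. cf a \<alpha> * (cf b \<gamma> * (\<gamma> \<bullet> \<alpha>)))"
      unfolding inner_cf[of a b] by (intro sum.cong refl) (simp add: inner_commute[of _ b] inner_cf[of b] sum_distrib_left)
    also have "\<dots> = 0"
    proof (intro sum.neutral ballI)
      fix \<alpha> \<gamma> assume "\<alpha> \<in> \<Delta>" "\<gamma> \<in> \<Delta>"
      then show "cf a \<alpha> * (cf b \<gamma> * (\<gamma> \<bullet> \<alpha>)) = 0"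
        using ab orth by (cases "\<alpha> \<in> J"; cases "\<gamma> \<in> J") (auto simp: A_def B_def inner_commute)
    qed
    finally show "a \<bullet> b = 0" .
  qed
  moreover have "A \<noteq> {}"
  proof -
    obtain \<alpha> where "\<alpha> \<in> J" using ne by auto
    then have "\<alpha> \<in> A" using J simple_roots by (auto simp: A_def cf_simple subset_iff)
    then show ?thesis by auto
  qed
  moreover have "B \<noteq> {}"
  proof -
    obtain \<alpha> where "\<alpha> \<in> \<Delta>" "\<alpha> \<notin> J" using neq J by auto
    then have "\<alpha> \<in> B" using simple_roots by (auto simp: B_def cf_simple)
    then show ?thesis by auto
  qed
  ultimately show False using irreducible unfolding irreducible_rs_def by blast
qed

section \<open>Existence and extremal properties of the highest root\<close>

lemma ex_highest_root: "\<exists>\<theta>. \<theta> \<in> \<Phi> \<and> (\<forall>\<beta>\<in>\<Phi>. nonneg_comb \<Delta> (\<theta> - \<beta>))"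
proof -
  have nePhi: "\<Phi> \<noteq> {}" using irreducible by (simp add: irreducible_rs_def)
  obtain \<theta> where \<theta>: "\<theta> \<in> \<Phi>" and max: "\<And>\<beta>. \<beta> \<in> \<Phi> \<Longrightarrow> ht \<beta> \<le> ht \<theta>"
    using arg_min_if_finite[OF finite_roots nePhi, of "\<lambda>x. - ht x"] by (metis neg_less_iff_less not_le)
  have P\<theta>: "\<theta> \<in> Pos"
    using pos_or_neg[OF \<theta>] max[OF neg_root[OF \<theta>]] ht_pos[of "- \<theta>"] by (auto simp: ht_neg)
  have dom: "\<theta> \<bullet> \<alpha> \<ge> 0" if "\<alpha> \<in> \<Delta>" for \<alpha>
  proof (rule ccontr)
    assume "\<not> ?thesis"
    moreover have "\<theta> \<noteq> - \<alpha>" using P\<theta> that not_pos_and_neg simple_pos by auto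
    ultimately have "\<theta> + \<alpha> \<in> \<Phi>" using \<theta> that simple_roots by (intro add_root) auto
    then show False using max[of "\<theta> + \<alpha>"] that by (auto simp: ht_add ht_simple)
  qed
  \<comment> \<open>Against a simple root outside the support of \<theta> every summand of the
    pairing is nonpositive while the sum is nonnegative. So all summands vanish and the support is
    an orthogonal block.\<close>
  have full: "{\<alpha>\<in>\<Delta>. cf \<theta> \<alpha> \<noteq> 0} = \<Delta>"
  proof (rule simple_connected)
    show "{\<alpha>\<in>\<Delta>. cf \<theta> \<alpha> \<noteq> 0} \<noteq> {}" using ex_pos_cf[OF P\<theta>] by auto
    show "\<forall>\<alpha>\<in>{\<alpha>\<in>\<Delta>. cf \<theta> \<alpha> \<noteq> 0}. \<forall>\<gamma>\<in>\<Delta> - {\<alpha>\<in>\<Delta>. cf \<theta> \<alpha> \<noteq> 0}. \<alpha> \<bullet> \<gamma> = 0"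
    proof (intro ballI)
      fix \<alpha> \<gamma> assume a: "\<alpha> \<in> {\<alpha>\<in>\<Delta>. cf \<theta> \<alpha> \<noteq> 0}" and g: "\<gamma> \<in> \<Delta> - {\<alpha>\<in>\<Delta>. cf \<theta> \<alpha> \<noteq> 0}"
      have le: "cf \<theta> \<delta> * (\<delta> \<bullet> \<gamma>) \<le> 0" if "\<delta> \<in> \<Delta>" for \<delta>
      proof (cases "\<delta> = \<gamma>")
        case False
        then show ?thesis using pos_cf[OF P\<theta> that] simple_obtuse[OF that] g by (intro mult_nonneg_nonpos) auto
      qed (use g in auto)
      have "(\<Sum>\<delta>\<in>\<Delta>. - (cf \<theta> \<delta> * (\<delta> \<bullet> \<gamma>))) \<le> 0" using dom[of \<gamma>] g inner_cf[of \<theta> \<gamma>] by (simp add: sum_negf)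
      moreover have "(\<Sum>\<delta>\<in>\<Delta>. - (cf \<theta> \<delta> * (\<delta> \<bullet> \<gamma>))) \<ge> 0" using le by (intro sum_nonneg) auto
      ultimately have "(\<Sum>\<delta>\<in>\<Delta>. - (cf \<theta> \<delta> * (\<delta> \<bullet> \<gamma>))) = 0" by linarith
      then have "\<forall>\<delta>\<in>\<Delta>. - (cf \<theta> \<delta> * (\<delta> \<bullet> \<gamma>)) = 0"
        using le finite_simple by (subst (asm) sum_nonneg_eq_0_iff) auto
      then show "\<alpha> \<bullet> \<gamma> = 0" using a by auto
    qed
  qed auto
  then have cf\<theta>: "cf \<theta> \<alpha> > 0" if "\<alpha> \<in> \<Delta>" for \<alpha> using pos_cf[OF P\<theta> that] that by force
  have "nonneg_comb \<Delta> (\<theta> - \<beta>)" if "\<beta> \<in> \<Phi>" for \<beta>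
  proof (rule ccontr)
    assume n\<beta>: "\<not> ?thesis"
    let ?S = "{\<beta>\<in>\<Phi>. \<not> nonneg_comb \<Delta> (\<theta> - \<beta>)}"
    have fin: "finite ?S" and ne: "?S \<noteq> {}" using finite_roots that n\<beta> by auto
    \<comment> \<open>A root of maximal height among those not below \<theta> is dominant too,
      because adding a simple root to it would give a root below \<theta>. As \<theta> has full
      support, the two pair positively, their difference is a root, and maximality of the height of
      \<theta> fixes its sign.\<close>
    obtain \<delta> where \<delta>: "\<delta> \<in> \<Phi>" "\<not> nonneg_comb \<Delta> (\<theta> - \<delta>)"
      and mx: "\<And>\<epsilon>. \<epsilon> \<in> \<Phi> \<Longrightarrow> \<not> nonneg_comb \<Delta> (\<theta> - \<epsilon>) \<Longrightarrow> ht \<epsilon> \<le> ht \<delta>"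
      using arg_min_if_finite[OF fin ne, of "\<lambda>x. - ht x"] by (smt (verit) mem_Collect_eq)
    have d: "\<delta> \<bullet> \<alpha> \<ge> 0" if "\<alpha> \<in> \<Delta>" for \<alpha>
    proof (rule ccontr)
      assume n: "\<not> ?thesis"
      have "nonneg_comb \<Delta> (\<theta> + \<alpha>)"
        using pos_cf[OF P\<theta>] pos_cf[OF simple_pos[OF that]] by (auto simp: nonneg_comb_iff intro: add_nonneg_nonneg)
      then have "\<delta> \<noteq> - \<alpha>" using \<delta>(2) by auto
      then have sm: "\<delta> + \<alpha> \<in> \<Phi>" using n \<delta> that simple_roots by (intro add_root) auto
      have "nonneg_comb \<Delta> (\<theta> - (\<delta> + \<alpha>))"
        using mx[OF sm] that by (auto simp: ht_add ht_simple)
      then show False using \<delta>(2) that unfolding nonneg_comb_iff by (force simp: cf_simple split: if_splits)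
    qed
    have "\<exists>\<alpha>\<in>\<Delta>. \<delta> \<bullet> \<alpha> \<noteq> 0"
    proof (rule ccontr)
      assume "\<not> ?thesis"
      then have "\<delta> \<bullet> \<delta> = 0" unfolding inner_cf[of \<delta> \<delta>] by (intro sum.neutral) (auto simp: inner_commute)
      then show False using \<delta> root_nonzero by auto
    qed
    then obtain \<alpha> where \<alpha>: "\<alpha> \<in> \<Delta>" "\<delta> \<bullet> \<alpha> > 0" using d by force
    have "\<theta> \<bullet> \<delta> > 0"
      unfolding inner_cf[of \<theta> \<delta>] using \<alpha> cf\<theta> d finite_simple
      by (intro sum_pos2[of _ \<alpha>]) (auto simp: inner_commute intro: mult_nonneg_nonneg less_imp_le)
    moreover have "\<delta> \<noteq> \<theta>" using \<delta>(2) by (auto simp: nonneg_comb_iff representation_zero)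
    ultimately have r: "\<delta> + (- \<theta>) \<in> \<Phi>" using \<delta> \<theta> neg_root by (intro add_root) (auto simp: inner_commute)
    have "- (\<delta> - \<theta>) \<in> Pos"
      using pos_or_neg[OF r] ht_pos[of "\<delta> - \<theta>"] max[OF \<delta>(1)] ht_add[of \<delta> "- \<theta>"] ht_neg[of \<theta>] by auto
    then show False using \<delta>(2) by (auto simp: pos_roots_def)
  qed
  then show ?thesis using \<theta> by auto
qed

abbreviation "\<theta> \<equiv> highest_root \<Phi> \<Delta>"

lemma highest_root_root: "\<theta> \<in> \<Phi>" and highest_root_ge: "\<beta> \<in> \<Phi> \<Longrightarrow> nonneg_comb \<Delta> (\<theta> - \<beta>)"
proof -
  have "\<exists>!t. t \<in> \<Phi> \<and> (\<forall>\<beta>\<in>\<Phi>. nonneg_comb \<Delta> (t - \<beta>))"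
  proof (rule ex_ex1I[OF ex_highest_root])
    fix s t assume s: "s \<in> \<Phi> \<and> (\<forall>\<beta>\<in>\<Phi>. nonneg_comb \<Delta> (s - \<beta>))" and t: "t \<in> \<Phi> \<and> (\<forall>\<beta>\<in>\<Phi>. nonneg_comb \<Delta> (t - \<beta>))"
    then have "nonneg_comb \<Delta> (s - t)" "nonneg_comb \<Delta> (t - s)" by auto
    then show "s = t" unfolding nonneg_comb_iff by (intro cf_eqI) (force simp: )
  qed
  from theI'[OF this] show "\<theta> \<in> \<Phi>" "\<beta> \<in> \<Phi> \<Longrightarrow> nonneg_comb \<Delta> (\<theta> - \<beta>)"
    by (auto simp: highest_root_def)
qed

lemma highest_root_cf: "\<beta> \<in> \<Phi> \<Longrightarrow> \<alpha> \<in> \<Delta> \<Longrightarrow> cf \<beta> \<alpha> \<le> cf \<theta> \<alpha>"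
  using highest_root_ge[of \<beta>] by (auto simp: nonneg_comb_iff)

lemma highest_root_pos: "\<theta> \<in> Pos"
  using highest_root_cf[OF neg_root[OF highest_root_root]] highest_root_root
  by (force simp: pos_roots_def nonneg_comb_iff)

lemma highest_root_dominant: assumes "\<alpha> \<in> \<Delta>" shows "\<theta> \<bullet> \<alpha> \<ge> 0"
proof -
  have "cf (refl \<alpha> \<theta>) \<alpha> \<le> cf \<theta> \<alpha>"
    using assms simple_roots highest_root_root by (intro highest_root_cf refl_root) auto
  then have "2 * (\<theta> \<bullet> \<alpha>) / (\<alpha> \<bullet> \<alpha>) \<ge> 0" using assms by (simp add: cf_refl)
  moreover have "\<alpha> \<bullet> \<alpha> > 0" using assms simple_roots root_nonzero by auto
  ultimately show ?thesis by (simp add: zero_le_divide_iff)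
qed

text \<open>With a Cartan integer of 2 or more, the negative of the reflected root would exceed
  \<theta> in some coordinate unless \<beta> is \<theta>. This lets the affine simple reflection be
  treated like the finite ones.\<close>

lemma highest_root_pairing:
  assumes "\<beta> \<in> Pos" "\<beta> \<noteq> \<theta>"
  shows "\<beta> \<bullet> \<theta> = 0 \<or> (2 * (\<beta> \<bullet> \<theta>) / (\<theta> \<bullet> \<theta>) = 1 \<and> \<theta> - \<beta> \<in> Pos)"
proof -
  obtain m where m: "2 * (\<beta> \<bullet> \<theta>) / (\<theta> \<bullet> \<theta>) = of_int m"
    using pairing_int[OF highest_root_root pos_root[OF assms(1)]] by (auto elim: Ints_cases)
  have tt: "\<theta> \<bullet> \<theta> > 0" using highest_root_root root_nonzero by auto
  have "\<beta> \<bullet> \<theta> \<ge> 0" unfolding inner_cf[of \<beta> \<theta>]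
    using pos_cf[OF assms(1)] highest_root_dominant by (intro sum_nonneg mult_nonneg_nonneg) (auto simp: inner_commute)
  then have "2 * (\<beta> \<bullet> \<theta>) / (\<theta> \<bullet> \<theta>) \<ge> 0" using tt by simp
  then have m0: "m \<ge> 0" using m by simp
  have r: "refl \<theta> \<beta> = \<beta> - of_int m *\<^sub>R \<theta>" using m by (simp add: refl_def)
  have rin: "refl \<theta> \<beta> \<in> \<Phi>" using refl_root[OF highest_root_root pos_root[OF assms(1)]] .
  have "m \<le> 1"
  proof (rule ccontr)
    assume "\<not> ?thesis"
    then have m2: "of_int m \<ge> (2::real)" by linarith
    have "cf \<beta> \<alpha> = cf \<theta> \<alpha>" if "\<alpha> \<in> \<Delta>" for \<alpha>
    proof -
      have "cf (- refl \<theta> \<beta>) \<alpha> \<le> cf \<theta> \<alpha>" using rin that by (intro highest_root_cf neg_root)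
      then have "of_int m * cf \<theta> \<alpha> - cf \<beta> \<alpha> \<le> cf \<theta> \<alpha>" using r by simp
      moreover have "2 * cf \<theta> \<alpha> \<le> of_int m * cf \<theta> \<alpha>"
        using m2 pos_cf[OF highest_root_pos that] by (intro mult_right_mono) auto
      moreover have "cf \<beta> \<alpha> \<le> cf \<theta> \<alpha>" using highest_root_cf[OF pos_root[OF assms(1)] that] .
      ultimately show ?thesis by linarith
    qed
    then show False using cf_eqI assms(2) by blast
  qed
  then consider "m = 0" | "m = 1" using m0 by linarith
  then show ?thesis
  proof cases
    case 1 then show ?thesis using m tt by auto
  next
    case 2
    then have eq: "- refl \<theta> \<beta> = \<theta> - \<beta>" using r by simp
    then have "\<theta> - \<beta> \<in> \<Phi>" using neg_root[OF rin] by simp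
    then show ?thesis using 2 m highest_root_ge[OF pos_root[OF assms(1)]] by (auto simp: pos_roots_def)
  qed
qed

end

section \<open>The affine Weyl group\<close>

lemma gen_group_induct [consumes 1, case_names gen_id gen_step]:
  assumes "u \<in> gen_group G" "P id" "\<And>u g. u \<in> gen_group G \<Longrightarrow> P u \<Longrightarrow> g \<in> G \<Longrightarrow> P (g \<circ> u)"
  shows "P u"
  using assms(1) by (rule gen_group.induct) (use assms(2,3) in \<open>simp_all add: id_def o_def\<close>)

lemma gen_group_gen: "g \<in> G \<Longrightarrow> g \<in> gen_group G"
  using gen_step[OF gen_id, of g G] by simp

lemma gen_group_comp: "u \<in> gen_group G \<Longrightarrow> v \<in> gen_group G \<Longrightarrow> u \<circ> v \<in> gen_group G"
  by (induction rule: gen_group_induct) (auto simp: comp_assoc intro: gen_group.intros)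

lemma gen_group_inv:
  assumes "u \<in> gen_group G" "\<And>g. g \<in> G \<Longrightarrow> g \<circ> g = id"
  shows "bij u \<and> inv u \<in> gen_group G"
  using assms(1)
proof (induction rule: gen_group_induct)
  case (gen_step u g)
  have g: "bij g" "inv g = g"
    using assms(2)[OF gen_step.hyps(2)] by (auto intro: o_bij inv_unique_comp)
  then have "inv (g \<circ> u) = inv u \<circ> g" using gen_step by (simp add: o_inv_distrib)
  then show ?case using gen_step g(1) gen_group_gen by (metis bij_comp gen_group_comp)
qed (metis bij_id inv_id gen_group.gen_id)

lemma gen_group_mono: "(\<And>g. g \<in> G \<Longrightarrow> g \<in> gen_group H) \<Longrightarrow> u \<in> gen_group G \<Longrightarrow> u \<in> gen_group H"
  by (erule gen_group_induct) (blast intro: gen_group.intros gen_group_comp)+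

lemma aff_refl_aff_refl: "\<beta> \<noteq> 0 \<Longrightarrow> aff_refl \<beta> k \<circ> aff_refl \<beta> k = id"
proof
  fix x assume "\<beta> \<noteq> 0"
  then have "coroot \<beta> \<bullet> \<beta> = 2" by (simp add: coroot_def)
  then show "(aff_refl \<beta> k \<circ> aff_refl \<beta> k) x = id x"
    by (simp add: aff_refl_def inner_diff_left algebra_simps flip: scaleR_add_left)
qed

lemma aff_refl_neg: "aff_refl (- \<beta>) (- k) = aff_refl \<beta> k"
  by (simp add: fun_eq_iff aff_refl_def coroot_def algebra_simps flip: scaleR_add_left add_divide_distrib)

text \<open>Sides of hyperplanes are compared through this: inside an open unit strip the comparison
  with a level becomes one between integers.\<close>

lemma int_below_iff:
  fixes x :: real
  assumes "of_int m < x" "x < of_int m + 1" shows "x < of_int k \<longleftrightarrow> m < k"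
proof
  assume "m < k"
  then have "real_of_int (m + 1) \<le> of_int k" by (intro of_int_le_iff[THEN iffD2]) simp
  then show "x < of_int k" using assms by simp
next
  assume "x < of_int k"
  then have "real_of_int m < of_int k" using assms(1) by linarith
  then show "m < k" by simp
qed

lemma int_between_neq:
  fixes x :: real
  assumes "of_int m < x" "x < of_int m + 1" shows "x \<noteq> of_int k"
  using int_below_iff[OF assms, of k] int_below_iff[OF assms, of "k + 1"] assms by auto

lemma wbar_plus: "wbar u x + u 0 = u x"
  by (simp add: wbar_def)

context irreducible_root_system
begin

section \<open>Linear and translation parts of affine Weyl group elements\<close>

abbreviation "W \<equiv> weyl \<Phi>"
abbreviation "AW \<equiv> aff_weyl \<Phi>"
abbreviation "I \<equiv> aff_index \<Delta>"
abbreviation "s \<equiv> sref \<Phi> \<Delta>"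

lemma aff_weyl_comp: "u \<in> AW \<Longrightarrow> v \<in> AW \<Longrightarrow> u \<circ> v \<in> AW"
  and weyl_comp: "u \<in> W \<Longrightarrow> v \<in> W \<Longrightarrow> u \<circ> v \<in> W"
  and id_aff_weyl: "id \<in> AW" and id_weyl: "id \<in> W"
  by (auto simp: aff_weyl_def weyl_def intro: gen_group_comp gen_group.gen_id)

lemma aff_weyl_inv: assumes "u \<in> AW" shows "bij u" "inv u \<in> AW"
  using gen_group_inv[of u "{aff_refl \<beta> k |\<beta> k. \<beta> \<in> \<Phi>}"] assms aff_refl_aff_refl root_nonzero
  by (auto simp: aff_weyl_def)

lemma weyl_inv: assumes "u \<in> W" shows "bij u" "inv u \<in> W"
  using gen_group_inv[of u "{aff_refl \<beta> 0 |\<beta>. \<beta> \<in> \<Phi>}"] assms aff_refl_aff_refl root_nonzero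
  by (auto simp: weyl_def)

lemma aff_weyl_refl: "\<beta> \<in> \<Phi> \<Longrightarrow> aff_refl \<beta> k \<in> AW"
  unfolding aff_weyl_def by (rule gen_group_gen) auto

lemma weyl_refl: "\<beta> \<in> \<Phi> \<Longrightarrow> refl \<beta> \<in> W"
  unfolding weyl_def aff_refl_0[symmetric] by (rule gen_group_gen) auto

lemma weyl_aff_weyl: "w \<in> W \<Longrightarrow> w \<in> AW"
  unfolding weyl_def aff_weyl_def by (erule gen_group_mono[rotated]) (auto intro!: gen_group_gen)

lemma weyl_props:
  assumes "w \<in> W" shows "linear w \<and> (\<forall>x y. w x \<bullet> w y = x \<bullet> y) \<and> (\<forall>\<beta>\<in>\<Phi>. w \<beta> \<in> \<Phi>)"
  using assms unfolding weyl_def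
proof (induction rule: gen_group_induct)
  case gen_id
  then show ?case by (simp add: linear_iff)
next
  case (gen_step u g)
  then obtain \<beta> where "\<beta> \<in> \<Phi>" "g = refl \<beta>" by (auto simp: aff_refl_0)
  then show ?case
    using gen_step.IH linear_refl[of \<beta>] inner_refl_refl[of \<beta>] refl_root[of \<beta>] root_nonzero[of \<beta>]
    by (auto simp: linear_iff)
qed

lemma weyl_linear: "w \<in> W \<Longrightarrow> linear w" and weyl_inner: "w \<in> W \<Longrightarrow> w x \<bullet> w y = x \<bullet> y"
  and weyl_root: "w \<in> W \<Longrightarrow> \<beta> \<in> \<Phi> \<Longrightarrow> w \<beta> \<in> \<Phi>"
  using weyl_props by auto

lemma weyl_zero: "w \<in> W \<Longrightarrow> w 0 = 0" and weyl_neg: "w \<in> W \<Longrightarrow> w (- x) = - w x"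
  and weyl_diff: "w \<in> W \<Longrightarrow> w (x - y) = w x - w y"
  and weyl_scale: "w \<in> W \<Longrightarrow> w (c *\<^sub>R x) = c *\<^sub>R w x"
  using weyl_linear by (auto simp: linear_0 linear_neg linear_diff linear_scale)

lemma weyl_inv_inner: "w \<in> W \<Longrightarrow> inv w x \<bullet> y = x \<bullet> w y"
  using weyl_inner[of w "inv w x" y] weyl_inv(1)[of w] by (simp add: surj_f_inv_f bij_is_surj)

lemma weyl_wbar: "w \<in> W \<Longrightarrow> wbar w = w"
  by (simp add: wbar_def weyl_zero)

text \<open>An element is determined by its permutation of the roots, since these span.\<close>

lemma finite_weyl: "finite W"
proof (rule inj_on_finite)
  show "inj_on (\<lambda>w. restrict w \<Phi>) W"
  proof (rule inj_onI)
    fix u v assume uv: "u \<in> W" "v \<in> W" "restrict u \<Phi> = restrict v \<Phi>"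
    then have "u \<beta> = v \<beta>" if "\<beta> \<in> \<Phi>" for \<beta> using that by (metis restrict_apply')
    then show "u = v"
      using linear_eq_on_span[OF weyl_linear[OF uv(1)] weyl_linear[OF uv(2)]] span_roots by blast
  qed
  show "(\<lambda>w. restrict w \<Phi>) ` W \<subseteq> \<Phi> \<rightarrow>\<^sub>E \<Phi>" using weyl_root by auto
  show "finite (\<Phi> \<rightarrow>\<^sub>E \<Phi>)" using finite_roots by (simp add: finite_PiE)
qed

lemma coroot_int: assumes "\<beta> \<in> \<Phi>" "\<gamma> \<in> \<Phi>" shows "coroot \<beta> \<bullet> \<gamma> \<in> \<int>"
proof -
  have "coroot \<beta> \<bullet> \<gamma> = 2 * (\<gamma> \<bullet> \<beta>) / (\<beta> \<bullet> \<beta>)" by (simp add: coroot_def inner_commute)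
  then show ?thesis using pairing_int[OF assms] by metis
qed

text \<open>The translation part is recorded only through its integral pairings with roots; they are
  what carries integer levels to integer levels.\<close>

lemma aff_weyl_props: assumes "u \<in> AW" shows "wbar u \<in> W \<and> (\<forall>\<beta>\<in>\<Phi>. u 0 \<bullet> \<beta> \<in> \<int>)"
  using assms unfolding aff_weyl_def
proof (induction rule: gen_group_induct)
  case gen_id
  then show ?case using id_weyl by (simp add: wbar_def id_def)
next
  case (gen_step u g)
  then obtain \<beta> k where b: "\<beta> \<in> \<Phi>" "g = aff_refl \<beta> k" by auto
  have "wbar (g \<circ> u) = refl \<beta> \<circ> wbar u"
    unfolding b by (simp add: wbar_def fun_eq_iff aff_refl_def aff_refl_0[symmetric] inner_diff_left algebra_simps)
  moreover have "(g \<circ> u) 0 \<bullet> \<gamma> \<in> \<int>" if "\<gamma> \<in> \<Phi>" for \<gamma>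
    using gen_step.IH b coroot_int[OF b(1) that] that by (auto simp: aff_refl_def inner_diff)
  ultimately show ?case using gen_step.IH weyl_comp[OF weyl_refl[OF b(1)]] by metis
qed

lemma wbar_weyl: "u \<in> AW \<Longrightarrow> wbar u \<in> W" and aff_weyl_int: "u \<in> AW \<Longrightarrow> \<beta> \<in> \<Phi> \<Longrightarrow> u 0 \<bullet> \<beta> \<in> \<int>"
  using aff_weyl_props by auto

lemma wbar_comp: "u \<in> AW \<Longrightarrow> wbar (u \<circ> v) = wbar u \<circ> wbar v"
  using weyl_diff[OF wbar_weyl[of u]] by (auto simp: fun_eq_iff) (auto simp: wbar_def)

lemma aff_weyl_inv_apply: assumes "u \<in> AW" shows "u (inv u x) = x" "inv u (u x) = x"
    "u \<circ> inv u = id" "inv u \<circ> u = id"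
  using aff_weyl_inv(1)[OF assms] by (simp_all add: bij_is_inj bij_is_surj surj_f_inv_f fun_eq_iff)

lemma weyl_inv_apply: assumes "u \<in> W" shows "u (inv u x) = x" "inv u (u x) = x"
    "u \<circ> inv u = id" "inv u \<circ> u = id"
  using aff_weyl_inv_apply[OF weyl_aff_weyl[OF assms]] by auto

lemma wbar_inv: assumes "u \<in> AW" shows "wbar (inv u) = inv (wbar u)"
proof -
  have "wbar u \<circ> wbar (inv u) = id" "wbar (inv u) \<circ> wbar u = id"
    using wbar_comp[OF assms, of "inv u"] wbar_comp[OF aff_weyl_inv(2)[OF assms], of u]
      aff_weyl_inv_apply[OF assms] weyl_wbar[OF id_weyl] by auto
  then show ?thesis by (metis inv_unique_comp)
qed

lemma aff_weyl_inner: "u \<in> AW \<Longrightarrow> u x \<bullet> wbar u \<gamma> = x \<bullet> \<gamma> + u 0 \<bullet> wbar u \<gamma>"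
  using weyl_inner[OF wbar_weyl, of u x \<gamma>] wbar_plus[of u x] by (metis inner_add_left)

text \<open>The image of the hyperplane \<open>(\<gamma>, k)\<close> under \<open>u\<close> is \<open>(wbar u \<gamma>, tr u \<gamma> k)\<close>.\<close>

definition tr :: "('v \<Rightarrow> 'v) \<Rightarrow> 'v \<Rightarrow> int \<Rightarrow> int" where
  "tr u \<gamma> k = k + \<lfloor>u 0 \<bullet> wbar u \<gamma>\<rfloor>"

text \<open>The floor in \<open>tr\<close> is exact, because the pairing is an integer.\<close>

lemma of_int_tr: assumes "u \<in> AW" "\<gamma> \<in> \<Phi>" shows "real_of_int (tr u \<gamma> k) = k + u 0 \<bullet> wbar u \<gamma>"
proof -
  have "u 0 \<bullet> wbar u \<gamma> \<in> \<int>" using aff_weyl_int[OF assms(1) weyl_root[OF wbar_weyl[OF assms(1)] assms(2)]] .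
  then show ?thesis by (simp add: tr_def)
qed

lemma inner_tr: "u \<in> AW \<Longrightarrow> \<gamma> \<in> \<Phi> \<Longrightarrow> u x \<bullet> wbar u \<gamma> - of_int (tr u \<gamma> k) = x \<bullet> \<gamma> - of_int k"
  using of_int_tr[of u \<gamma> k] aff_weyl_inner[of u x \<gamma>] by linarith

text \<open>Hyperplanes are pulled back rather than alcoves pushed forward, so that a question about
  the alcove of \<open>u\<close> becomes one about the fundamental alcove.\<close>

lemma pull_back:
  assumes "u \<in> AW" "\<beta> \<in> \<Phi>"
  obtains \<gamma> m where "\<gamma> \<in> \<Phi>" "\<And>x. u x \<bullet> \<beta> - of_int k = x \<bullet> \<gamma> - of_int m" "wbar u \<gamma> = \<beta>" "tr u \<gamma> m = k"
proof -
  let ?\<gamma> = "wbar (inv u) \<beta>" and ?m = "tr (inv u) \<beta> k"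
  have g: "?\<gamma> \<in> \<Phi>" using weyl_root[OF wbar_weyl[OF aff_weyl_inv(2)]] assms by auto
  have eq: "u x \<bullet> \<beta> - of_int k = x \<bullet> ?\<gamma> - of_int ?m" for x
    using inner_tr[OF aff_weyl_inv(2)[OF assms(1)] assms(2), of "u x" k] aff_weyl_inv_apply[OF assms(1)] by simp
  have w: "wbar u ?\<gamma> = \<beta>" using wbar_inv[OF assms(1)] weyl_inv_apply(1)[OF wbar_weyl[OF assms(1)]] by simp
  have "real_of_int (tr u ?\<gamma> ?m) = of_int k"
    using inner_tr[OF assms(1) g, of 0 ?m] eq[of 0] unfolding w by simp
  then have "tr u ?\<gamma> ?m = k" by linarith
  with g eq w show ?thesis using that by blast
qed

text \<open>A simple reflection composed on the inside is the reflection through a wall of the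
  current alcove on the outside. The exchange arguments below rest on this.\<close>

lemma aff_refl_conj:
  assumes "u \<in> AW" "\<gamma> \<in> \<Phi>" shows "u \<circ> aff_refl \<gamma> k = aff_refl (wbar u \<gamma>) (tr u \<gamma> k) \<circ> u"
proof
  fix x
  have w: "wbar u \<in> W" using wbar_weyl[OF assms(1)] .
  have "coroot (wbar u \<gamma>) = wbar u (coroot \<gamma>)" by (simp add: coroot_def weyl_inner[OF w] weyl_scale[OF w])
  moreover have "u (x - c *\<^sub>R y) = u x - c *\<^sub>R wbar u y" for c y
    using wbar_plus[of u "x - c *\<^sub>R y"] wbar_plus[of u x] by (simp add: weyl_diff[OF w] weyl_scale[OF w] algebra_simps)
  ultimately show "(u \<circ> aff_refl \<gamma> k) x = (aff_refl (wbar u \<gamma>) (tr u \<gamma> k) \<circ> u) x"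
    using inner_tr[OF assms, of x k] by (simp add: aff_refl_def)
qed

text \<open>The alcove is cut out by the inequalities \<open>x \<bullet> nrm i \<le> lev i\<close>, with outward normals.\<close>

definition nrm :: "'v option \<Rightarrow> 'v" where "nrm i = (case i of None \<Rightarrow> \<theta> | Some \<alpha> \<Rightarrow> - \<alpha>)"
definition lev :: "'v option \<Rightarrow> int" where "lev i = (case i of None \<Rightarrow> 1 | Some _ \<Rightarrow> 0)"

lemma nrm_simps [simp]: "nrm None = \<theta>" "nrm (Some \<alpha>) = - \<alpha>" "lev None = 1" "lev (Some \<alpha>) = 0"
  by (auto simp: nrm_def lev_def)

lemma sref_eq: "s i = aff_refl (nrm i) (lev i)"
  by (cases i) (simp_all add: aff_refl_0 refl_neg)

lemma index_cases: assumes "i \<in> I" obtains "i = None" | \<alpha> where "\<alpha> \<in> \<Delta>" "i = Some \<alpha>"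
  using assms by (auto simp: aff_index_def)

lemma nrm_root: "i \<in> I \<Longrightarrow> nrm i \<in> \<Phi>"
  using simple_roots neg_root highest_root_root by (auto elim!: index_cases)

lemma sref_aff_weyl: "i \<in> I \<Longrightarrow> s i \<in> AW"
  using nrm_root aff_weyl_refl by (simp add: sref_eq)

lemma sref_sref: "i \<in> I \<Longrightarrow> s i \<circ> s i = id"
  using nrm_root root_nonzero by (simp add: sref_eq aff_refl_aff_refl)

lemma sref_inv: "i \<in> I \<Longrightarrow> inv (s i) = s i"
  using sref_sref inv_unique_comp by metis

lemma sref_nrm: "i \<in> I \<Longrightarrow> s i x \<bullet> nrm i = 2 * of_int (lev i) - x \<bullet> nrm i"
  using root_nonzero[OF nrm_root, of i]
  by (simp add: sref_eq aff_refl_def coroot_def inner_diff_left)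

section \<open>The open alcove and its walls\<close>

definition open_alcove :: "'v set" where "open_alcove = {x. \<forall>i\<in>I. x \<bullet> nrm i < of_int (lev i)}"

lemma open_alcove_simple: "x \<in> open_alcove \<Longrightarrow> \<alpha> \<in> \<Delta> \<Longrightarrow> x \<bullet> \<alpha> > 0"
  and open_alcove_highest: "x \<in> open_alcove \<Longrightarrow> x \<bullet> \<theta> < 1"
  by (auto simp: open_alcove_def aff_index_def)

lemma fund_alcove_bounds:
  assumes "x \<in> fund_alcove \<Phi> \<Delta>" "\<beta> \<in> Pos" shows "0 \<le> x \<bullet> \<beta>" "x \<bullet> \<beta> \<le> 1"
proof -
  have x: "x \<bullet> \<alpha> \<ge> 0" if "\<alpha> \<in> \<Delta>" for \<alpha> using assms(1) that by (auto simp: fund_alcove_def fund_chamber_def)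
  show "0 \<le> x \<bullet> \<beta>" unfolding inner_commute[of x \<beta>] inner_cf[of \<beta> x]
    using x pos_cf[OF assms(2)] by (intro sum_nonneg mult_nonneg_nonneg) (auto simp: inner_commute)
  have "0 \<le> (\<theta> - \<beta>) \<bullet> x" unfolding inner_cf[of "\<theta> - \<beta>" x]
    using x highest_root_cf[OF pos_root[OF assms(2)]] by (intro sum_nonneg mult_nonneg_nonneg) (auto simp: inner_commute)
  then show "x \<bullet> \<beta> \<le> 1" using assms(1) by (auto simp: fund_alcove_def inner_diff inner_commute)
qed

lemma chamber_pos:
  assumes "\<And>\<alpha>. \<alpha> \<in> \<Delta> \<Longrightarrow> x \<bullet> \<alpha> > 0" "\<beta> \<in> Pos" shows "x \<bullet> \<beta> > 0"
proof -
  obtain \<alpha> where "\<alpha> \<in> \<Delta>" "cf \<beta> \<alpha> > 0" using ex_pos_cf[OF assms(2)] by auto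
  then show ?thesis unfolding inner_commute[of x \<beta>] inner_cf[of \<beta> x]
    using assms(1) pos_cf[OF assms(2)] finite_simple
    by (intro sum_pos2[of _ \<alpha>]) (auto simp: inner_commute intro: mult_nonneg_nonneg less_imp_le)
qed

lemma open_alcove_fund: "x \<in> open_alcove \<Longrightarrow> x \<in> fund_alcove \<Phi> \<Delta>"
  by (auto simp: open_alcove_def aff_index_def fund_alcove_def fund_chamber_def intro: less_imp_le)

lemma open_alcove_bounds:
  assumes "x \<in> open_alcove" "\<beta> \<in> Pos" shows "0 < x \<bullet> \<beta>" "x \<bullet> \<beta> < 1"
proof -
  show "0 < x \<bullet> \<beta>" using chamber_pos[OF open_alcove_simple[OF assms(1)] assms(2)] .
  have "0 \<le> (\<theta> - \<beta>) \<bullet> x" unfolding inner_cf[of "\<theta> - \<beta>" x]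
    using open_alcove_simple[OF assms(1)] highest_root_cf[OF pos_root[OF assms(2)]]
    by (intro sum_nonneg mult_nonneg_nonneg) (auto simp: inner_commute intro: less_imp_le)
  then show "x \<bullet> \<beta> < 1" using open_alcove_highest[OF assms(1)] by (auto simp: inner_diff inner_commute)
qed

text \<open>An interior point can be pushed a little along each outward normal without leaving the
  alcove, which makes every defining inequality strict.\<close>

lemma interior_fund_alcove: "interior (fund_alcove \<Phi> \<Delta>) \<subseteq> open_alcove"
proof
  fix x assume "x \<in> interior (fund_alcove \<Phi> \<Delta>)"
  then obtain e where e: "e > 0" "ball x e \<subseteq> fund_alcove \<Phi> \<Delta>" by (auto simp: mem_interior)
  show "x \<in> open_alcove" unfolding open_alcove_def
  proof safe
    fix i assume i: "i \<in> I"
    let ?n = "nrm i" let ?y = "x + (e / (2 * norm ?n)) *\<^sub>R ?n"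
    have n: "norm ?n > 0" using root_nonzero[OF nrm_root[OF i]] by simp
    have "?y \<in> ball x e" using n e by (simp add: dist_norm)
    then have "?y \<in> fund_alcove \<Phi> \<Delta>" using e by auto
    then have "?y \<bullet> ?n \<le> of_int (lev i)"
      using i by (auto simp: fund_alcove_def fund_chamber_def elim!: index_cases)
    moreover have "?y \<bullet> ?n = x \<bullet> ?n + e / (2 * norm ?n) * (norm ?n)\<^sup>2"
      by (simp add: inner_add_left power2_norm_eq_inner)
    moreover have "e / (2 * norm ?n) * (norm ?n)\<^sup>2 > 0" using n e by simp
    ultimately show "x \<bullet> ?n < of_int (lev i)" by linarith
  qed
qed

lemma open_alcove_root:
  assumes "z \<in> open_alcove" "\<beta> \<in> \<Phi>" obtains m :: int where "of_int m < z \<bullet> \<beta>" "z \<bullet> \<beta> < of_int m + 1"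
proof (cases "\<beta> \<in> Pos")
  case True then show ?thesis using that[of 0] open_alcove_bounds[OF assms(1)] by auto
next
  case False
  then show ?thesis using that[of "-1"] neg_pos_iff[OF assms(2)] open_alcove_bounds[OF assms(1), of "- \<beta>"] by auto
qed

lemma aff_weyl_root:
  assumes "z \<in> open_alcove" "u \<in> AW" "\<beta> \<in> \<Phi>" obtains m :: int where "of_int m < u z \<bullet> \<beta>" "u z \<bullet> \<beta> < of_int m + 1"
proof -
  obtain \<gamma> m where g: "\<gamma> \<in> \<Phi>" "\<And>x. u x \<bullet> \<beta> - of_int 0 = x \<bullet> \<gamma> - of_int m"
    using pull_back[OF assms(2,3), of 0] by blast
  obtain n where "of_int n < z \<bullet> \<gamma>" "z \<bullet> \<gamma> < of_int n + 1" using open_alcove_root[OF assms(1) g(1)] .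
  then show ?thesis using that[of "n - m"] g(2)[of z] by auto
qed

text \<open>The orbit of \<open>z\<close> avoids all hyperplanes, so a failed strict comparison
  means the opposite strict one, and a single comparison encodes a side.\<close>

lemma aff_weyl_generic: "z \<in> open_alcove \<Longrightarrow> u \<in> AW \<Longrightarrow> \<beta> \<in> \<Phi> \<Longrightarrow> u z \<bullet> \<beta> \<noteq> of_int k"
  by (erule (2) aff_weyl_root[of z u \<beta>]) (rule int_between_neq)

lemma nrm_level: assumes "z \<in> open_alcove" "i \<in> I" shows "of_int (lev i) - 1 < z \<bullet> nrm i" "z \<bullet> nrm i < of_int (lev i)"
  using assms open_alcove_bounds[OF assms(1)] simple_pos highest_root_pos by (auto elim!: index_cases)

text \<open>A finite simple reflection permutes the other positive roots. Under the affine one the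
  pairing with \<beta> either stays or becomes 1 minus the pairing with the positive root \<theta> -
  \<beta>.\<close>

lemma sref_bounds:
  assumes z: "z \<in> open_alcove" and i: "i \<in> I" and b: "\<beta> \<in> Pos" "\<beta> \<noteq> nrm i" "\<beta> \<noteq> - nrm i"
  shows "0 < s i z \<bullet> \<beta> \<and> s i z \<bullet> \<beta> < 1"
  using i
proof (cases rule: index_cases)
  case (2 \<alpha>)
  have a0: "\<alpha> \<noteq> 0" using 2 simple_roots root_nonzero by auto
  have "s i z \<bullet> \<beta> = refl \<alpha> z \<bullet> refl \<alpha> (refl \<alpha> \<beta>)" using 2 a0 by (simp add: aff_refl_0 refl_refl)
  also have "\<dots> = z \<bullet> refl \<alpha> \<beta>" using a0 by (rule inner_refl_refl)
  finally show ?thesis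
    using open_alcove_bounds[OF z refl_simple_pos[OF 2(1) b(1)]] b 2 by auto
next
  case 1
  have tt: "\<theta> \<bullet> \<theta> > 0" using highest_root_root root_nonzero by auto
  have eq: "s i z \<bullet> \<beta> = z \<bullet> \<beta> - (z \<bullet> \<theta> - 1) * (2 * (\<beta> \<bullet> \<theta>) / (\<theta> \<bullet> \<theta>))"
    using 1 by (simp add: aff_refl_def coroot_def inner_diff inner_commute)
  have "\<beta> \<noteq> \<theta>" using b 1 by simp
  from highest_root_pairing[OF b(1) this] show ?thesis
  proof (elim disjE conjE)
    assume one: "2 * (\<beta> \<bullet> \<theta>) / (\<theta> \<bullet> \<theta>) = 1" and "\<theta> - \<beta> \<in> Pos"
    have "z \<bullet> \<theta> - z \<bullet> \<beta> > 0" "z \<bullet> \<theta> - z \<bullet> \<beta> < 1"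
      using open_alcove_bounds[OF z \<open>\<theta> - \<beta> \<in> Pos\<close>] by (auto simp: inner_diff)
    then show ?thesis unfolding eq one by simp
  qed (use open_alcove_bounds[OF z b(1)] in \<open>auto simp: eq\<close>)
qed

text \<open>All other roots keep \<open>z\<close> and \<open>s i z\<close> in the same unit strip,
  and in the direction of the wall exactly one level lies between them. Two answers appear because a
  pair and its negative name the same hyperplane.\<close>

lemma only_wall_separates:
  assumes z: "z \<in> open_alcove" and i: "i \<in> I" and b: "\<beta> \<in> \<Phi>"
    and sep: "(z \<bullet> \<beta> < of_int k) \<noteq> (s i z \<bullet> \<beta> < of_int k)"
  shows "(\<beta> = nrm i \<and> k = lev i) \<or> (\<beta> = - nrm i \<and> k = - lev i)"
proof -
  consider "\<beta> = nrm i" | "\<beta> = - nrm i" | "\<beta> \<noteq> nrm i" "\<beta> \<noteq> - nrm i" by auto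
  then show ?thesis
  proof cases
    case 1
    have "z \<bullet> \<beta> < of_int k \<longleftrightarrow> lev i - 1 < k"
      using nrm_level[OF z i] 1 by (intro int_below_iff) auto
    moreover have "s i z \<bullet> \<beta> < of_int k \<longleftrightarrow> lev i < k"
      using nrm_level[OF z i] sref_nrm[OF i, of z] 1 by (intro int_below_iff) auto
    ultimately show ?thesis using sep 1 by auto
  next
    case 2
    have "z \<bullet> \<beta> < of_int k \<longleftrightarrow> - lev i < k"
      using nrm_level[OF z i] 2 by (intro int_below_iff) auto
    moreover have "s i z \<bullet> \<beta> < of_int k \<longleftrightarrow> - lev i - 1 < k"
      using nrm_level[OF z i] sref_nrm[OF i, of z] 2 by (intro int_below_iff) auto
    ultimately show ?thesis using sep 2 by auto
  next
    case 3
    have "0 < z \<bullet> \<delta> \<and> z \<bullet> \<delta> < 1 \<and> 0 < s i z \<bullet> \<delta> \<and> s i z \<bullet> \<delta> < 1" if "\<delta> \<in> Pos" "\<delta> = \<beta> \<or> \<delta> = - \<beta>" for \<delta>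
      using open_alcove_bounds[OF z that(1)] sref_bounds[OF z i that(1)] that(2) 3
      by (metis minus_minus)
    then have "\<exists>m::int. of_int m < z \<bullet> \<beta> \<and> z \<bullet> \<beta> < of_int m + 1 \<and> of_int m < s i z \<bullet> \<beta> \<and> s i z \<bullet> \<beta> < of_int m + 1"
      using pos_or_neg[OF b] by (elim disjE) (force intro: exI[of _ 0], force intro: exI[of _ "-1"])
    then show ?thesis using sep int_below_iff by metis
  qed
qed

lemma crossing:
  assumes z: "z \<in> open_alcove" and u: "u \<in> AW" and j: "j \<in> I" and b: "\<beta> \<in> \<Phi>"
    and sep: "(u z \<bullet> \<beta> < of_int k) \<noteq> (u (s j z) \<bullet> \<beta> < of_int k)"
  shows "(\<beta> = wbar u (nrm j) \<and> k = tr u (nrm j) (lev j)) \<or> (\<beta> = - wbar u (nrm j) \<and> k = - tr u (nrm j) (lev j))"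
proof -
  obtain \<gamma> m where g: "\<gamma> \<in> \<Phi>" "\<And>x. u x \<bullet> \<beta> - of_int k = x \<bullet> \<gamma> - of_int m" "wbar u \<gamma> = \<beta>" "tr u \<gamma> m = k"
    using pull_back[OF u b] by blast
  have "(z \<bullet> \<gamma> < of_int m) \<noteq> (s j z \<bullet> \<gamma> < of_int m)"
    using sep g(2)[of z] g(2)[of "s j z"] by auto
  from only_wall_separates[OF z j g(1) this] show ?thesis
  proof (elim disjE conjE)
    assume "\<gamma> = - nrm j" "m = - lev j"
    moreover have "real_of_int (tr u (- nrm j) (- lev j)) = of_int (- tr u (nrm j) (lev j))"
      using of_int_tr[OF u nrm_root[OF j]] of_int_tr[OF u neg_root[OF nrm_root[OF j]]]
      by (simp add: weyl_neg[OF wbar_weyl[OF u]])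
    then have "tr u (- nrm j) (- lev j) = - tr u (nrm j) (lev j)" by linarith
    ultimately show ?thesis using g by (auto simp: weyl_neg[OF wbar_weyl[OF u]])
  qed (use g in auto)
qed

lemma crossing_conj:
  assumes z: "z \<in> open_alcove" and u: "u \<in> AW" and j: "j \<in> I" and b: "\<beta> \<in> \<Phi>"
    and sep: "(u z \<bullet> \<beta> < of_int k) \<noteq> (u (s j z) \<bullet> \<beta> < of_int k)"
  shows "u \<circ> s j = aff_refl \<beta> k \<circ> u"
  unfolding sref_eq aff_refl_conj[OF u nrm_root[OF j]]
  using crossing[OF assms] by (elim disjE conjE) (simp_all only: aff_refl_neg)

text \<open>Geometric exchange condition: a gallery step that crosses a wall of the fundamental
  alcove is the reflection in that wall.\<close>

lemma crossing_wall:
  assumes z: "z \<in> open_alcove" and u: "u \<in> AW" and i: "i \<in> I" and j: "j \<in> I"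
    and sep: "(u z \<bullet> nrm i < of_int (lev i)) \<noteq> (u (s j z) \<bullet> nrm i < of_int (lev i))"
  shows "u \<circ> s j = s i \<circ> u"
  using crossing_conj[OF z u j nrm_root[OF i] sep] by (simp add: sref_eq)

section \<open>Generation by the simple reflections\<close>

definition simple_group :: "('v \<Rightarrow> 'v) set" where "simple_group = gen_group (s ` I)"

lemma simple_group_aff_weyl: "u \<in> simple_group \<Longrightarrow> u \<in> AW"
  unfolding simple_group_def aff_weyl_def
  by (erule gen_group_mono[rotated]) (use sref_aff_weyl in \<open>auto simp: aff_weyl_def\<close>)

lemma simple_group_comp: "u \<in> simple_group \<Longrightarrow> v \<in> simple_group \<Longrightarrow> u \<circ> v \<in> simple_group"
  and simple_group_sref: "i \<in> I \<Longrightarrow> s i \<in> simple_group"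
  and simple_group_inv: "u \<in> simple_group \<Longrightarrow> inv u \<in> simple_group"
  using gen_group_inv[of u "s ` I"] sref_sref
  by (auto simp: simple_group_def intro: gen_group_comp gen_group_gen)

text \<open>The group is infinite, but after pulling back, the quantity measures \<open>z\<close>
  against hyperplanes of the arrangement, and only finitely many of these give a value of at most
  \<open>R\<close>.\<close>

lemma closest_to_hyperplane:
  assumes z: "z \<in> open_alcove" and b: "\<beta> \<in> \<Phi>"
  obtains u where "u \<in> simple_group" "\<And>v. v \<in> simple_group \<Longrightarrow> \<bar>u z \<bullet> \<beta> - of_int k\<bar> \<le> \<bar>v z \<bullet> \<beta> - of_int k\<bar>"
proof -
  define R where "R = \<bar>z \<bullet> \<beta> - of_int k\<bar>"
  define D where "D = (\<lambda>(\<gamma>, n::int). \<bar>z \<bullet> \<gamma> - of_int n\<bar>) ` {(\<gamma>, n). \<gamma> \<in> \<Phi> \<and> \<bar>z \<bullet> \<gamma> - of_int n\<bar> \<le> R}"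
  define E where "E = {\<bar>v z \<bullet> \<beta> - of_int k\<bar> | v. v \<in> simple_group \<and> \<bar>v z \<bullet> \<beta> - of_int k\<bar> \<le> R}"
  have "{(\<gamma>, n). \<gamma> \<in> \<Phi> \<and> \<bar>z \<bullet> \<gamma> - of_int n\<bar> \<le> R} \<subseteq> Sigma \<Phi> (\<lambda>\<gamma>. {\<lfloor>z \<bullet> \<gamma> - R\<rfloor>..\<lceil>z \<bullet> \<gamma> + R\<rceil>})"
    by (auto simp: abs_le_iff floor_le_iff le_ceiling_iff)
  then have finD: "finite D" unfolding D_def
    by (intro finite_imageI) (auto intro: finite_subset[OF _ finite_SigmaI[OF finite_roots]])
  have "E \<subseteq> D"
  proof
    fix x assume "x \<in> E"
    then obtain v where v: "v \<in> simple_group" "x = \<bar>v z \<bullet> \<beta> - of_int k\<bar>" "x \<le> R" by (auto simp: E_def)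
    obtain \<gamma> m where "\<gamma> \<in> \<Phi>" "\<And>x. v x \<bullet> \<beta> - of_int k = x \<bullet> \<gamma> - of_int m"
      using pull_back[OF simple_group_aff_weyl[OF v(1)] b] by blast
    then show "x \<in> D" using v unfolding D_def by (intro image_eqI[of _ _ "(\<gamma>, m)"]) auto
  qed
  then have finE: "finite E" using finD finite_subset by blast
  have idE: "R \<in> E" unfolding E_def R_def
    by (intro CollectI exI[of _ id]) (auto simp: simple_group_def intro: gen_group.gen_id)
  have "Min E \<in> E" using finE idE by (intro Min_in) auto
  then obtain u where u: "u \<in> simple_group" "\<bar>u z \<bullet> \<beta> - of_int k\<bar> = Min E" "Min E \<le> R" unfolding E_def by auto
  have "\<bar>u z \<bullet> \<beta> - of_int k\<bar> \<le> \<bar>v z \<bullet> \<beta> - of_int k\<bar>" if "v \<in> simple_group" for v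
  proof (cases "\<bar>v z \<bullet> \<beta> - of_int k\<bar> \<le> R")
    case True
    then show ?thesis unfolding u(2) using that finE by (intro Min_le) (auto simp: E_def)
  qed (use u in auto)
  then show ?thesis using that u(1) by blast
qed

text \<open>Otherwise \<gamma> pairs nonnegatively with every simple root, hence with \<theta> -
  \<gamma>, so its squared norm is at most its pairing with \<theta>, which is nonpositive.\<close>

lemma no_antidominant_root:
  assumes "\<gamma> \<in> \<Phi>" shows "\<exists>i\<in>I. nrm i \<bullet> \<gamma> > 0"
proof (rule ccontr)
  assume "\<not> ?thesis"
  then have le: "\<theta> \<bullet> \<gamma> \<le> 0" "\<And>\<alpha>. \<alpha> \<in> \<Delta> \<Longrightarrow> \<alpha> \<bullet> \<gamma> \<ge> 0" by (auto simp: aff_index_def not_less)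
  have "(\<theta> - \<gamma>) \<bullet> \<gamma> \<ge> 0" unfolding inner_cf[of "\<theta> - \<gamma>" \<gamma>]
    using le(2) highest_root_cf[OF assms] by (intro sum_nonneg mult_nonneg_nonneg) auto
  then have "\<gamma> \<bullet> \<gamma> \<le> 0" using le(1) by (simp add: inner_diff)
  then show False using root_nonzero[OF assms] by (simp add: not_le flip: not_less)
qed

text \<open>Move the hyperplane by the group of simple reflections as close to \<open>z\<close> as possible;
  it is then a wall of the fundamental alcove.\<close>

lemma aff_refl_simple_group_aux:
  assumes z: "z \<in> open_alcove" and b: "\<beta> \<in> \<Phi>" and u: "u \<in> simple_group"
    and min: "\<And>v. v \<in> simple_group \<Longrightarrow> \<bar>u z \<bullet> \<beta> - of_int k\<bar> \<le> \<bar>v z \<bullet> \<beta> - of_int k\<bar>"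
    and neg: "u z \<bullet> \<beta> < of_int k"
  shows "aff_refl \<beta> k \<in> simple_group"
proof -
  have uA: "u \<in> AW" using u simple_group_aff_weyl by auto
  obtain \<gamma> m where g: "\<gamma> \<in> \<Phi>" "\<And>x. u x \<bullet> \<beta> - of_int k = x \<bullet> \<gamma> - of_int m"
    using pull_back[OF uA b] by blast
  obtain i where i: "i \<in> I" "nrm i \<bullet> \<gamma> > 0" using no_antidominant_root[OF g(1)] by auto
  have nn: "nrm i \<bullet> nrm i > 0" using root_nonzero[OF nrm_root[OF i(1)]] by simp
  have "s i z \<bullet> \<gamma> = z \<bullet> \<gamma> - (z \<bullet> nrm i - of_int (lev i)) * (2 / (nrm i \<bullet> nrm i) * (nrm i \<bullet> \<gamma>))"
    by (simp add: sref_eq aff_refl_def coroot_def inner_diff)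
  moreover have "(z \<bullet> nrm i - of_int (lev i)) * (2 / (nrm i \<bullet> nrm i) * (nrm i \<bullet> \<gamma>)) < 0"
    using nrm_level[OF z i(1)] i nn by (intro mult_neg_pos mult_pos_pos divide_pos_pos) auto
  ultimately have gt: "s i z \<bullet> \<gamma> > z \<bullet> \<gamma>" by linarith
  \<comment> \<open>Reflecting in wall \<open>i\<close> moves the point towards the hyperplane.
    Staying on the same side would beat the minimum, so the hyperplane itself is crossed.\<close>
  have "\<not> (u (s i z) \<bullet> \<beta> < of_int k)"
  proof
    assume "u (s i z) \<bullet> \<beta> < of_int k"
    moreover have "\<bar>u z \<bullet> \<beta> - of_int k\<bar> \<le> \<bar>(u \<circ> s i) z \<bullet> \<beta> - of_int k\<bar>"
      using u i by (intro min simple_group_comp simple_group_sref)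
    ultimately show False using gt neg g(2)[of z] g(2)[of "s i z"] by auto
  qed
  then have "u \<circ> s i = aff_refl \<beta> k \<circ> u" using neg by (intro crossing_conj[OF z uA i(1) b]) auto
  then have "aff_refl \<beta> k = u \<circ> s i \<circ> inv u" using aff_weyl_inv_apply(3)[OF uA] by (metis comp_assoc comp_id)
  then show ?thesis using u i simple_group_comp simple_group_inv simple_group_sref by metis
qed

end

text \<open>One point stands for each alcove: sides, chambers and separation are all tested on the
  orbit of \<open>z\<close>. Only membership in the open alcove is asked of \<open>z\<close>, so the
  locale can be interpreted at other points too.\<close>

locale alcove_point = irreducible_root_system +
  fixes z :: 'a
  assumes z: "z \<in> open_alcove"
begin

lemma aff_refl_simple_group: assumes b: "\<beta> \<in> \<Phi>" shows "aff_refl \<beta> k \<in> simple_group"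
proof -
  obtain u where u: "u \<in> simple_group" "\<And>v. v \<in> simple_group \<Longrightarrow> \<bar>u z \<bullet> \<beta> - of_int k\<bar> \<le> \<bar>v z \<bullet> \<beta> - of_int k\<bar>"
    using closest_to_hyperplane[OF z b] by blast
  show ?thesis
  proof (cases "u z \<bullet> \<beta> < of_int k")
    case True then show ?thesis using u by (intro aff_refl_simple_group_aux[OF z b u(1)]) auto
  next
    case False
    moreover have "u z \<bullet> \<beta> \<noteq> of_int k" using aff_weyl_generic[OF z simple_group_aff_weyl[OF u(1)] b] .
    moreover have "\<bar>x \<bullet> \<beta> - of_int k\<bar> = \<bar>x \<bullet> (- \<beta>) - of_int (- k)\<bar>" for x by simp
    ultimately have "aff_refl (- \<beta>) (- k) \<in> simple_group"
      using u by (intro aff_refl_simple_group_aux[OF z neg_root[OF b] u(1)]) auto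
    then show ?thesis by (simp add: aff_refl_neg)
  qed
qed

lemma aff_weyl_simple_group: "u \<in> AW \<Longrightarrow> u \<in> simple_group"
  unfolding aff_weyl_def simple_group_def
  by (erule gen_group_mono[rotated]) (use aff_refl_simple_group in \<open>auto simp: simple_group_def\<close>)

section \<open>Words of simple reflections and freeness of the action on alcoves\<close>

definition wd :: "'a option list \<Rightarrow> 'a \<Rightarrow> 'a" where "wd xs = foldr (\<lambda>i f. s i \<circ> f) xs id"

lemma wd_simps [simp]: "wd [] = id" "wd (i # xs) = s i \<circ> wd xs"
  by (auto simp: wd_def)

lemma wd_append: "wd (xs @ ys) = wd xs \<circ> wd ys"
  by (induction xs) (auto simp: comp_assoc)

lemma wd_aff_weyl: "set xs \<subseteq> I \<Longrightarrow> wd xs \<in> AW"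
  by (induction xs) (auto simp: id_aff_weyl intro: aff_weyl_comp sref_aff_weyl)

lemma simple_group_wd: "u \<in> simple_group \<Longrightarrow> \<exists>xs. set xs \<subseteq> I \<and> u = wd xs"
  unfolding simple_group_def
proof (induction rule: gen_group_induct)
  case (gen_step u g)
  then obtain xs i where "set xs \<subseteq> I" "u = wd xs" "i \<in> I" "g = s i" by auto
  then show ?case by (intro exI[of _ "i # xs"]) auto
qed (auto intro: exI[of _ "[]"])

text \<open>A gallery that returns to the side of its first wall crosses that wall again, and deleting
  the two crossings shortens the word.\<close>

lemma wd_faithful: "set xs \<subseteq> I \<Longrightarrow> wd xs z \<in> open_alcove \<Longrightarrow> wd xs = id"
proof (induction "length xs" arbitrary: xs rule: less_induct)
  case less
  show ?case
  proof (cases xs)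
    case (Cons i ys)
    define side where "side j \<longleftrightarrow> wd (take j xs) z \<bullet> nrm i < of_int (lev i)" for j
    have i: "i \<in> I" using Cons less.prems by auto
    have s1: "\<not> side 1" using Cons nrm_level[OF z i] sref_nrm[OF i, of z] by (auto simp: side_def)
    have "side (length xs)" using less.prems(2) i by (auto simp: side_def open_alcove_def)
    have "\<exists>j\<ge>1. j < length xs \<and> \<not> side j \<and> side (Suc j)"
    proof (rule ccontr)
      assume n: "\<not> ?thesis"
      have "\<not> side j" if "j \<ge> 1" "j \<le> length xs" for j
        using that by (induction rule: dec_induct) (use n s1 in \<open>auto simp: Suc_le_eq\<close>)
      then show False using \<open>side (length xs)\<close> Cons by auto
    qed
    then obtain j where j: "j \<ge> 1" "j < length xs" "\<not> side j" "side (Suc j)" by auto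
    let ?w = "wd (take j xs)"
    have xj: "xs ! j \<in> I" using j less.prems by auto
    have tk: "wd (take (Suc j) xs) = ?w \<circ> s (xs ! j)"
      using j by (simp add: take_Suc_conv_app_nth wd_append)
    have wA: "?w \<in> AW" using less.prems set_take_subset by (intro wd_aff_weyl) fastforce
    have "?w \<circ> s (xs ! j) = s i \<circ> ?w"
      using j(3,4) tk by (intro crossing_wall[OF z wA i xj]) (auto simp: side_def)
    moreover have "?w = s i \<circ> wd (take (j - 1) ys)" using Cons j by (cases j) auto
    ultimately have "wd (take (Suc j) xs) = wd (take (j - 1) ys)"
      using tk sref_sref[OF i] by (metis comp_assoc id_comp)
    then have eq: "wd xs = wd (take (j - 1) ys @ drop (Suc j) xs)"
      using append_take_drop_id[of "Suc j" xs] by (metis wd_append)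
    have "wd (take (j - 1) ys @ drop (Suc j) xs) = id"
    proof (rule less.hyps)
      show "length (take (j - 1) ys @ drop (Suc j) xs) < length xs" using j Cons by auto
      show "set (take (j - 1) ys @ drop (Suc j) xs) \<subseteq> I"
        using less.prems Cons by (auto dest: in_set_takeD in_set_dropD)
      show "wd (take (j - 1) ys @ drop (Suc j) xs) z \<in> open_alcove" using eq less.prems by simp
    qed
    then show ?thesis using eq by simp
  qed simp
qed

lemma faithful: "u \<in> AW \<Longrightarrow> u z \<in> open_alcove \<Longrightarrow> u = id"
  using simple_group_wd[OF aff_weyl_simple_group] wd_faithful by auto

end

section \<open>Demazure products and chambers\<close>

context alcove_point
begin

abbreviation "A \<equiv> fund_alcove \<Phi> \<Delta>"

section \<open>Sides of hyperplanes decided at the base point\<close>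

lemma alcove_root_bounds:
  assumes "u \<in> AW" "\<beta> \<in> \<Phi>"
  obtains m :: int where "of_int m < u z \<bullet> \<beta>" "u z \<bullet> \<beta> < of_int m + 1"
    "\<And>x. x \<in> A \<Longrightarrow> of_int m \<le> u x \<bullet> \<beta> \<and> u x \<bullet> \<beta> \<le> of_int m + 1"
proof -
  obtain \<gamma> l where g: "\<gamma> \<in> \<Phi>" "\<And>x. u x \<bullet> \<beta> - of_int 0 = x \<bullet> \<gamma> - of_int l"
    using pull_back[OF assms, of 0] by blast
  have "\<exists>m::int. of_int m < z \<bullet> \<gamma> \<and> z \<bullet> \<gamma> < of_int m + 1 \<and> (\<forall>x\<in>A. of_int m \<le> x \<bullet> \<gamma> \<and> x \<bullet> \<gamma> \<le> of_int m + 1)"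
  proof (cases "\<gamma> \<in> Pos")
    case True
    then show ?thesis using open_alcove_bounds[OF z True] fund_alcove_bounds[OF _ True] by (intro exI[of _ 0]) auto
  next
    case False
    then have n: "- \<gamma> \<in> Pos" using neg_pos_iff[OF g(1)] by simp
    have "-1 \<le> x \<bullet> \<gamma>" "x \<bullet> \<gamma> \<le> 0" if "x \<in> A" for x using fund_alcove_bounds[OF that n] by auto
    then show ?thesis using open_alcove_bounds[OF z n] by (intro exI[of _ "-1"]) auto
  qed
  then obtain m :: int where "of_int m < z \<bullet> \<gamma>" "z \<bullet> \<gamma> < of_int m + 1" "\<forall>x\<in>A. of_int m \<le> x \<bullet> \<gamma> \<and> x \<bullet> \<gamma> \<le> of_int m + 1"
    by auto
  then show ?thesis using that[of "m - l"] g(2) by (auto simp: algebra_simps)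
qed

lemma zA: "z \<in> A" using open_alcove_fund[OF z] .

lemma generic: "u \<in> AW \<Longrightarrow> \<beta> \<in> \<Phi> \<Longrightarrow> u z \<bullet> \<beta> \<noteq> of_int k"
  using aff_weyl_generic[OF z] .

lemma generic_z: "\<beta> \<in> \<Phi> \<Longrightarrow> z \<bullet> \<beta> \<noteq> of_int k"
  using generic[OF id_aff_weyl] by simp

lemma neg_less_iff: "u \<in> AW \<Longrightarrow> \<beta> \<in> \<Phi> \<Longrightarrow> u z \<bullet> (- \<beta>) < of_int (- k) \<longleftrightarrow> \<not> u z \<bullet> \<beta> < of_int k"
  using generic[of u \<beta> k] by auto

lemma neg_less_z_iff: "\<beta> \<in> \<Phi> \<Longrightarrow> z \<bullet> (- \<beta>) < of_int (- k) \<longleftrightarrow> \<not> z \<bullet> \<beta> < of_int k"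
  using generic_z[of \<beta> k] by auto

text \<open>A closed alcove lies in the closed unit strip around \<open>u z\<close>, and no level
  falls strictly inside a strip. Separation by closed half-spaces thus becomes a comparison at one
  point.\<close>

lemma alcove_below: assumes "u \<in> AW" "\<beta> \<in> \<Phi>" shows "alcove \<Phi> \<Delta> u \<subseteq> {\<gamma>. \<gamma> \<bullet> \<beta> \<le> of_int k} \<longleftrightarrow> u z \<bullet> \<beta> < of_int k"
proof
  assume "alcove \<Phi> \<Delta> u \<subseteq> {\<gamma>. \<gamma> \<bullet> \<beta> \<le> of_int k}"
  then have "u z \<bullet> \<beta> \<le> of_int k" using zA by (auto simp: alcove_def)
  then show "u z \<bullet> \<beta> < of_int k" using generic[OF assms, of k] by simp
next
  assume lt: "u z \<bullet> \<beta> < of_int k"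
  obtain m :: int where m: "of_int m < u z \<bullet> \<beta>" "u z \<bullet> \<beta> < of_int m + 1"
    "\<And>x. x \<in> A \<Longrightarrow> of_int m \<le> u x \<bullet> \<beta> \<and> u x \<bullet> \<beta> \<le> of_int m + 1"
    using alcove_root_bounds[OF assms] by blast
  have "m < k" using int_below_iff[OF m(1,2)] lt by blast
  then have "real_of_int m + 1 \<le> of_int k" by linarith
  then show "alcove \<Phi> \<Delta> u \<subseteq> {\<gamma>. \<gamma> \<bullet> \<beta> \<le> of_int k}" using m(3) by (force simp: alcove_def)
qed

lemma alcove_above: assumes "u \<in> AW" "\<beta> \<in> \<Phi>" shows "alcove \<Phi> \<Delta> u \<subseteq> {\<gamma>. \<gamma> \<bullet> \<beta> \<ge> of_int k} \<longleftrightarrow> \<not> u z \<bullet> \<beta> < of_int k"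
proof -
  have "{\<gamma>. \<gamma> \<bullet> \<beta> \<ge> of_int k} = {\<gamma>. \<gamma> \<bullet> (- \<beta>) \<le> of_int (- k)}" by auto
  then show ?thesis using alcove_below[OF assms(1) neg_root[OF assms(2)], of "- k"] neg_less_iff[OF assms, of k] by simp
qed

lemma alcove_id: "alcove \<Phi> \<Delta> id = A"
  by (simp add: alcove_def)

lemma separates_iff:
  assumes "u \<in> AW" "v \<in> AW" "\<beta> \<in> \<Phi>"
  shows "separates (\<beta>, k) (alcove \<Phi> \<Delta> u) (alcove \<Phi> \<Delta> v) \<longleftrightarrow> (u z \<bullet> \<beta> < of_int k) \<noteq> (v z \<bullet> \<beta> < of_int k)"
  unfolding separates_def fst_conv snd_conv
  using alcove_above[OF assms(1,3)] alcove_above[OF assms(2,3)] alcove_below[OF assms(1,3)] alcove_below[OF assms(2,3)]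
  by auto

lemma sleft_eq: "sleft \<Phi> \<Delta> i u = u \<circ> s i"
  by (simp add: sleft_def gmult_def)

lemma below_tr:
  assumes "u \<in> AW" "\<gamma> \<in> \<Phi>" shows "u x \<bullet> wbar u \<gamma> < of_int (tr u \<gamma> k) \<longleftrightarrow> x \<bullet> \<gamma> < of_int k"
  using inner_tr[OF assms, of x k] by linarith

lemma below_tr':
  assumes "u \<in> AW" "\<gamma> \<in> \<Phi>" shows "y \<bullet> wbar u \<gamma> < of_int (tr u \<gamma> k) \<longleftrightarrow> inv u y \<bullet> \<gamma> < of_int k"
  using below_tr[OF assms, of "inv u y"] aff_weyl_inv_apply[OF assms(1)] by simp

lemma wbar_nrm_root: "u \<in> AW \<Longrightarrow> i \<in> I \<Longrightarrow> wbar u (nrm i) \<in> \<Phi>"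
  using weyl_root[OF wbar_weyl nrm_root] .

lemma cross_side: 
  assumes "u \<in> AW" "i \<in> I"
  shows "u z \<bullet> wbar u (nrm i) < of_int (tr u (nrm i) (lev i))"
    and "\<not> u (s i z) \<bullet> wbar u (nrm i) < of_int (tr u (nrm i) (lev i))"
  using below_tr[OF assms(1) nrm_root[OF assms(2)]] nrm_level[OF z assms(2)] sref_nrm[OF assms(2), of z] by auto

section \<open>Ascents and Demazure products\<close>

lemma sep_hyp_eq:
  assumes u: "u \<in> AW" and i: "i \<in> I"
  shows "sep_hyp \<Phi> \<Delta> u i = (if wbar u (nrm i) \<in> Pos then (wbar u (nrm i), tr u (nrm i) (lev i))
     else (- wbar u (nrm i), - tr u (nrm i) (lev i)))" (is "_ = ?H")
proof -
  let ?b = "wbar u (nrm i)" and ?k = "tr u (nrm i) (lev i)"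
  have b: "?b \<in> \<Phi>" using wbar_nrm_root[OF assms] .
  have us: "u \<circ> s i \<in> AW" using aff_weyl_comp[OF u sref_aff_weyl[OF i]] .
  have P: "fst ?H \<in> Pos" using neg_pos_iff[OF b] by auto
  show ?thesis unfolding sep_hyp_def sleft_eq
  proof (rule the_equality)
    have s1: "separates (?b, ?k) (alcove \<Phi> \<Delta> u) (alcove \<Phi> \<Delta> (u \<circ> s i))"
      using cross_side[OF assms] by (simp add: separates_iff[OF u us b])
    have "separates (- ?b, - ?k) (alcove \<Phi> \<Delta> u) (alcove \<Phi> \<Delta> (u \<circ> s i))"
      unfolding separates_iff[OF u us neg_root[OF b]] neg_less_iff[OF u b] neg_less_iff[OF us b]
      using cross_side[OF assms] by simp
    with s1 show "fst ?H \<in> Pos \<and> separates ?H (alcove \<Phi> \<Delta> u) (alcove \<Phi> \<Delta> (u \<circ> s i))" using P by auto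
    fix H assume H: "fst H \<in> Pos \<and> separates H (alcove \<Phi> \<Delta> u) (alcove \<Phi> \<Delta> (u \<circ> s i))"
    obtain \<beta> k where [simp]: "H = (\<beta>, k)" by fastforce
    have "(u z \<bullet> \<beta> < of_int k) \<noteq> (u (s i z) \<bullet> \<beta> < of_int k)"
      using H separates_iff[OF u us pos_root] by auto
    from crossing[OF z u i pos_root this] H show "H = ?H"
      using neg_pos_iff[OF b] by auto
  qed
qed

text \<open>Pulled back by \<open>u\<close>, the wall between the alcoves of \<open>u\<close> and
  \<open>u o s i\<close> is the \<open>i\<close>-th wall of the fundamental alcove, and the base
  point becomes \<open>inv u z\<close>. So the condition says that the step leads away from the base
  alcove.\<close>

definition asc :: "('a \<Rightarrow> 'a) \<Rightarrow> 'a option \<Rightarrow> bool" where "asc u i \<longleftrightarrow> inv u z \<bullet> nrm i < of_int (lev i)"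

lemma asc_cross: "u \<in> AW \<Longrightarrow> i \<in> I \<Longrightarrow> asc u i \<longleftrightarrow> z \<bullet> wbar u (nrm i) < of_int (tr u (nrm i) (lev i))"
  using below_tr'[OF _ nrm_root] by (auto simp: asc_def)

lemma separates_sep_hyp:
  assumes u: "u \<in> AW" and i: "i \<in> I"
  shows "separates (sep_hyp \<Phi> \<Delta> u i) (alcove \<Phi> \<Delta> u) A \<longleftrightarrow> \<not> asc u i"
  using separates_iff[OF u id_aff_weyl wbar_nrm_root[OF assms]]
    separates_iff[OF u id_aff_weyl neg_root[OF wbar_nrm_root[OF assms]], of "- tr u (nrm i) (lev i)"]
    cross_side[OF assms] asc_cross[OF assms] neg_less_z_iff[OF wbar_nrm_root[OF assms]] neg_less_iff[OF u wbar_nrm_root[OF assms]]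
  unfolding sep_hyp_eq[OF assms] alcove_id by (simp del: inner_minus_right of_int_minus)

text \<open>The only hyperplane crossed is one that did not separate before, so no separation is
  ever undone.\<close>

lemma asc_mono:
  assumes u: "u \<in> AW" and i: "i \<in> I" and a: "asc u i" and b: "\<beta> \<in> \<Phi>"
    and sep: "(u z \<bullet> \<beta> < of_int k) \<noteq> (z \<bullet> \<beta> < of_int k)"
  shows "(u (s i z) \<bullet> \<beta> < of_int k) \<noteq> (z \<bullet> \<beta> < of_int k)"
proof (rule ccontr)
  assume "\<not> ?thesis"
  then have "(u z \<bullet> \<beta> < of_int k) \<noteq> (u (s i z) \<bullet> \<beta> < of_int k)" using sep by auto
  from crossing[OF z u i b this] show False
    using sep cross_side(1)[OF u i] a[unfolded asc_cross[OF u i]]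
      neg_less_z_iff[OF wbar_nrm_root[OF u i]] neg_less_iff[OF u wbar_nrm_root[OF u i]] by (elim disjE conjE) (simp_all only: simp_thms)
qed

definition dstep :: "('a \<Rightarrow> 'a) \<Rightarrow> 'a option \<Rightarrow> 'a \<Rightarrow> 'a" where
  "dstep u i = (if asc u i then u \<circ> s i else u)"

text \<open>This is \<open>dstep\<close> carried over by inversion: the letter enters on the outer
  side of the composition.\<close>

definition lstep :: "'a option \<Rightarrow> ('a \<Rightarrow> 'a) \<Rightarrow> 'a \<Rightarrow> 'a" where
  "lstep i u = (if asc (inv u) i then s i \<circ> u else u)"

lemma dstep_aff_weyl: "u \<in> AW \<Longrightarrow> i \<in> I \<Longrightarrow> dstep u i \<in> AW"
  by (simp add: dstep_def aff_weyl_comp sref_aff_weyl)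

lemma inv_inv_aff: "u \<in> AW \<Longrightarrow> inv (inv u) = u"
  using aff_weyl_inv(1) by (simp add: inv_inv_eq)

lemma inv_comp_sref: "u \<in> AW \<Longrightarrow> i \<in> I \<Longrightarrow> inv (u \<circ> s i) = s i \<circ> inv u"
  using o_inv_distrib[of u "s i"] aff_weyl_inv(1) sref_aff_weyl sref_inv by metis

lemma inv_sref_comp: "u \<in> AW \<Longrightarrow> i \<in> I \<Longrightarrow> inv (s i \<circ> u) = inv u \<circ> s i"
  using o_inv_distrib[of "s i" u] aff_weyl_inv(1) sref_aff_weyl sref_inv by metis

lemma inv_dstep: "u \<in> AW \<Longrightarrow> i \<in> I \<Longrightarrow> inv (lstep i u) = dstep (inv u) i"
  using inv_sref_comp by (simp add: dstep_def lstep_def)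

lemma asc_flip: assumes "u \<in> AW" "i \<in> I" shows "asc (u \<circ> s i) i \<longleftrightarrow> \<not> asc u i"
  using sref_nrm[OF assms(2), of "inv u z"] generic[OF aff_weyl_inv(2)[OF assms(1)] nrm_root[OF assms(2)], of "lev i"]
  unfolding asc_def inv_comp_sref[OF assms] by auto

lemma aff_refl_flip:
  assumes "\<beta> \<noteq> 0" shows "aff_refl \<beta> k x \<bullet> \<beta> = 2 * of_int k - x \<bullet> \<beta>"
  using assms by (simp add: aff_refl_def coroot_def inner_diff_left)

text \<open>The equation says that the wall being crossed is the \<open>i\<close>-th wall of the
  base alcove, so both ascents ask whether this one hyperplane leaves \<open>u z\<close> and
  \<open>z\<close> on the same side.\<close>

lemma asc_commuting:
  assumes u: "u \<in> AW" and i: "i \<in> I" and j: "j \<in> I" and eq: "u \<circ> s j = s i \<circ> u"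
  shows "asc u j \<longleftrightarrow> asc (inv u) i"
proof -
  let ?b = "wbar u (nrm j)" and ?k = "tr u (nrm j) (lev j)"
  have b: "?b \<in> \<Phi>" using wbar_nrm_root[OF u j] .
  have "aff_refl ?b ?k \<circ> u = s i \<circ> u" using aff_refl_conj[OF u nrm_root[OF j], of "lev j"] eq by (simp add: sref_eq)
  then have "aff_refl ?b ?k \<circ> (u \<circ> inv u) = s i \<circ> (u \<circ> inv u)" by (metis comp_assoc)
  then have "aff_refl ?b ?k = s i" using aff_weyl_inv_apply(3)[OF u] by simp
  then have "s i z \<bullet> ?b = 2 * of_int ?k - z \<bullet> ?b" using aff_refl_flip[OF root_nonzero[OF b]] by metis
  then have "(z \<bullet> ?b < of_int ?k) \<noteq> (s i z \<bullet> ?b < of_int ?k)" using generic_z[OF b, of ?k] by auto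
  from only_wall_separates[OF z i b this] show ?thesis
  proof (elim disjE conjE)
    assume e: "?b = nrm i" "?k = lev i"
    then show ?thesis
      using cross_side(1)[OF u j] asc_cross[OF u j] nrm_level[OF z i] by (simp add: asc_def inv_inv_aff[OF u])
  next
    assume e: "?b = - nrm i" "?k = - lev i"
    then show ?thesis
      using cross_side(1)[OF u j] asc_cross[OF u j] nrm_level[OF z i] by (simp add: asc_def inv_inv_aff[OF u])
  qed
qed

text \<open>If the two walls agree, both steps make the same move or none, and after a move the
  other step is a descent. If they differ, neither step crosses the wall that decides the ascent of
  the other.\<close>

lemma dstep_lstep:
  assumes u: "u \<in> AW" and i: "i \<in> I" and j: "j \<in> I"
  shows "dstep (lstep i u) j = lstep i (dstep u j)"
proof (cases "u \<circ> s j = s i \<circ> u")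
  case True
  have iu: "inv u \<in> AW" using aff_weyl_inv(2)[OF u] .
  have "asc (inv (s i \<circ> u)) i \<longleftrightarrow> \<not> asc (inv u) i"
    using asc_flip[OF iu i] inv_sref_comp[OF u i] by simp
  then show ?thesis
    using asc_commuting[OF u i j True] asc_flip[OF u j] True by (auto simp: dstep_def lstep_def)
next
  case False
  have iu: "inv u \<in> AW" using aff_weyl_inv(2)[OF u] .
  have 1: "asc (s i \<circ> u) j \<longleftrightarrow> asc u j"
  proof (rule ccontr)
    assume "\<not> ?thesis"
    then have "inv u \<circ> s i = s j \<circ> inv u"
      by (intro crossing_wall[OF z iu j i]) (auto simp: asc_def inv_sref_comp[OF u i])
    then have "u \<circ> (inv u \<circ> s i) \<circ> u = u \<circ> (s j \<circ> inv u) \<circ> u" by simp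
    then have "s i \<circ> u = u \<circ> s j" using aff_weyl_inv_apply[OF u] by (metis comp_assoc comp_id id_comp)
    then show False using False by simp
  qed
  have 2: "asc (inv (u \<circ> s j)) i \<longleftrightarrow> asc (inv u) i"
  proof (rule ccontr)
    assume "\<not> ?thesis"
    then have "u \<circ> s j = s i \<circ> u"
      using inv_inv_aff[OF u] inv_inv_aff[OF aff_weyl_comp[OF u sref_aff_weyl[OF j]]]
      by (intro crossing_wall[OF z u i j]) (auto simp: asc_def)
    then show False using False by simp
  qed
  show ?thesis using 1 2 by (auto simp: dstep_def lstep_def comp_assoc)
qed

lemma foldl_dstep_aff_weyl: "u \<in> AW \<Longrightarrow> set xs \<subseteq> I \<Longrightarrow> foldl dstep u xs \<in> AW"
  by (induction xs arbitrary: u) (auto simp: dstep_aff_weyl)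

lemma foldl_dstep_lstep:
  "u \<in> AW \<Longrightarrow> i \<in> I \<Longrightarrow> set xs \<subseteq> I \<Longrightarrow> foldl dstep (lstep i u) xs = lstep i (foldl dstep u xs)"
  by (induction xs arbitrary: u) (auto simp: dstep_lstep dstep_aff_weyl)

lemma asc_id: "i \<in> I \<Longrightarrow> asc id i"
  using nrm_level[OF z] by (simp add: asc_def)

text \<open>The first letter is read as an outer step on \<open>id\<close>, moved past the remaining
  letters by commutation, and turned by inversion into a final inner step.\<close>

lemma demazure_rev: "set xs \<subseteq> I \<Longrightarrow> foldl dstep id (rev xs) = inv (foldl dstep id xs)"
proof (induction xs)
  case (Cons i xs)
  then have i: "i \<in> I" and xs: "set xs \<subseteq> I" by auto
  have "foldl dstep id (i # xs) = foldl dstep (lstep i id) xs"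
    using asc_id[OF i] by (simp add: dstep_def lstep_def)
  also have "\<dots> = lstep i (foldl dstep id xs)" using foldl_dstep_lstep[OF id_aff_weyl i xs] .
  finally have "inv (foldl dstep id (i # xs)) = dstep (inv (foldl dstep id xs)) i"
    using inv_dstep[OF foldl_dstep_aff_weyl[OF id_aff_weyl xs] i] by simp
  moreover have "foldl dstep id (rev (i # xs)) = dstep (foldl dstep id (rev xs)) i" by simp
  ultimately show ?case using Cons.IH[OF xs] by metis
qed simp

text \<open>Preserving positivity puts \<open>inv g z\<close> back into the open alcove, where the
  action is free.\<close>

lemma weyl_pos_id: assumes "g \<in> W" "\<And>\<beta>. \<beta> \<in> Pos \<Longrightarrow> g \<beta> \<in> Pos" shows "g = id"
proof -
  have iW: "inv g \<in> W" using weyl_inv[OF assms(1)] by auto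
  have "inv g z \<in> open_alcove"
  proof (unfold open_alcove_def, safe)
    fix i assume "i \<in> I"
    then show "inv g z \<bullet> nrm i < of_int (lev i)"
    proof (cases rule: index_cases)
      case 1
      then show ?thesis using open_alcove_bounds[OF z assms(2)[OF highest_root_pos]] by (simp add: weyl_inv_inner[OF assms(1)])
    next
      case (2 \<alpha>)
      then show ?thesis using open_alcove_bounds[OF z assms(2)[OF simple_pos]] by (simp add: weyl_inv_inner[OF assms(1)])
    qed
  qed
  then have "inv g = id" using faithful weyl_aff_weyl[OF iW] by auto
  then show ?thesis using weyl_inv_apply(3)[OF assms(1)] by simp
qed

section \<open>Chambers and dominant representatives\<close>

definition dominant :: "('a \<Rightarrow> 'a) \<Rightarrow> bool" where "dominant u \<longleftrightarrow> (\<forall>\<beta>\<in>Pos. u z \<bullet> \<beta> > 0)"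

lemma dominant_simple: "dominant u \<longleftrightarrow> (\<forall>\<alpha>\<in>\<Delta>. u z \<bullet> \<alpha> > 0)"
  using chamber_pos[of "u z"] simple_pos by (auto simp: dominant_def)

definition chm :: "('a \<Rightarrow> 'a) \<Rightarrow> 'a \<Rightarrow> 'a" where "chm u = (THE v. v \<in> W \<and> dominant (inv v \<circ> u))"

text \<open>Take \<open>v\<close> maximising \<open>u z \<bullet> v z\<close>: if a simple root had
  a negative pairing, composing with its reflection would increase this number.\<close>

lemma ex_chm: assumes u: "u \<in> AW" shows "\<exists>v\<in>W. dominant (inv v \<circ> u)"
proof -
  have ne: "W \<noteq> {}" using id_weyl by auto
  obtain v where v: "v \<in> W" and mx: "\<And>w. w \<in> W \<Longrightarrow> u z \<bullet> w z \<le> u z \<bullet> v z"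
    using arg_min_if_finite[OF finite_weyl ne, of "\<lambda>w. - (u z \<bullet> w z)"] by (metis neg_less_iff_less not_le)
  have "(inv v \<circ> u) z \<bullet> \<alpha> > 0" if a: "\<alpha> \<in> \<Delta>" for \<alpha>
  proof (rule ccontr)
    assume n: "\<not> ?thesis"
    have va: "v \<alpha> \<in> \<Phi>" using a simple_roots weyl_root[OF v] by auto
    have aa: "\<alpha> \<bullet> \<alpha> > 0" using a simple_roots root_nonzero by auto
    have "u z \<bullet> v \<alpha> \<le> 0" using n by (simp add: weyl_inv_inner[OF v])
    then have neg: "u z \<bullet> v \<alpha> < 0" using generic[OF u va, of 0] by simp
    have "u z \<bullet> (v \<circ> refl \<alpha>) z = u z \<bullet> v z - (2 * (z \<bullet> \<alpha>) / (\<alpha> \<bullet> \<alpha>)) * (u z \<bullet> v \<alpha>)"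
      by (simp add: refl_def weyl_diff[OF v] weyl_scale[OF v] inner_diff_right)
    moreover have "2 * (z \<bullet> \<alpha>) / (\<alpha> \<bullet> \<alpha>) * (u z \<bullet> v \<alpha>) < 0"
      using neg aa open_alcove_simple[OF z a] by (intro mult_pos_neg) auto
    moreover have "v \<circ> refl \<alpha> \<in> W" using v a simple_roots by (intro weyl_comp weyl_refl) auto
    ultimately show False using mx[of "v \<circ> refl \<alpha>"] by linarith
  qed
  then show ?thesis using v by (auto simp: dominant_simple)
qed

lemma chm_unique:
  assumes u: "u \<in> AW" and v: "v \<in> W" "dominant (inv v \<circ> u)" and w: "w \<in> W" "dominant (inv w \<circ> u)"
  shows "v = w"
proof -
  have pos: "\<gamma> \<in> Pos" if "\<gamma> \<in> \<Phi>" "u z \<bullet> x \<gamma> > 0" "x \<in> W" "dominant (inv x \<circ> u)" for \<gamma> x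
  proof (rule ccontr)
    assume "\<gamma> \<notin> Pos"
    then have "u z \<bullet> x (- \<gamma>) > 0" using that neg_pos_iff[OF that(1)] by (auto simp: dominant_def weyl_inv_inner)
    then show False using that by (simp add: weyl_neg)
  qed
  have "inv w \<circ> v = id"
  proof (rule weyl_pos_id)
    show W: "inv w \<circ> v \<in> W" using v w weyl_comp weyl_inv by auto
    fix \<beta> assume b: "\<beta> \<in> Pos"
    have "u z \<bullet> w ((inv w \<circ> v) \<beta>) > 0"
      using v b weyl_inv_apply[OF w(1)] by (auto simp: dominant_def weyl_inv_inner)
    then show "(inv w \<circ> v) \<beta> \<in> Pos" using pos[OF _ _ w] weyl_root[OF W pos_root[OF b]] by auto
  qed
  then have "w \<circ> (inv w \<circ> v) = w" by simp
  then show ?thesis using weyl_inv_apply(3)[OF w(1)] by (metis comp_assoc id_comp)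
qed

lemma chm: assumes "u \<in> AW" shows "chm u \<in> W" "dominant (inv (chm u) \<circ> u)"
proof -
  have "\<exists>!v. v \<in> W \<and> dominant (inv v \<circ> u)" using ex_chm[OF assms] chm_unique[OF assms] by blast
  from theI'[OF this] show "chm u \<in> W" "dominant (inv (chm u) \<circ> u)" by (auto simp: chm_def)
qed

lemma chm_eqI: "u \<in> AW \<Longrightarrow> v \<in> W \<Longrightarrow> dominant (inv v \<circ> u) \<Longrightarrow> chm u = v"
  using chm chm_unique by blast

text \<open>Folding onto the fundamental chamber: \<open>u\<close> is \<open>chm u o hat u\<close>,
  with one factor naming the chamber and the other the dominant alcove.\<close>

definition hat :: "('a \<Rightarrow> 'a) \<Rightarrow> 'a \<Rightarrow> 'a" where "hat u = inv (chm u) \<circ> u"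

lemma hat: assumes "u \<in> AW" shows "hat u \<in> AW" "dominant (hat u)" "chm u \<circ> hat u = u"
  using chm[OF assms] aff_weyl_comp[OF weyl_aff_weyl[OF weyl_inv(2)] assms] weyl_inv_apply(3)
  by (auto simp: hat_def simp flip: comp_assoc)

lemma chm_comp: assumes "v \<in> W" "h \<in> AW" "dominant h" shows "chm (v \<circ> h) = v" "hat (v \<circ> h) = h"
proof -
  have e: "inv v \<circ> (v \<circ> h) = h" using weyl_inv_apply(4)[OF assms(1)] by (simp flip: comp_assoc)
  show "chm (v \<circ> h) = v"
    using assms e chm_eqI[OF aff_weyl_comp[OF weyl_aff_weyl]] by metis
  then show "hat (v \<circ> h) = h" using e by (simp add: hat_def)
qed

text \<open>Translates the inclusion of sets in the theorem into \<open>chm\<close>; genericity of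
  the orbit turns the weak inequalities into strict ones.\<close>

lemma alcove_chamber:
  assumes "u \<in> AW" "w \<in> W" shows "alcove \<Phi> \<Delta> u \<subseteq> chamber \<Delta> w \<longleftrightarrow> chm u = w"
proof -
  have g: "inv w \<circ> u \<in> AW" using assms aff_weyl_comp weyl_aff_weyl weyl_inv by auto
  have "alcove \<Phi> \<Delta> u \<subseteq> chamber \<Delta> w \<longleftrightarrow> (\<forall>\<alpha>\<in>\<Delta>. alcove \<Phi> \<Delta> (inv w \<circ> u) \<subseteq> {\<gamma>. \<gamma> \<bullet> \<alpha> \<ge> of_int 0})"
  proof -
    have "y \<in> chamber \<Delta> w \<longleftrightarrow> inv w y \<in> fund_chamber \<Delta>" for y
      unfolding chamber_def using weyl_inv_apply[OF assms(2)] by (metis imageE imageI)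
    then show ?thesis by (auto simp: alcove_def fund_chamber_def)
  qed
  also have "\<dots> \<longleftrightarrow> (\<forall>\<alpha>\<in>\<Delta>. \<not> (inv w \<circ> u) z \<bullet> \<alpha> < of_int 0)"
    using alcove_above[OF g] simple_roots by blast
  also have "\<dots> \<longleftrightarrow> dominant (inv w \<circ> u)"
  proof -
    have "(inv w \<circ> u) z \<bullet> \<alpha> \<noteq> of_int 0" if "\<alpha> \<in> \<Delta>" for \<alpha> using generic[OF g, of \<alpha> 0] that simple_roots by auto
    then show ?thesis unfolding dominant_simple by force
  qed
  also have "\<dots> \<longleftrightarrow> chm u = w" using chm_eqI[OF assms] chm[OF assms(1)] by blast
  finally show ?thesis .
qed

lemma chm_dominant: "u \<in> AW \<Longrightarrow> chm u = id \<longleftrightarrow> dominant u"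
  using chm_eqI[OF _ id_weyl, of u] chm[of u] by auto

lemma chamber_id: "chamber \<Delta> id = fund_chamber \<Delta>"
  by (simp add: chamber_def)

lemma dom_weyl_iff: "u \<in> dom_weyl \<Phi> \<Delta> \<longleftrightarrow> u \<in> AW \<and> dominant u"
  using alcove_chamber[OF _ id_weyl] chm_dominant by (auto simp: dom_weyl_def chamber_id)

text \<open>In a positive direction the wall lies ahead of a dominant alcove, at level at least 1,
  whereas the fundamental chamber is bounded by hyperplanes of level 0.\<close>

lemma dominant_step:
  assumes h: "h \<in> AW" "dominant h" and i: "i \<in> I" and b: "wbar h (nrm i) \<in> Pos"
  shows "tr h (nrm i) (lev i) \<ge> 1" "dominant (h \<circ> s i)"
proof -
  have "of_int 0 < real_of_int (tr h (nrm i) (lev i))"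
    using cross_side(1)[OF h(1) i] h(2) b by (force simp: dominant_def)
  then show k: "tr h (nrm i) (lev i) \<ge> 1" by linarith
  have "(h \<circ> s i) z \<bullet> \<alpha> > 0" if "\<alpha> \<in> \<Delta>" for \<alpha>
  proof (rule ccontr)
    assume "\<not> ?thesis"
    moreover have "h z \<bullet> \<alpha> > 0" using h(2) simple_pos[OF that] by (auto simp: dominant_def)
    ultimately have "(h z \<bullet> (- \<alpha>) < of_int 0) \<noteq> (h (s i z) \<bullet> (- \<alpha>) < of_int 0)" by auto
    from crossing[OF z h(1) i _ this] that simple_roots neg_root k show False by auto
  qed
  then show "dominant (h \<circ> s i)" by (auto simp: dominant_simple)
qed

lemma root_bounds: "\<beta> \<in> \<Phi> \<Longrightarrow> -1 < z \<bullet> \<beta> \<and> z \<bullet> \<beta> < 1"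
  using open_alcove_bounds[OF z, of \<beta>] open_alcove_bounds[OF z, of "- \<beta>"] pos_or_neg[of \<beta>] by auto

lemma level_bounds:
  assumes "h \<in> AW" "i \<in> I" shows "of_int (tr h (nrm i) (lev i)) - 1 < h z \<bullet> wbar h (nrm i)"
  using inner_tr[OF assms(1) nrm_root[OF assms(2)], of z "lev i"] nrm_level[OF z assms(2)] by linarith

text \<open>The new dominant factor does not depend on \<open>chm u\<close>. In a positive direction
  the level is at least 1, out of reach of the pairing of \<open>z\<close> with any root, so the
  step is always an ascent. In a negative direction an ascent forces level 0, and the crossing is a
  reflection of the finite group, absorbed by the chamber factor.\<close>

lemma hat_dstep:
  assumes u: "u \<in> AW" and i: "i \<in> I"
  shows "hat (dstep u i) = (if wbar (hat u) (nrm i) \<in> Pos then hat u \<circ> s i else hat u)"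
proof -
  define v where "v = chm u" define h where "h = hat u"
  have v: "v \<in> W" and h: "h \<in> AW" "dominant h" and uvh: "u = v \<circ> h"
    using chm[OF u] hat[OF u] by (auto simp: v_def h_def)
  let ?b = "wbar h (nrm i)" and ?k = "tr h (nrm i) (lev i)"
  have b: "?b \<in> \<Phi>" using wbar_nrm_root[OF h(1) i] .
  have "inv u = inv h \<circ> inv v" unfolding uvh using o_inv_distrib weyl_inv(1)[OF v] aff_weyl_inv(1)[OF h(1)] by blast
  then have asc: "asc u i \<longleftrightarrow> z \<bullet> v ?b < of_int ?k"
    using below_tr'[OF h(1) nrm_root[OF i], of "inv v z" "lev i"] by (simp add: asc_def weyl_inv_inner[OF v])
  have vb: "-1 < z \<bullet> v ?b" "z \<bullet> v ?b < 1" using root_bounds[OF weyl_root[OF v b]] by auto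
  show ?thesis
  proof (cases "?b \<in> Pos")
    case True
    have "real_of_int 1 \<le> of_int ?k" using dominant_step(1)[OF h i True] by (simp only: of_int_le_iff)
    then have "asc u i" using asc vb by simp
    then have "dstep u i = v \<circ> (h \<circ> s i)" by (simp add: dstep_def uvh comp_assoc)
    then have "hat (dstep u i) = h \<circ> s i"
      using chm_comp(2)[OF v _ dominant_step(2)[OF h i True]] aff_weyl_comp[OF h(1) sref_aff_weyl[OF i]] by simp
    then show ?thesis using True by (simp add: h_def)
  next
    case False
    have "hat (dstep u i) = h"
    proof (cases "asc u i")
      case True
      have "real_of_int (-1) < of_int ?k" using True[unfolded asc] vb by simp
      then have "?k \<ge> 0" by linarith
      moreover have "h z \<bullet> ?b < 0" using h(2) False neg_pos_iff[OF b] by (force simp: dominant_def)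
      then have "real_of_int ?k < of_int 1" using level_bounds[OF h(1) i] by simp
      ultimately have "?k = 0" by linarith
      then have "h \<circ> s i = refl ?b \<circ> h"
        using aff_refl_conj[OF h(1) nrm_root[OF i], of "lev i"] by (simp add: sref_eq aff_refl_0)
      then have "dstep u i = (v \<circ> refl ?b) \<circ> h" using True by (simp add: dstep_def uvh comp_assoc)
      then show ?thesis using chm_comp(2)[OF weyl_comp[OF v weyl_refl[OF b]] h] by simp
    next
      case False
      then show ?thesis by (simp add: dstep_def h_def)
    qed
    then show ?thesis using False by (simp add: h_def)
  qed
qed

text \<open>The right-hand side involves \<open>h\<close> only through \<open>wbar h\<close>. This
  is why the dominant chain projects to a Markov chain on \<open>W\<close>.\<close>

lemma allowed_iff:
  assumes h: "h \<in> AW" "dominant h" and i: "i \<in> I"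
  shows "asc h i \<and> alcove \<Phi> \<Delta> (h \<circ> s i) \<subseteq> fund_chamber \<Delta> \<longleftrightarrow> wbar h (nrm i) \<in> Pos"
proof -
  let ?b = "wbar h (nrm i)" and ?k = "tr h (nrm i) (lev i)"
  have b: "?b \<in> \<Phi>" using wbar_nrm_root[OF h(1) i] .
  have hs: "h \<circ> s i \<in> AW" using aff_weyl_comp[OF h(1) sref_aff_weyl[OF i]] .
  have ch: "alcove \<Phi> \<Delta> (h \<circ> s i) \<subseteq> fund_chamber \<Delta> \<longleftrightarrow> dominant (h \<circ> s i)"
    using alcove_chamber[OF hs id_weyl] chm_dominant[OF hs] by (simp add: chamber_id)
  have asc: "asc h i \<longleftrightarrow> z \<bullet> ?b < of_int ?k" using asc_cross[OF h(1) i] .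
  show ?thesis
  proof (cases "?b \<in> Pos")
    case True
    have "real_of_int 1 \<le> of_int ?k" using dominant_step(1)[OF h i True] by (simp only: of_int_le_iff)
    then have "asc h i" using asc root_bounds[OF b] by simp
    then show ?thesis using True dominant_step(2)[OF h i True] ch by simp
  next
    case False
    have "\<not> (asc h i \<and> dominant (h \<circ> s i))"
    proof
      assume a: "asc h i \<and> dominant (h \<circ> s i)"
      then have "real_of_int (-1) < of_int ?k" using root_bounds[OF b] asc by simp
      then have "?k \<ge> 0" by linarith
      then have "real_of_int ?k \<ge> 0" by simp
      moreover have "h (s i z) \<bullet> ?b < 0" using a False neg_pos_iff[OF b] by (force simp: dominant_def)
      ultimately show False using cross_side(2)[OF h(1) i] by simp
    qed
    then show ?thesis using False ch by simp
  qed
qed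

section \<open>Inversions and the longest element\<close>

definition inversions :: "('a \<Rightarrow> 'a) \<Rightarrow> 'a set" where "inversions w = {\<gamma>\<in>Pos. w \<gamma> \<notin> Pos}"

lemma finite_inversions: "finite (inversions w)"
  using finite_roots pos_root by (auto intro: finite_subset[of _ \<Phi>] simp: inversions_def)

lemma simple_root: "\<alpha> \<in> \<Delta> \<Longrightarrow> \<alpha> \<in> \<Phi>"
  using simple_roots by auto

text \<open>The reflection permutes the positive roots other than \<alpha>, so the old inversions
  are carried along and \<alpha> is the only new one.\<close>

lemma card_inversions_refl:
  assumes w: "w \<in> W" and a: "\<alpha> \<in> \<Delta>" and p: "w \<alpha> \<in> Pos"
  shows "card (inversions (w \<circ> refl \<alpha>)) = Suc (card (inversions w))"
proof -
  have a0: "\<alpha> \<noteq> 0" using simple_root[OF a] root_nonzero by auto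
  have ra: "refl \<alpha> \<alpha> = - \<alpha>" using refl_self[OF a0] .
  have nw: "w (- \<alpha>) \<notin> Pos" using p not_pos_and_neg by (simp add: weyl_neg[OF w])
  have an: "\<alpha> \<notin> inversions w" using p by (simp add: inversions_def)
  have inj: "inj (refl \<alpha>)" using refl_refl[OF a0] by (metis injI)
  have "inversions (w \<circ> refl \<alpha>) = insert \<alpha> (refl \<alpha> ` inversions w)"
  proof (intro set_eqI iffI)
    fix \<gamma> assume g: "\<gamma> \<in> inversions (w \<circ> refl \<alpha>)"
    show "\<gamma> \<in> insert \<alpha> (refl \<alpha> ` inversions w)"
    proof (cases "\<gamma> = \<alpha>")
      case False
      then have "refl \<alpha> \<gamma> \<in> inversions w" using g refl_simple_pos[OF a, of \<gamma>] by (auto simp: inversions_def)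
      then show ?thesis using refl_refl[OF a0, of \<gamma>] by (metis image_eqI insertI2)
    qed auto
  next
    fix \<gamma> assume "\<gamma> \<in> insert \<alpha> (refl \<alpha> ` inversions w)"
    then show "\<gamma> \<in> inversions (w \<circ> refl \<alpha>)"
    proof
      assume "\<gamma> = \<alpha>" then show ?thesis using simple_pos[OF a] ra nw by (simp add: inversions_def)
    next
      assume "\<gamma> \<in> refl \<alpha> ` inversions w"
      then obtain \<delta> where d: "\<delta> \<in> inversions w" "\<gamma> = refl \<alpha> \<delta>" by auto
      then have "\<delta> \<noteq> \<alpha>" using an by auto
      then show ?thesis using d refl_simple_pos[OF a, of \<delta>] refl_refl[OF a0, of \<delta>] by (auto simp: inversions_def)
    qed
  qed
  moreover have "\<alpha> \<notin> refl \<alpha> ` inversions w"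
  proof
    assume "\<alpha> \<in> refl \<alpha> ` inversions w"
    then obtain \<delta> where d: "\<delta> \<in> inversions w" "\<alpha> = refl \<alpha> \<delta>" by auto
    then have "\<delta> = - \<alpha>" using refl_refl[OF a0, of \<delta>] ra by simp
    then show False using d not_pos_and_neg[OF simple_pos[OF a]] by (simp add: inversions_def)
  qed
  ultimately show ?thesis using finite_inversions inj by (simp add: card_image inj_on_subset[OF inj])
qed

lemma card_inversions_refl':
  assumes w: "w \<in> W" and a: "\<alpha> \<in> \<Delta>" and p: "w \<alpha> \<notin> Pos"
  shows "card (inversions w) = Suc (card (inversions (w \<circ> refl \<alpha>)))"
proof -
  have a0: "\<alpha> \<noteq> 0" using simple_root[OF a] root_nonzero by auto
  have "(w \<circ> refl \<alpha>) \<alpha> \<in> Pos"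
    using p neg_pos_iff[OF weyl_root[OF w simple_root[OF a]]] by (simp add: refl_self[OF a0] weyl_neg[OF w])
  moreover have "w \<circ> refl \<alpha> \<circ> refl \<alpha> = w" using refl_refl[OF a0] by (simp add: fun_eq_iff)
  ultimately show ?thesis
    using card_inversions_refl[OF weyl_comp[OF w weyl_refl[OF simple_root[OF a]]] a] by simp
qed

text \<open>The scalar serves both signs: with 1 positivity, with -1 negativity spreads from the
  base to all positive roots.\<close>

lemma weyl_all_pos:
  assumes w: "w \<in> W" and p: "\<And>\<alpha>. \<alpha> \<in> \<Delta> \<Longrightarrow> nonneg_comb \<Delta> (c *\<^sub>R w \<alpha>)" and b: "\<beta> \<in> Pos"
  shows "nonneg_comb \<Delta> (c *\<^sub>R w \<beta>)"
proof -
  have "w \<beta> = (\<Sum>\<alpha>\<in>\<Delta>. cf \<beta> \<alpha> *\<^sub>R w \<alpha>)"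
    by (subst sum_cf[of \<beta>, symmetric]) (simp add: linear_sum[OF weyl_linear[OF w]] weyl_scale[OF w])
  then have "cf (c *\<^sub>R w \<beta>) \<gamma> = (\<Sum>\<alpha>\<in>\<Delta>. cf \<beta> \<alpha> * cf (c *\<^sub>R w \<alpha>) \<gamma>)" for \<gamma>
    by (simp add: cf_sum sum_distrib_left mult.left_commute)
  then show ?thesis using p pos_cf[OF b] by (auto simp: nonneg_comb_iff intro!: sum_nonneg)
qed

lemma ex_word: "w \<in> W \<Longrightarrow> \<exists>xs. set xs \<subseteq> \<Delta> \<and> length xs = card (inversions w) \<and> word_map xs = w"
proof (induction "card (inversions w)" arbitrary: w)
  case 0
  then have "inversions w = {}" using finite_inversions by simp
  then have "w = id" using weyl_pos_id[OF 0(2)] by (auto simp: inversions_def)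
  then show ?case using 0 by (intro exI[of _ "[]"]) auto
next
  case (Suc n)
  have "\<exists>\<alpha>\<in>\<Delta>. w \<alpha> \<notin> Pos"
  proof (rule ccontr)
    assume "\<not> ?thesis"
    then have "nonneg_comb \<Delta> (1 *\<^sub>R w \<beta>)" if "\<beta> \<in> Pos" for \<beta>
      using weyl_all_pos[OF Suc(3) _ that, of 1] by (auto simp: pos_roots_def)
    then have "inversions w = {}" using weyl_root[OF Suc(3) pos_root] by (auto simp: inversions_def pos_roots_def)
    then show False using Suc(2) by simp
  qed
  then obtain \<alpha> where a: "\<alpha> \<in> \<Delta>" "w \<alpha> \<notin> Pos" by auto
  have W: "w \<circ> refl \<alpha> \<in> W" using weyl_comp[OF Suc(3) weyl_refl[OF simple_root[OF a(1)]]] .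
  have "n = card (inversions (w \<circ> refl \<alpha>))" using card_inversions_refl'[OF Suc(3) a] Suc(2) by simp
  from Suc(1)[OF this W] this obtain xs where xs: "set xs \<subseteq> \<Delta>" "length xs = n" "word_map xs = w \<circ> refl \<alpha>" by auto
  have "word_map (\<alpha> # xs) = w"
    using refl_refl[OF root_nonzero[OF simple_root[OF a(1)]]] xs by (simp add: gmult_def aff_refl_0 fun_eq_iff)
  then show ?case using xs a Suc(2) by (intro exI[of _ "\<alpha> # xs"]) auto
qed

lemma word_bound: "set xs \<subseteq> \<Delta> \<Longrightarrow> word_map xs \<in> W \<and> card (inversions (word_map xs)) \<le> length xs"
proof (induction xs)
  case Nil
  have "inversions id = {}" by (simp add: inversions_def)
  then show ?case using id_weyl by (metis card.empty le_refl list.size(3) word_map.simps(1))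
next
  case (Cons \<alpha> xs)
  then have a: "\<alpha> \<in> \<Delta>" and IH: "word_map xs \<in> W" "card (inversions (word_map xs)) \<le> length xs" by auto
  have e: "word_map (\<alpha> # xs) = word_map xs \<circ> refl \<alpha>" by (simp add: gmult_def aff_refl_0)
  have "card (inversions (word_map xs \<circ> refl \<alpha>)) \<le> Suc (card (inversions (word_map xs)))"
    using card_inversions_refl[OF IH(1) a] card_inversions_refl'[OF IH(1) a] by (cases "word_map xs \<alpha> \<in> Pos") auto
  then have "card (inversions (word_map xs \<circ> refl \<alpha>)) \<le> length (\<alpha> # xs)" using IH(2) by simp
  then show ?case using e weyl_comp[OF IH(1) weyl_refl[OF simple_root[OF a]]] by metis
qed

text \<open>The longest element is defined by word length, whereas signs of roots are wanted;
  counting inversions connects the two.\<close>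

lemma weyl_length_eq: assumes "w \<in> W" shows "weyl_length \<Delta> w = card (inversions w)"
  unfolding weyl_length_def using ex_word[OF assms] word_bound by (intro Least_equality) metis+

lemma neg_weyl_pos_id:
  assumes "v \<in> W" "w \<in> W" "\<And>\<beta>. \<beta> \<in> Pos \<Longrightarrow> v \<beta> \<notin> Pos" "\<And>\<beta>. \<beta> \<in> Pos \<Longrightarrow> w \<beta> \<notin> Pos" shows "v = w"
proof -
  have "inv w \<circ> v = id"
  proof (rule weyl_pos_id)
    show W: "inv w \<circ> v \<in> W" using assms weyl_comp weyl_inv by auto
    fix \<beta> assume b: "\<beta> \<in> Pos"
    show "(inv w \<circ> v) \<beta> \<in> Pos"
    proof (rule ccontr)
      let ?g = "inv w (v \<beta>)"
      assume "(inv w \<circ> v) \<beta> \<notin> Pos"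
      moreover have "?g \<in> \<Phi>" using weyl_root[OF W pos_root[OF b]] by simp
      ultimately have "- ?g \<in> Pos" using neg_pos_iff by auto
      then have "w (- ?g) \<notin> Pos" using assms(4) by blast
      then have "- v \<beta> \<notin> Pos" using weyl_inv_apply[OF assms(2)] by (simp add: weyl_neg[OF assms(2)])
      then show False using assms(3)[OF b] neg_pos_iff[OF weyl_root[OF assms(1) pos_root[OF b]]] by auto
    qed
  qed
  then have "w \<circ> (inv w \<circ> v) = w" by simp
  then show ?thesis using weyl_inv_apply(3)[OF assms(2)] by (metis comp_assoc id_comp)
qed

text \<open>An element with the most inversions makes every simple root negative, since otherwise
  one more reflection would add an inversion. Having all positive roots as inversions then
  determines it.\<close>

lemma longest: "longest \<Phi> \<Delta> \<in> W" "\<beta> \<in> Pos \<Longrightarrow> longest \<Phi> \<Delta> \<beta> \<notin> Pos"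
proof -
  have ne: "W \<noteq> {}" using id_weyl by auto
  obtain w where w: "w \<in> W" and mx: "\<And>v. v \<in> W \<Longrightarrow> card (inversions v) \<le> card (inversions w)"
    using arg_min_if_finite[OF finite_weyl ne, of "\<lambda>w. - int (card (inversions w))"]
    by (metis neg_less_iff_less not_le of_nat_less_iff)
  have np: "w \<alpha> \<notin> Pos" if "\<alpha> \<in> \<Delta>" for \<alpha>
    using card_inversions_refl[OF w that] mx[OF weyl_comp[OF w weyl_refl[OF simple_root[OF that]]]] by auto
  have wneg: "w \<beta> \<notin> Pos" if "\<beta> \<in> Pos" for \<beta>
  proof -
    have "nonneg_comb \<Delta> ((-1) *\<^sub>R w \<beta>)"
      using np neg_pos_iff[OF weyl_root[OF w simple_root]]
      by (intro weyl_all_pos[OF w _ that]) (auto simp: pos_roots_def)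
    then show ?thesis using neg_pos_iff[OF weyl_root[OF w pos_root[OF that]]] neg_root[OF weyl_root[OF w pos_root[OF that]]]
      by (auto simp: pos_roots_def)
  qed
  have "longest \<Phi> \<Delta> = w" unfolding longest_def
  proof (rule the_equality)
    show "w \<in> W \<and> (\<forall>v\<in>W. weyl_length \<Delta> v \<le> weyl_length \<Delta> w)" using w mx by (simp add: weyl_length_eq)
    fix v assume v: "v \<in> W \<and> (\<forall>x\<in>W. weyl_length \<Delta> x \<le> weyl_length \<Delta> v)"
    then have "card (inversions w) \<le> card (inversions v)" using w weyl_length_eq by metis
    moreover have "inversions w = Pos" using wneg by (auto simp: inversions_def)
    moreover have "inversions v \<subseteq> Pos" "finite Pos"
      using finite_roots pos_root by (auto simp: inversions_def intro: finite_subset)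
    ultimately have "inversions v = Pos" by (metis card_seteq)
    then have "\<And>\<beta>. \<beta> \<in> Pos \<Longrightarrow> v \<beta> \<notin> Pos" by (auto simp: inversions_def)
    then show "v = w" using neg_weyl_pos_id[of v w] v w wneg by auto
  qed
  then show "longest \<Phi> \<Delta> \<in> W" "\<beta> \<in> Pos \<Longrightarrow> longest \<Phi> \<Delta> \<beta> \<notin> Pos" using w wneg by auto
qed

text \<open>With \<open>u = v o h\<close>, the point \<open>inv u z\<close> is the image of
  \<open>inv v z - h 0\<close> under the inverse of the linear part of \<open>h\<close>. Once
  \<open>h 0\<close> pairs positively with all positive roots, the bounded vector
  \<open>inv v z\<close> cannot matter and the difference is antidominant, which accounts for the
  longest element.\<close>

lemma chm_inv:
  assumes u: "u \<in> AW" and reg: "\<And>\<beta>. \<beta> \<in> Pos \<Longrightarrow> hat u z \<bullet> \<beta> > 1"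
  shows "chm (inv u) = inv (wbar (hat u)) \<circ> longest \<Phi> \<Delta>"
proof -
  define v where "v = chm u" define h where "h = hat u"
  have v: "v \<in> W" and h: "h \<in> AW" "dominant h" and uvh: "u = v \<circ> h"
    using chm[OF u] hat[OF u] by (auto simp: v_def h_def)
  let ?w = "longest \<Phi> \<Delta>" let ?L = "wbar h"
  have L: "?L \<in> W" using wbar_weyl[OF h(1)] .
  have iL: "inv ?L \<in> W" using weyl_inv(2)[OF L] .
  have x: "inv ?L \<circ> ?w \<in> W" using weyl_comp[OF iL longest(1)] .
  have inh: "inv h y = inv ?L (y - h 0)" for y
  proof -
    have "inv ?L y + inv h 0 = inv h y" "inv ?L (h 0) + inv h 0 = 0"
      using wbar_plus[of "inv h"] aff_weyl_inv_apply(2)[OF h(1)] by (auto simp: wbar_inv[OF h(1)])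
    then show ?thesis by (simp add: weyl_diff[OF iL] add_eq_0_iff)
  qed
  have iu: "inv u = inv h \<circ> inv v" unfolding uvh using o_inv_distrib weyl_inv(1)[OF v] aff_weyl_inv(1)[OF h(1)] by blast
  have "(inv (inv ?L \<circ> ?w) \<circ> inv u) z \<bullet> \<beta> > 0" if b: "\<beta> \<in> Pos" for \<beta>
  proof -
    have r: "?w \<beta> \<in> \<Phi>" using weyl_root[OF longest(1) pos_root[OF b]] .
    have d: "- ?w \<beta> \<in> Pos" using longest(2)[OF b] neg_pos_iff[OF r] by auto
    have "(inv (inv ?L \<circ> ?w) \<circ> inv u) z \<bullet> \<beta> = inv u z \<bullet> inv ?L (?w \<beta>)"
      using weyl_inv_inner[OF x] by simp
    also have "\<dots> = (inv v z - h 0) \<bullet> ?w \<beta>"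
      using weyl_inner[OF iL] by (simp add: iu inh)
    also have "\<dots> = z \<bullet> v (?w \<beta>) + h 0 \<bullet> (- ?w \<beta>)" by (simp add: inner_diff_left weyl_inv_inner[OF v])
    finally have eq: "(inv (inv ?L \<circ> ?w) \<circ> inv u) z \<bullet> \<beta> = z \<bullet> v (?w \<beta>) + h 0 \<bullet> (- ?w \<beta>)" .
    have "h z \<bullet> (- ?w \<beta>) > 1" using reg[OF d] by (simp add: h_def)
    moreover have "?L z \<bullet> (- ?w \<beta>) = z \<bullet> inv ?L (- ?w \<beta>)"
      using weyl_inv_inner[OF iL] inv_inv_eq[OF weyl_inv(1)[OF L]] by metis
    moreover have "z \<bullet> inv ?L (- ?w \<beta>) < 1" using root_bounds[OF weyl_root[OF iL pos_root[OF d]]] by auto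
    \<comment> \<open>Exceeding 1 is more than the linear image of \<open>z\<close> can account for.
      Integrality then raises positive to at least 1, which outweighs the remaining pairing of
      \<open>z\<close>, itself larger than -1.\<close>
    ultimately have "h 0 \<bullet> (- ?w \<beta>) > 0"
      using inner_add_left[of "?L z" "h 0" "- ?w \<beta>"] unfolding wbar_plus by linarith
    moreover obtain n :: int where n: "h 0 \<bullet> (- ?w \<beta>) = of_int n" using aff_weyl_int[OF h(1) pos_root[OF d]] by (rule Ints_cases)
    ultimately have "h 0 \<bullet> (- ?w \<beta>) \<ge> 1" unfolding n by simp
    then show ?thesis unfolding eq using root_bounds[OF weyl_root[OF v r]] by linarith
  qed
  then have "dominant (inv (inv ?L \<circ> ?w) \<circ> inv u)" by (simp add: dominant_def)
  then show ?thesis using chm_eqI[OF aff_weyl_inv(2)[OF u] x] by (simp add: h_def)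
qed

end

section \<open>Rays\<close>

lemma affine_zero_between:
  fixes p q a b :: real
  assumes "p + a * q < 0" "p + b * q \<ge> 0"
  obtains r where "min a b \<le> r" "r \<le> max a b" "p + r * q = 0" "r \<noteq> a"
proof -
  have q: "q \<noteq> 0" using assms by auto
  define r where "r = - p / q"
  have z: "p + r * q = 0" using q by (simp add: r_def)
  have "min a b \<le> r \<and> r \<le> max a b"
  proof (cases "q > 0")
    case True
    then have "a \<le> r" "r \<le> b" using assms by (auto simp: r_def field_simps)
    then show ?thesis by auto
  next
    case False
    then have "q < 0" using q by simp
    then have "b \<le> r" "r \<le> a" using assms by (auto simp: r_def field_simps)
    then show ?thesis by auto
  qed
  moreover have "r \<noteq> a" using z assms by auto
  ultimately show ?thesis using that z by auto
qed

lemma affine_nonpos_closed: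
  fixes p q a b :: real
  assumes "\<And>r. a < r \<Longrightarrow> r < b \<Longrightarrow> p + r * q < 0" "a < b" "a \<le> c" "c \<le> b"
  shows "p + c * q \<le> 0"
proof (rule ccontr)
  assume n: "\<not> ?thesis"
  let ?m = "(a + b) / 2"
  define e where "e = p + c * q"
  have e: "e > 0" using n by (simp add: e_def)
  have m: "p + ?m * q < 0" by (rule assms(1)) (use assms(2) in auto)
  obtain r where r: "min ?m c \<le> r" "r \<le> max ?m c" "p + r * q = 0" "r \<noteq> ?m"
    using affine_zero_between[OF m, of c] e by (auto simp: e_def)
  have "r \<noteq> c" using r e by (auto simp: e_def)
  then have "a < r" "r < b" using r assms by (auto simp: min_def max_def split: if_splits)
  then show False using assms(1)[of r] r by auto
qed

context alcove_point
begin

section \<open>Translations by the coroot lattice; equality of hyperplanes and of alcoves\<close>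

lemma translation_closed:
  "(\<lambda>x. x + a) \<in> AW \<Longrightarrow> (\<lambda>x. x + b) \<in> AW \<Longrightarrow> (\<lambda>x. x + (a + b)) \<in> AW"
  "(\<lambda>x. x + a) \<in> AW \<Longrightarrow> (\<lambda>x. x + (- a)) \<in> AW"
proof -
  assume a: "(\<lambda>x. x + a) \<in> AW"
  { assume b: "(\<lambda>x. x + b) \<in> AW"
    have "(\<lambda>x. x + (a + b)) = (\<lambda>x. x + b) \<circ> (\<lambda>x. x + a)" by (auto simp: fun_eq_iff)
    then show "(\<lambda>x. x + (a + b)) \<in> AW" using aff_weyl_comp[OF b a] by simp }
  have "inv (\<lambda>x. x + a) = (\<lambda>x. x + (- a))" by (rule inv_unique_comp) (auto simp: fun_eq_iff)
  then show "(\<lambda>x. x + (- a)) \<in> AW" using aff_weyl_inv(2)[OF a] by simp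
qed

text \<open>Reflections in parallel hyperplanes at consecutive levels compose to the translation by
  the coroot.\<close>

lemma coroot_translation: assumes "\<beta> \<in> \<Phi>" shows "(\<lambda>x. x + coroot \<beta>) \<in> AW"
proof -
  have "coroot \<beta> \<bullet> \<beta> = 2" using root_nonzero[OF assms] by (simp add: coroot_def)
  then have "(\<lambda>x. x + coroot \<beta>) = aff_refl \<beta> 1 \<circ> aff_refl \<beta> 0"
    by (simp add: fun_eq_iff aff_refl_def inner_diff_left algebra_simps flip: scaleR_add_left)
  then show ?thesis using aff_weyl_comp[OF aff_weyl_refl aff_weyl_refl] assms by simp
qed

lemma int_translation: assumes "(\<lambda>x. x + a) \<in> AW" shows "(\<lambda>x. x + of_int k *\<^sub>R a) \<in> AW"
proof -
  have n: "(\<lambda>x. x + of_nat n *\<^sub>R a) \<in> AW" for n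
  proof (induction n)
    case 0 show ?case using id_aff_weyl by (simp add: id_def)
  next
    case (Suc n) then show ?case using translation_closed(1)[OF assms, of "of_nat n *\<^sub>R a"] by (simp add: algebra_simps)
  qed
  show ?thesis
  proof (cases "k \<ge> 0")
    case True then show ?thesis using n[of "nat k"] by simp
  next
    case False then show ?thesis using translation_closed(2)[OF n[of "nat (- k)"]] by simp
  qed
qed

lemma lattice_translation: assumes "\<xi> \<in> coroot_lattice \<Phi>" shows "(\<lambda>x. x + \<xi>) \<in> AW"
proof -
  obtain c where c: "\<xi> = (\<Sum>\<alpha>\<in>\<Phi>. of_int (c \<alpha>) *\<^sub>R coroot \<alpha>)" using assms by (auto simp: coroot_lattice_def)
  have "(\<lambda>x. x + (\<Sum>\<alpha>\<in>S. of_int (c \<alpha>) *\<^sub>R coroot \<alpha>)) \<in> AW" if "finite S" "S \<subseteq> \<Phi>" for S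
    using that
  proof (induction S)
    case empty show ?case using id_aff_weyl by (simp add: id_def)
  next
    case (insert \<alpha> S)
    then show ?case using translation_closed(1)[OF int_translation[OF coroot_translation[of \<alpha>], of "c \<alpha>"]] by simp
  qed
  then show ?thesis using c finite_roots by auto
qed

lemma lattice_int: assumes "\<xi> \<in> coroot_lattice \<Phi>" "\<beta> \<in> \<Phi>" shows "\<xi> \<bullet> \<beta> \<in> \<int>"
  using aff_weyl_int[OF lattice_translation[OF assms(1)] assms(2)] by simp

lemma lattice_neg: assumes "\<xi> \<in> coroot_lattice \<Phi>" shows "- \<xi> \<in> coroot_lattice \<Phi>"
proof -
  obtain c where c: "\<xi> = (\<Sum>\<alpha>\<in>\<Phi>. of_int (c \<alpha>) *\<^sub>R coroot \<alpha>)" using assms by (auto simp: coroot_lattice_def)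
  then have "- \<xi> = (\<Sum>\<alpha>\<in>\<Phi>. of_int (- c \<alpha>) *\<^sub>R coroot \<alpha>)" by (simp add: sum_negf)
  then show ?thesis by (auto simp: coroot_lattice_def intro!: exI[of _ "\<lambda>\<alpha>. - c \<alpha>"])
qed

text \<open>Two test points suffice: \<open>y\<close>, the foot of the perpendicular from 0, and
  \<open>y + w\<close>, where \<open>w\<close> is the component of \<gamma> orthogonal to \<beta>.
  Equality of the hyperplanes kills \<open>w\<close>, so the roots are proportional.\<close>

lemma hyp_eq_imp:
  assumes "\<beta> \<in> \<Phi>" "\<gamma> \<in> \<Phi>" "hyp \<beta> k = hyp \<gamma> l" shows "(\<gamma> = \<beta> \<and> l = k) \<or> (\<gamma> = - \<beta> \<and> l = - k)"
proof -
  have bb: "\<beta> \<bullet> \<beta> \<noteq> 0" using root_nonzero[OF assms(1)] by simp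
  define y where "y = (of_int k / (\<beta> \<bullet> \<beta>)) *\<^sub>R \<beta>"
  define w where "w = \<gamma> - ((\<gamma> \<bullet> \<beta>) / (\<beta> \<bullet> \<beta>)) *\<^sub>R \<beta>"
  have yb: "y \<bullet> \<beta> = of_int k" using bb by (simp add: y_def)
  have wb: "w \<bullet> \<beta> = 0" using bb by (simp add: w_def inner_diff_left)
  have "y \<in> hyp \<beta> k" "y + w \<in> hyp \<beta> k" using yb wb by (auto simp: hyp_def inner_add_left)
  then have "y \<in> hyp \<gamma> l" "y + w \<in> hyp \<gamma> l" using assms(3) by auto
  then have yg: "y \<bullet> \<gamma> = of_int l" and "w \<bullet> \<gamma> = 0" by (auto simp: hyp_def inner_add_left)
  then have "w \<bullet> w = 0" using wb by (simp add: w_def[of ] inner_diff_right inner_commute)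
  then have g: "\<gamma> = ((\<gamma> \<bullet> \<beta>) / (\<beta> \<bullet> \<beta>)) *\<^sub>R \<beta>" by (simp add: w_def)
  then have "(\<gamma> \<bullet> \<beta>) / (\<beta> \<bullet> \<beta>) = 1 \<or> (\<gamma> \<bullet> \<beta>) / (\<beta> \<bullet> \<beta>) = -1" using root_scale assms by metis
  then have "\<gamma> = \<beta> \<or> \<gamma> = - \<beta>" using g by (metis scaleR_minus1_left scaleR_one)
  then show ?thesis using yg yb by auto
qed

lemma index_inj:
  assumes "i \<in> I" "j \<in> I" "(nrm j = nrm i \<and> lev j = lev i) \<or> (nrm j = - nrm i \<and> lev j = - lev i)" shows "i = j"
  using assms(1)
proof (cases rule: index_cases)
  case 1
  from assms(2) show ?thesis by (cases rule: index_cases) (use 1 assms in auto)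
next
  case (2 \<alpha>)
  from assms(2) show ?thesis
  proof (cases rule: index_cases)
    case (2 \<gamma>)
    then show ?thesis using \<open>\<alpha> \<in> \<Delta>\<close> \<open>i = Some \<alpha>\<close> assms(3) not_pos_and_neg simple_pos by auto
  qed (use 2 assms in auto)
qed

lemma sref_inj: assumes "i \<in> I" "j \<in> I" "s i = s j" shows "i = j"
proof -
  have "(z \<bullet> nrm i < of_int (lev i)) \<noteq> (s j z \<bullet> nrm i < of_int (lev i))"
    using nrm_level[OF z assms(1)] sref_nrm[OF assms(1), of z] assms(3) by auto
  from only_wall_separates[OF z assms(2) nrm_root[OF assms(1)] this] index_inj[OF assms(2,1)] show ?thesis by auto
qed

lemma comp_left_cancel: "u \<in> AW \<Longrightarrow> u \<circ> f = u \<circ> g \<Longrightarrow> f = g"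
  using aff_weyl_inv_apply(4)[of u] by (metis comp_assoc id_comp)

text \<open>Freeness is applied at \<open>y\<close> instead of \<open>z\<close>, since the points
  met along a ray need not lie in the orbit of \<open>z\<close>.\<close>

lemma open_alcove_transfer:
  assumes "y \<in> open_alcove" "u \<in> AW" "v \<in> AW" "u y = v y'" "y' \<in> open_alcove" shows "u = v"
proof -
  interpret y: alcove_point \<Phi> \<Delta> y by unfold_locales (rule assms(1))
  have "inv v \<circ> u = id"
    using assms aff_weyl_comp[OF aff_weyl_inv(2)] aff_weyl_inv_apply(2)[OF assms(3)] by (intro y.faithful) auto
  then have "v \<circ> (inv v \<circ> u) = v" by simp
  then show ?thesis using aff_weyl_inv_apply(3)[OF assms(3)] by (metis comp_assoc id_comp)
qed

lemma fund_alcove_iff: "y \<in> A \<longleftrightarrow> (\<forall>i\<in>I. y \<bullet> nrm i \<le> of_int (lev i))"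
  by (auto simp: fund_alcove_def fund_chamber_def aff_index_def)

lemma alcove_inj: assumes "u \<in> AW" "v \<in> AW" "alcove \<Phi> \<Delta> u = alcove \<Phi> \<Delta> v" shows "u = v"
proof -
  have g: "inv v \<circ> u \<in> AW" using assms aff_weyl_comp aff_weyl_inv by auto
  have "u z \<in> v ` A" using assms(3) zA by (auto simp: alcove_def)
  then have "inv v (u z) \<in> A" using aff_weyl_inv_apply(2)[OF assms(2)] by auto
  then have "inv v (u z) \<in> open_alcove"
    using generic[OF g nrm_root] by (fastforce simp: fund_alcove_iff open_alcove_def order_le_less)
  then show ?thesis
    using open_alcove_transfer[OF z assms(1,2), of "inv v (u z)"] aff_weyl_inv_apply(1)[OF assms(2)] by simp
qed

lemma sref_ne_id: "i \<in> I \<Longrightarrow> u \<in> AW \<Longrightarrow> u \<circ> s i \<noteq> u"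
  using comp_left_cancel[of u "s i" id] nrm_level[OF z, of i] sref_nrm[of i z] by auto

end

section \<open>Crossing times of the ray\<close>

locale ray = alcove_point +
  fixes \<eta> :: 'a
  assumes Upsilon: "\<eta> \<in> Upsilon \<Phi> \<Delta> z"
begin

abbreviation pt :: "real \<Rightarrow> 'a" where "pt r \<equiv> z + r *\<^sub>R \<eta>"

lemma eta_lattice: "\<eta> \<in> coroot_lattice \<Phi>" and eta_nonzero: "\<eta> \<noteq> 0"
  using Upsilon by (auto simp: Upsilon_def)

lemma eta_int: "\<beta> \<in> \<Phi> \<Longrightarrow> \<eta> \<bullet> \<beta> \<in> \<int>"
  using lattice_int[OF eta_lattice] .

lemma hyps_pos: "\<beta> \<in> \<Phi> \<Longrightarrow> hyp \<beta> k \<in> hyps \<Phi> \<Delta>"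
proof -
  assume b: "\<beta> \<in> \<Phi>"
  have "hyp \<beta> k = hyp (- \<beta>) (- k)" by (auto simp: hyp_def)
  then show ?thesis using pos_or_neg[OF b] by (auto simp: hyps_def)
qed

lemma crossing_unique:
  assumes "r \<ge> 0" "\<beta> \<in> \<Phi>" "\<gamma> \<in> \<Phi>" "pt r \<bullet> \<beta> = of_int k" "pt r \<bullet> \<gamma> = of_int l"
  shows "(\<gamma> = \<beta> \<and> l = k) \<or> (\<gamma> = - \<beta> \<and> l = - k)"
proof (rule hyp_eq_imp[OF assms(2,3)])
  have "pt r \<in> hyp \<beta> k" "pt r \<in> hyp \<gamma> l" using assms by (auto simp: hyp_def)
  then show "hyp \<beta> k = hyp \<gamma> l"
    using Upsilon assms(1) hyps_pos[OF assms(2), of k] hyps_pos[OF assms(3), of l] unfolding Upsilon_def by blast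
qed

text \<open>Crossing times of the whole line, negative times included, so that both rays share one
  periodic set.\<close>

definition T :: "real set" where "T = {r. \<exists>\<beta>\<in>\<Phi>. \<exists>k::int. pt r \<bullet> \<beta> = of_int k}"

lemma pt_inner: "pt r \<bullet> \<beta> = z \<bullet> \<beta> + r * (\<eta> \<bullet> \<beta>)"
  by (simp add: inner_add_left)

text \<open>Roots pair integrally with \<eta>, so a whole unit of time changes every pairing by an
  integer.\<close>

lemma T_shift: "r + of_int n \<in> T \<longleftrightarrow> r \<in> T"
proof -
  have *: "r + of_int n \<in> T" if rT: "r \<in> T" for r n
  proof -
    obtain \<beta> k where b: "\<beta> \<in> \<Phi>" "pt r \<bullet> \<beta> = of_int k" using rT unfolding T_def by blast
    obtain m where m: "\<eta> \<bullet> \<beta> = of_int m" using eta_int[OF b(1)] by (auto elim: Ints_cases)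
    have "pt (r + of_int n) \<bullet> \<beta> = of_int (k + n * m)" using b(2) unfolding pt_inner m by (simp add: algebra_simps)
    then show ?thesis using b(1) unfolding T_def by blast
  qed
  show ?thesis using *[of r n] *[of "r + of_int n" "- n"] by auto
qed

lemma zero_T: "0 \<notin> T"
  using generic_z by (auto simp: T_def)

lemma int_T: "of_int n \<notin> T"
  using T_shift[of 0 n] zero_T by simp

lemma T_slope: "\<beta> \<in> \<Phi> \<Longrightarrow> pt r \<bullet> \<beta> = of_int k \<Longrightarrow> \<eta> \<bullet> \<beta> \<noteq> 0"
  using generic_z[of \<beta> k] by (auto simp: pt_inner)

lemma T_finite: "finite (T \<inter> {- B..B})"
proof (rule finite_subset)
  let ?S = "Sigma \<Phi> (\<lambda>\<beta>. {\<lfloor>z \<bullet> \<beta> - \<bar>\<eta> \<bullet> \<beta>\<bar> * B\<rfloor>..\<lceil>z \<bullet> \<beta> + \<bar>\<eta> \<bullet> \<beta>\<bar> * B\<rceil>})"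
  show "T \<inter> {- B..B} \<subseteq> (\<lambda>(\<beta>, k::int). (of_int k - z \<bullet> \<beta>) / (\<eta> \<bullet> \<beta>)) ` ?S"
  proof
    fix r assume r: "r \<in> T \<inter> {- B..B}"
    then obtain \<beta> k where b: "\<beta> \<in> \<Phi>" "pt r \<bullet> \<beta> = of_int k" by (auto simp: T_def)
    have ne: "\<eta> \<bullet> \<beta> \<noteq> 0" using T_slope[OF b] .
    have "\<bar>r * (\<eta> \<bullet> \<beta>)\<bar> \<le> B * \<bar>\<eta> \<bullet> \<beta>\<bar>" using r by (auto simp: abs_mult intro!: mult_right_mono)
    then have "\<bar>of_int k - z \<bullet> \<beta>\<bar> \<le> \<bar>\<eta> \<bullet> \<beta>\<bar> * B" using b(2) unfolding pt_inner by (simp add: mult.commute)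
    then have "k \<in> {\<lfloor>z \<bullet> \<beta> - \<bar>\<eta> \<bullet> \<beta>\<bar> * B\<rfloor>..\<lceil>z \<bullet> \<beta> + \<bar>\<eta> \<bullet> \<beta>\<bar> * B\<rceil>}"
      by (auto simp: abs_le_iff floor_le_iff le_ceiling_iff)
    moreover have "r = (of_int k - z \<bullet> \<beta>) / (\<eta> \<bullet> \<beta>)" using b(2) ne unfolding pt_inner by (simp add: field_simps)
    ultimately show "r \<in> (\<lambda>(\<beta>, k::int). (of_int k - z \<bullet> \<beta>) / (\<eta> \<bullet> \<beta>)) ` ?S"
      using b(1) by (intro image_eqI[of _ _ "(\<beta>, k)"]) auto
  qed
  show "finite ((\<lambda>(\<beta>, k::int). (of_int k - z \<bullet> \<beta>) / (\<eta> \<bullet> \<beta>)) ` ?S)"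
    by (intro finite_imageI finite_SigmaI finite_roots) auto
qed

lemma ex_slope: "\<exists>\<beta>\<in>\<Phi>. \<eta> \<bullet> \<beta> \<noteq> 0"
proof (rule ccontr)
  assume "\<not> ?thesis"
  then have "\<Phi> \<subseteq> {y. \<eta> \<bullet> y = 0}" by auto
  then have "span \<Phi> \<subseteq> {y. \<eta> \<bullet> y = 0}"
    by (intro span_minimal) (auto simp: subspace_def inner_add_right)
  then have "\<eta> \<in> {y. \<eta> \<bullet> y = 0}" using span_roots by blast
  then have "\<eta> \<bullet> \<eta> = 0" by blast
  then show False using eta_nonzero by simp
qed

lemma T_above: "\<exists>r\<in>T. r > a"
proof -
  obtain \<beta> where b: "\<beta> \<in> \<Phi>" "\<eta> \<bullet> \<beta> \<noteq> 0" using ex_slope by auto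
  define r where "r = - (z \<bullet> \<beta>) / (\<eta> \<bullet> \<beta>)"
  have "pt r \<bullet> \<beta> = of_int 0" unfolding pt_inner r_def using b(2) by simp
  then have "r \<in> T" using b unfolding T_def by blast
  then have "r + of_int (\<lceil>a - r\<rceil> + 1) \<in> T" using T_shift by blast
  moreover have "r + of_int (\<lceil>a - r\<rceil> + 1) > a" by linarith
  ultimately show ?thesis by blast
qed

text \<open>Kept as a relation so that next crossings can be identified by uniqueness, both for the
  shifted ray and for an arbitrary ray sequence.\<close>

definition nxtP :: "real \<Rightarrow> real \<Rightarrow> bool" where "nxtP a t \<longleftrightarrow> t \<in> T \<and> a < t \<and> (\<forall>r\<in>T. r \<le> a \<or> t \<le> r)"

lemma nxtP_unique: "nxtP a t \<Longrightarrow> nxtP a t' \<Longrightarrow> t = t'"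
  by (force simp: nxtP_def)

lemma ex_nxtP: "\<exists>t. nxtP a t"
proof -
  obtain r where r: "r \<in> T" "r > a" using T_above by auto
  let ?F = "T \<inter> {a<..r}"
  have fin: "finite ?F" by (rule finite_subset[OF _ T_finite[of "max \<bar>a\<bar> \<bar>r\<bar>"]]) auto
  have ne: "?F \<noteq> {}" using r by auto
  have M: "Min ?F \<in> ?F" using fin ne by (rule Min_in)
  have "q \<le> a \<or> Min ?F \<le> q" if "q \<in> T" for q
  proof (cases "q \<le> a \<or> r < q")
    case True then show ?thesis using M by auto
  next
    case False then show ?thesis using that by (intro disjI2 Min_le[OF fin]) auto
  qed
  then show ?thesis using M by (intro exI[of _ "Min ?F"]) (auto simp: nxtP_def)
qed

definition nxt :: "real \<Rightarrow> real" where "nxt a = (SOME t. nxtP a t)"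

lemma nxt: "nxtP a (nxt a)"
  unfolding nxt_def using ex_nxtP by (rule someI_ex)

lemma nxtP_shift: "nxtP a t \<Longrightarrow> nxtP (a + 1) (t + 1)"
  unfolding nxtP_def
proof (intro conjI ballI)
  assume n: "t \<in> T \<and> a < t \<and> (\<forall>r\<in>T. r \<le> a \<or> t \<le> r)"
  then show "t + 1 \<in> T" using T_shift[of t 1] by simp
  show "a + 1 < t + 1" using n by simp
  fix r assume "r \<in> T"
  then have "r - 1 \<in> T" using T_shift[of "r - 1" 1] by simp
  then show "r \<le> a + 1 \<or> t + 1 \<le> r" using n by force
qed

lemma wall_fun:
  assumes "u \<in> AW" "i \<in> I"
  shows "inv u (pt r) \<bullet> nrm i - of_int (lev i)
    = (z \<bullet> wbar u (nrm i) - of_int (tr u (nrm i) (lev i))) + r * (\<eta> \<bullet> wbar u (nrm i))"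
  using inner_tr[OF assms(1) nrm_root[OF assms(2)], of "inv u (pt r)" "lev i"]
  by (simp add: aff_weyl_inv_apply(1)[OF assms(1)] pt_inner)

lemma wall_zero_T:
  assumes "u \<in> AW" "i \<in> I" "inv u (pt r) \<bullet> nrm i = of_int (lev i)"
  shows "pt r \<bullet> wbar u (nrm i) = of_int (tr u (nrm i) (lev i))" "r \<in> T"
proof -
  show *: "pt r \<bullet> wbar u (nrm i) = of_int (tr u (nrm i) (lev i))"
    using wall_fun[OF assms(1,2), of r] assms(3) unfolding pt_inner by simp
  then show "r \<in> T" using wbar_nrm_root[OF assms(1,2)] unfolding T_def by blast
qed

definition ival :: "('a \<Rightarrow> 'a) \<Rightarrow> real \<Rightarrow> real \<Rightarrow> bool" where
  "ival u a b \<longleftrightarrow> u \<in> AW \<and> (\<forall>r. a < r \<and> r < b \<longrightarrow> inv u (pt r) \<in> open_alcove)"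

lemma ival_unique: assumes "ival u a b" "ival v c d" "max a c < min b d" shows "u = v"
proof -
  let ?m = "(max a c + min b d) / 2"
  have "l < (l + h) / 2 \<and> (l + h) / 2 < h" if "l < h" for l h :: real using that by (simp add: field_simps)
  from this[OF assms(3)] have m: "max a c < ?m" "?m < min b d" by blast+
  have "inv u (pt ?m) \<in> open_alcove" "inv v (pt ?m) \<in> open_alcove" "u \<in> AW" "v \<in> AW"
    using assms(1,2) m unfolding ival_def by auto
  then show ?thesis using open_alcove_transfer aff_weyl_inv_apply(1) by metis
qed

lemma open_not_T: assumes "u \<in> AW" "inv u (pt r) \<in> open_alcove" shows "r \<notin> T"
  using aff_weyl_generic[OF assms(2,1)] aff_weyl_inv_apply(1)[OF assms(1)] by (auto simp: T_def)

text \<open>An affine wall function can change sign only through a zero, and its zeros are crossing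
  times.\<close>

lemma ival_extend:
  assumes v: "v \<in> AW" and i: "i \<in> I" and t: "inv v (pt a) \<bullet> nrm i < of_int (lev i)"
    and n: "nxtP a b" and r: "a < r" "r < b"
  shows "inv v (pt r) \<bullet> nrm i < of_int (lev i)"
proof (rule ccontr)
  assume "\<not> ?thesis"
  then obtain q where q: "min a r \<le> q" "q \<le> max a r" "q \<noteq> a"
    "(z \<bullet> wbar v (nrm i) - of_int (tr v (nrm i) (lev i))) + q * (\<eta> \<bullet> wbar v (nrm i)) = 0"
    using affine_zero_between[of "z \<bullet> wbar v (nrm i) - of_int (tr v (nrm i) (lev i))" a "\<eta> \<bullet> wbar v (nrm i)" r]
      t wall_fun[OF v i, of a] wall_fun[OF v i, of r] by (metis diff_ge_0_iff_ge diff_less_0_iff_less not_less)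
  then have "q \<in> T" using wall_zero_T(2)[OF v i, of q] wall_fun[OF v i, of q] by simp
  moreover have "a < q" "q < b" using q r by auto
  ultimately show False using n by (auto simp: nxtP_def)
qed

lemma ival_start: "nxtP 0 b \<Longrightarrow> ival id 0 b"
  unfolding ival_def using ival_extend[OF id_aff_weyl, of _ 0 b] id_aff_weyl nrm_level[OF z]
  by (auto simp: open_alcove_def)

lemma ival_closed:
  assumes "ival u a b" "a < b" "a \<le> r" "r \<le> b" "i \<in> I" shows "inv u (pt r) \<bullet> nrm i \<le> of_int (lev i)"
proof -
  have u: "u \<in> AW" using assms by (simp add: ival_def)
  have "(z \<bullet> wbar u (nrm i) - of_int (tr u (nrm i) (lev i))) + r * (\<eta> \<bullet> wbar u (nrm i)) \<le> 0"
  proof (rule affine_nonpos_closed[OF _ assms(2-4)])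
    fix q assume "a < q" "q < b"
    then have "inv u (pt q) \<bullet> nrm i < of_int (lev i)" using assms(1,5) by (auto simp: ival_def open_alcove_def)
    then show "(z \<bullet> wbar u (nrm i) - of_int (tr u (nrm i) (lev i))) + q * (\<eta> \<bullet> wbar u (nrm i)) < 0"
      using wall_fun[OF u assms(5), of q] by simp
  qed
  then show ?thesis using wall_fun[OF u assms(5), of r] by simp
qed

text \<open>At time \<open>t\<close> the point lies on at least one wall, because \<open>t\<close>
  is a crossing time, and on no second one by the condition in \<open>Upsilon\<close>. That one wall
  gives the letter.\<close>

lemma ival_step:
  assumes iv: "ival u a t" and a: "a \<ge> 0" and n: "nxtP a t" "nxtP t t'"
  shows "\<exists>i\<in>I. ival (u \<circ> s i) t t'"
proof -
  have u: "u \<in> AW" using iv by (simp add: ival_def)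
  have at: "a < t" and tT: "t \<in> T" using n by (auto simp: nxtP_def)
  have "inv u (pt t) \<notin> open_alcove" using open_not_T[OF u] tT by blast
  then obtain i where i: "i \<in> I" "\<not> inv u (pt t) \<bullet> nrm i < of_int (lev i)" by (auto simp: open_alcove_def)
  then have fi: "inv u (pt t) \<bullet> nrm i = of_int (lev i)" using ival_closed[OF iv at _ _ i(1), of t] at by simp
  let ?b = "\<lambda>j. wbar u (nrm j)" and ?k = "\<lambda>j. tr u (nrm j) (lev j)"
  have fj: "inv u (pt t) \<bullet> nrm j < of_int (lev j)" if j: "j \<in> I" "j \<noteq> i" for j
  proof (rule ccontr)
    assume "\<not> ?thesis"
    then have "inv u (pt t) \<bullet> nrm j = of_int (lev j)" using ival_closed[OF iv at _ _ j(1), of t] at by simp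
    from crossing_unique[OF _ wbar_nrm_root[OF u i(1)] wbar_nrm_root[OF u j(1)] wall_zero_T(1)[OF u i(1) fi] wall_zero_T(1)[OF u j(1) this]]
    have c: "(?b j = ?b i \<and> ?k j = ?k i) \<or> (?b j = - ?b i \<and> ?k j = - ?k i)" using a at by simp
    have W: "wbar u \<in> W" using wbar_weyl[OF u] .
    have inj: "wbar u y = wbar u y' \<Longrightarrow> y = y'" for y y' using weyl_inv_apply(2)[OF W] by metis
    have "real_of_int (lev j) = of_int (lev i) \<and> nrm j = nrm i \<or> real_of_int (lev j) = of_int (- lev i) \<and> nrm j = - nrm i"
      using c
    proof (elim disjE conjE)
      assume e: "?b j = ?b i" "?k j = ?k i"
      then show ?thesis using inj[OF e(1)] by (simp add: tr_def)
    next
      assume e: "?b j = - ?b i" "?k j = - ?k i"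
      have "nrm j = - nrm i" using e(1) weyl_neg[OF W] inj by metis
      moreover have "real_of_int (?k j) = - of_int (?k i)" using e(2) by simp
      ultimately show ?thesis
        using of_int_tr[OF u nrm_root[OF i(1)], of "lev i"] of_int_tr[OF u nrm_root[OF j(1)], of "lev j"] e(1) by simp
    qed
    then have "(nrm j = nrm i \<and> lev j = lev i) \<or> (nrm j = - nrm i \<and> lev j = - lev i)"
      by (metis of_int_eq_iff)
    then show False using index_inj[OF i(1) j(1)] j(2) by simp
  qed
  have v: "u \<circ> s i \<in> AW" using aff_weyl_comp[OF u sref_aff_weyl[OF i(1)]] .
  have iu: "inv (u \<circ> s i) y = s i (inv u y)" for y using inv_comp_sref[OF u i(1)] by simp
  have fix_t: "s i (inv u (pt t)) = inv u (pt t)" using fi by (simp add: sref_eq aff_refl_def)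
  have "inv (u \<circ> s i) (pt r) \<bullet> nrm j < of_int (lev j)" if r: "t < r" "r < t'" and j: "j \<in> I" for r j
  proof (cases "j = i")
    case False
    then show ?thesis
      using ival_extend[OF v j _ n(2) r] fj[OF j False] iu[of "pt t"] fix_t by simp
  next
    case True
    \<comment> \<open>The function of the crossed wall is negative at the midpoint \<open>?m\<close>
      and zero at \<open>t\<close>, hence positive afterwards; \<open>s i\<close> reverses its
      sign.\<close>
    let ?f = "\<lambda>q. inv u (pt q) \<bullet> nrm i - of_int (lev i)" let ?m = "(a + t) / 2"
    have fm: "?f ?m < 0" using iv i(1) at by (auto simp: ival_def open_alcove_def)
    have ft: "?f t = 0" using fi by simp
    have lin: "?f q = (z \<bullet> ?b i - of_int (?k i)) + q * (\<eta> \<bullet> ?b i)" for q using wall_fun[OF u i(1)] .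
    have "?f t - ?f ?m = (t - ?m) * (\<eta> \<bullet> ?b i)" unfolding lin by (simp add: algebra_simps)
    then have "(t - ?m) * (\<eta> \<bullet> ?b i) > 0" using fm ft by simp
    moreover have "t - ?m > 0" using at by (simp add: field_simps)
    ultimately have "\<eta> \<bullet> ?b i > 0" by (simp add: zero_less_mult_iff)
    moreover have "?f r - ?f t = (r - t) * (\<eta> \<bullet> ?b i)" unfolding lin by (simp add: algebra_simps)
    ultimately have "?f r > 0" using ft r by simp
    then show ?thesis using True iu sref_nrm[OF i(1)] by simp
  qed
  then have "ival (u \<circ> s i) t t'" using v by (auto simp: ival_def open_alcove_def)
  then show ?thesis using i(1) by blast
qed

section \<open>Alcoves visited by the ray\<close>

primrec tt :: "nat \<Rightarrow> real" where "tt 0 = 0" | "tt (Suc j) = nxt (tt j)"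

lemma tt_nxtP: "nxtP (tt j) (tt (Suc j))" using nxt by simp

lemma tt_mono: "strict_mono tt"
  using tt_nxtP by (auto intro!: strict_monoI_Suc simp: nxtP_def simp del: tt.simps)

lemma tt_nonneg: "tt j \<ge> 0"
  using strict_mono_less_eq[OF tt_mono, of 0 j] by simp

lemma tt_T: "j \<ge> 1 \<Longrightarrow> tt j \<in> T"
  using tt_nxtP[of "j - 1"] by (auto simp: nxtP_def)

primrec uu :: "nat \<Rightarrow> 'a \<Rightarrow> 'a" where
  "uu 0 = id" |
  "uu (Suc j) = uu j \<circ> s (SOME i. i \<in> I \<and> ival (uu j \<circ> s i) (tt (Suc j)) (tt (Suc (Suc j))))"

lemma uu_step:
  assumes "ival (uu j) (tt j) (tt (Suc j))"
  shows "\<exists>i\<in>I. uu (Suc j) = uu j \<circ> s i \<and> ival (uu (Suc j)) (tt (Suc j)) (tt (Suc (Suc j)))"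
proof -
  let ?P = "\<lambda>i. i \<in> I \<and> ival (uu j \<circ> s i) (tt (Suc j)) (tt (Suc (Suc j)))"
  have "\<exists>i. ?P i" using ival_step[OF assms tt_nonneg tt_nxtP tt_nxtP] by auto
  from someI_ex[OF this] show ?thesis unfolding uu.simps(2) by blast
qed

lemma uu_ival: "ival (uu j) (tt j) (tt (Suc j))"
proof (induction j)
  case 0 show ?case using ival_start[OF tt_nxtP[of 0, unfolded tt.simps(1)]] by (metis tt.simps(1) uu.simps(1))
next
  case (Suc j) then show ?case using uu_step by blast
qed

lemma uu_aff_weyl: "uu j \<in> AW" using uu_ival by (auto simp: ival_def)

lemma uu_Suc: "\<exists>i\<in>I. uu (Suc j) = uu j \<circ> s i" using uu_step[OF uu_ival] by blast

lemma mem_alcove: assumes "u \<in> AW" shows "y \<in> alcove \<Phi> \<Delta> u \<longleftrightarrow> inv u y \<in> A"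
  unfolding alcove_def using aff_weyl_inv_apply[OF assms] by (metis imageE imageI)

lemma ray_seq_uu: "ray_seq \<Phi> \<Delta> z \<eta> uu"
  unfolding ray_seq_def
proof (intro conjI allI exI[of _ tt] ballI)
  fix j r assume "r \<in> {tt j..tt (Suc j)}"
  then show "pt r \<in> alcove \<Phi> \<Delta> (uu j)"
    using ival_closed[OF uu_ival, of j r] tt_nxtP[of j]
    unfolding mem_alcove[OF uu_aff_weyl] fund_alcove_iff by (auto simp: nxtP_def)
next
  fix j
  obtain i where "i \<in> I" "uu (Suc j) = uu j \<circ> s i" using uu_Suc by blast
  then show "alcove \<Phi> \<Delta> (uu (Suc j)) \<noteq> alcove \<Phi> \<Delta> (uu j)"
    using alcove_inj[OF uu_aff_weyl uu_aff_weyl] sref_ne_id[OF _ uu_aff_weyl] by metis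
qed (use uu_aff_weyl tt_mono in auto)

text \<open>The break times in \<open>ray_seq\<close> are arbitrary and have to be recognised as the
  crossing times. A break elsewhere would leave the alcove unchanged, which \<open>ray_seq\<close>
  excludes; a crossing inside a segment would force a wall function to vanish identically.\<close>

lemma ray_seq_unique: assumes "ray_seq \<Phi> \<Delta> z \<eta> u" shows "u = uu"
proof -
  have u0: "u 0 = id" and uA: "\<And>j. u j \<in> AW" and ne: "\<And>j. alcove \<Phi> \<Delta> (u (Suc j)) \<noteq> alcove \<Phi> \<Delta> (u j)"
    using assms by (auto simp: ray_seq_def)
  obtain t where t0: "t 0 = 0" and tm: "strict_mono t"
    and seg: "\<And>j r. t j \<le> r \<Longrightarrow> r \<le> t (Suc j) \<Longrightarrow> inv (u j) (pt r) \<in> A"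
    using assms mem_alcove[OF uA] by (auto simp: ray_seq_def)
  have tlt: "t j < t (Suc j)" for j using tm by (simp add: strict_mono_Suc_iff)
  have op: "inv (u j) (pt r) \<in> open_alcove" if "r \<notin> T" "t j \<le> r" "r \<le> t (Suc j)" for j r
  proof -
    have "inv (u j) (pt r) \<bullet> nrm i \<noteq> of_int (lev i)" if "i \<in> I" for i
      using wall_zero_T(2)[OF uA that] \<open>r \<notin> T\<close> by blast
    then show ?thesis using seg[OF that(2,3)] by (fastforce simp: fund_alcove_iff open_alcove_def order_le_less)
  qed
  have iv: "ival (u j) (t j) (t (Suc j))" for j
    unfolding ival_def
  proof (intro conjI allI impI uA)
    fix r assume r: "t j < r \<and> r < t (Suc j)"
    have "inv (u j) (pt r) \<bullet> nrm i < of_int (lev i)" if i: "i \<in> I" for i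
    proof (rule ccontr)
      let ?p = "z \<bullet> wbar (u j) (nrm i) - of_int (tr (u j) (nrm i) (lev i))" and ?q = "\<eta> \<bullet> wbar (u j) (nrm i)"
      have le: "?p + r * ?q \<le> 0" if "t j \<le> r" "r \<le> t (Suc j)" for r
        using seg[OF that] i wall_fun[OF uA i, of j r] by (force simp: fund_alcove_iff)
      assume "\<not> ?thesis"
      then have zr: "inv (u j) (pt r) \<bullet> nrm i = of_int (lev i)" using seg[of j r] r i by (force simp: fund_alcove_iff)
      then have "?p + r * ?q = 0" using wall_fun[OF uA i, of j r] by simp
      then have p: "?p = - (r * ?q)" by linarith
      \<comment> \<open>An affine function that is nonpositive on the segment and zero inside it has
        slope 0, but then \<open>z\<close> itself would lie on the hyperplane.\<close>
      have "(t j - r) * ?q \<le> 0" "(t (Suc j) - r) * ?q \<le> 0"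
        using le[of "t j"] le[of "t (Suc j)"] tlt[of j] unfolding p by (auto simp: algebra_simps)
      then have "?q = 0" using r by (auto simp: mult_le_0_iff)
      then show False
        using T_slope[OF wbar_nrm_root[OF uA i] wall_zero_T(1)[OF uA i zr]] by simp
    qed
    then show "inv (u j) (pt r) \<in> open_alcove" by (auto simp: open_alcove_def)
  qed
  have nx: "nxtP (t j) (t (Suc j))" for j
    unfolding nxtP_def
  proof (intro conjI ballI)
    show "t (Suc j) \<in> T"
    proof (rule ccontr)
      assume n: "t (Suc j) \<notin> T"
      have "inv (u j) (pt (t (Suc j))) \<in> open_alcove" "inv (u (Suc j)) (pt (t (Suc j))) \<in> open_alcove"
        using op[OF n, of j] op[OF n, of "Suc j"] tlt[of j] tlt[of "Suc j"] by auto
      then have "u j = u (Suc j)" using open_alcove_transfer[OF _ uA uA] aff_weyl_inv_apply(1)[OF uA] by metis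
      then show False using ne by metis
    qed
    fix r assume "r \<in> T"
    then show "r \<le> t j \<or> t (Suc j) \<le> r" using iv[of j] open_not_T[OF uA] by (force simp: ival_def)
  qed (use tlt in auto)
  have tt: "t j = tt j" for j
  proof (induction j)
    case (Suc j) then show ?case using nx[of j] tt_nxtP[of j] nxtP_unique by metis
  qed (simp add: t0)
  show ?thesis
  proof
    fix j
    show "u j = uu j" by (rule ival_unique[OF iv uu_ival]) (use tlt[of j] tt in \<open>simp del: tt.simps\<close>)
  qed
qed

lemma ray_alcoves: "ray_alcoves \<Phi> \<Delta> z \<eta> = uu"
  unfolding ray_alcoves_def using ray_seq_uu ray_seq_unique by blast

abbreviation "word \<equiv> ray_word \<Phi> \<Delta> z \<eta>"

lemma wordI: assumes "i \<in> I" "uu (Suc j) = uu j \<circ> s i" shows "word j = i"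
  unfolding ray_word_def ray_alcoves sleft_eq
proof (rule the_equality)
  fix k assume "k \<in> I \<and> uu (Suc j) = uu j \<circ> s k"
  then show "k = i" using comp_left_cancel[OF uu_aff_weyl] sref_inj assms by metis
qed (use assms in auto)

lemma word: "word j \<in> I" "uu (Suc j) = uu j \<circ> s (word j)"
  using uu_Suc[of j] wordI[of _ j] by auto

section \<open>Periodicity of the ray\<close>

definition \<tau> :: "int \<Rightarrow> 'a \<Rightarrow> 'a" where "\<tau> m = (\<lambda>y. y + of_int m *\<^sub>R \<eta>)"

lemma tau_aff_weyl: "\<tau> m \<in> AW"
  unfolding \<tau>_def by (rule int_translation[OF lattice_translation[OF eta_lattice]])

lemma tau_simps: "\<tau> a \<circ> \<tau> b = \<tau> (a + b)" "\<tau> 0 = id" "inv (\<tau> a) = \<tau> (- a)"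
proof -
  show *: "\<tau> a \<circ> \<tau> b = \<tau> (a + b)" for a b by (auto simp: \<tau>_def fun_eq_iff algebra_simps)
  show 0: "\<tau> 0 = id" by (auto simp: \<tau>_def fun_eq_iff)
  show "inv (\<tau> a) = \<tau> (- a)" using *[of a "- a"] *[of "- a" a] 0 by (intro inv_unique_comp) auto
qed

lemma inv_tau_comp: assumes "u \<in> AW" shows "inv (\<tau> m \<circ> u) (pt r) = inv u (pt (r - of_int m))"
proof -
  have "inv (\<tau> m \<circ> u) = inv u \<circ> \<tau> (- m)"
    using o_inv_distrib[OF aff_weyl_inv(1)[OF tau_aff_weyl] aff_weyl_inv(1)[OF assms]] tau_simps(3) by metis
  moreover have "\<tau> (- m) (pt r) = pt (r - of_int m)" by (simp add: \<tau>_def algebra_simps)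
  ultimately show ?thesis by simp
qed

lemma ival_shift: assumes "ival u a b" shows "ival (\<tau> m \<circ> u) (a + of_int m) (b + of_int m)"
  using assms aff_weyl_comp[OF tau_aff_weyl] inv_tau_comp unfolding ival_def by auto

lemma tt_unbounded: "\<exists>j. tt j > B"
proof (rule ccontr)
  assume "\<not> ?thesis"
  then have "tt ` {1..} \<subseteq> T \<inter> {- B..B}"
    using tt_T tt_nonneg by (auto simp: not_less) (meson neg_le_0_iff_le order_trans)
  then have "finite (tt ` {1..})" using T_finite finite_subset by blast
  then have "finite {1::nat..}" using strict_mono_imp_inj_on[OF tt_mono] finite_imageD inj_on_subset by blast
  then show False using infinite_Ici by blast
qed

lemma T_tt: assumes "r \<in> T" "r > 0" shows "\<exists>j. r = tt (Suc j)"
proof -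
  define j where "j = (LEAST j. r \<le> tt j)"
  have "\<exists>j. r \<le> tt j" using tt_unbounded[of r] less_imp_le by blast
  then have j: "r \<le> tt j" unfolding j_def by (rule LeastI_ex)
  have "j \<noteq> 0" using j assms by (metis not_less tt.simps(1))
  then obtain k where k: "j = Suc k" using not0_implies_Suc by blast
  have "\<not> r \<le> tt k" using not_less_Least[of k "\<lambda>j. r \<le> tt j"] k unfolding j_def by simp
  then have "tt j \<le> r" using tt_nxtP[of k] assms(1) k by (auto simp: nxtP_def)
  then show ?thesis using j k by (intro exI[of _ k]) (simp del: tt.simps)
qed

text \<open>The number of crossings per unit of time: a period of the word, possibly not the least.
  It is counted from \<open>tt 1\<close>, because \<open>tt 0\<close> is the start and not a
  crossing.\<close>

definition per :: nat where "per = (SOME P. tt (Suc P) = tt 1 + 1)"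

lemma tt_per: "tt (Suc per) = tt 1 + 1"
proof -
  have "tt 1 + of_int 1 \<in> T" using T_shift tt_T[of 1] by blast
  then have "\<exists>P. tt (Suc P) = tt 1 + 1" using T_tt[of "tt 1 + 1"] tt_nonneg[of 1] by force
  then show ?thesis unfolding per_def by (rule someI_ex)
qed

lemma per_pos: "per \<ge> 1"
  using tt_per by (cases per) auto

lemma tt_shift: "tt (Suc j + per) = tt (Suc j) + 1"
proof (induction j)
  case 0 then show ?case using tt_per by simp
next
  case (Suc j)
  have "nxtP (tt (Suc j) + 1) (tt (Suc (Suc j)) + 1)" using nxtP_shift[OF tt_nxtP] .
  moreover have "nxtP (tt (Suc j) + 1) (tt (Suc (Suc j + per)))" using tt_nxtP[of "Suc j + per"] Suc by metis
  ultimately show ?case using nxtP_unique by (metis add_Suc)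
qed

text \<open>At \<open>j = 0\<close> the two intervals begin at different times,
  \<open>tt per\<close> and 1, but they overlap, which is enough for
  \<open>ival_unique\<close>.\<close>

lemma uu_shift: "uu (j + per) = \<tau> 1 \<circ> uu j"
proof (rule ival_unique[OF uu_ival ival_shift[OF uu_ival]])
  have e: "tt (Suc (j + per)) = tt (Suc j) + 1" using tt_shift[of j] by (metis add_Suc)
  have "tt (j + per) < tt (Suc (j + per))" "tt j < tt (Suc j)" using tt_mono by (auto simp: strict_mono_Suc_iff simp del: tt.simps)
  then show "max (tt (j + per)) (tt j + of_int 1) < min (tt (Suc (j + per))) (tt (Suc j) + of_int 1)"
    using e by (simp del: tt.simps)
qed

lemma word_per: "word (j + per) = word j"
proof (rule wordI[OF word(1)])
  show "uu (Suc (j + per)) = uu (j + per) \<circ> s (word j)"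
    using uu_shift[of "Suc j"] uu_shift[of j] word(2)[of j] by (metis add_Suc comp_assoc)
qed

lemma tt_per_less: "tt per < 1"
proof (rule ccontr)
  assume n: "\<not> ?thesis"
  have T: "tt per \<in> T" using tt_T per_pos by auto
  then have "tt per \<noteq> 1" using int_T[of 1] by auto
  moreover have "tt per + of_int (-1) \<in> T" using T T_shift by blast
  moreover have "tt per - 1 < tt 1" using tt_per strict_monoD[OF tt_mono, of per "Suc per"] by simp
  ultimately show False using n tt_nxtP[of 0] by (force simp: nxtP_def)
qed

text \<open>Read backwards and translated into the future, the ray in direction \<open>- \<eta>\<close> visits the
  alcoves of the ray in direction \<open>\<eta>\<close> in reverse order.\<close>

definition bi :: "nat \<Rightarrow> nat" where "bi j = (j + 1) * per - j"
definition rback :: "nat \<Rightarrow> 'a \<Rightarrow> 'a" where "rback j = \<tau> (- int (j + 1)) \<circ> uu (bi j)"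

text \<open>With a lead of \<open>j + 1\<close> periods, going back \<open>j\<close> alcoves never
  reaches the start, so the subtraction in \<open>bi\<close> is not truncated.\<close>

lemma bi_pos: "bi j \<ge> 1"
proof -
  have "(j + 1) * 1 \<le> (j + 1) * per" using per_pos by (intro mult_le_mono) auto
  then show ?thesis by (simp add: bi_def)
qed

lemma bi_Suc: "bi (Suc j) = bi j - 1 + per"
proof -
  have "j + 1 \<le> (j + 1) * per" using per_pos by (metis mult.right_neutral mult_le_mono2)
  then show ?thesis by (simp add: bi_def)
qed

lemma rback_Suc: "rback j = rback (Suc j) \<circ> s (word (bi j - 1))" "rback (Suc j) = rback j \<circ> s (word (bi j - 1))"
proof -
  have b: "Suc (bi j - 1) = bi j" using bi_pos[of j] by simp
  have "rback (Suc j) = \<tau> (- int (j + 2)) \<circ> (\<tau> 1 \<circ> uu (bi j - 1))" using uu_shift by (simp add: rback_def bi_Suc)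
  also have "\<dots> = \<tau> (- int (j + 1)) \<circ> uu (bi j - 1)" by (simp add: tau_simps flip: comp_assoc)
  finally have e: "rback (Suc j) = \<tau> (- int (j + 1)) \<circ> uu (bi j - 1)" .
  have "uu (bi j) = uu (bi j - 1) \<circ> s (word (bi j - 1))" using word(2)[of "bi j - 1"] unfolding b .
  then have 1: "rback j = (\<tau> (- int (j + 1)) \<circ> uu (bi j - 1)) \<circ> s (word (bi j - 1))"
    by (simp only: rback_def comp_assoc)
  then show "rback j = rback (Suc j) \<circ> s (word (bi j - 1))" by (simp only: e)
  have "rback j \<circ> s (word (bi j - 1)) = (\<tau> (- int (j + 1)) \<circ> uu (bi j - 1)) \<circ> (s (word (bi j - 1)) \<circ> s (word (bi j - 1)))"
    by (simp only: 1 comp_assoc)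
  then show "rback (Suc j) = rback j \<circ> s (word (bi j - 1))"
    by (simp only: e sref_sref[OF word(1)] comp_id)
qed

lemma rback_aff_weyl: "rback j \<in> AW"
  unfolding rback_def using aff_weyl_comp[OF tau_aff_weyl uu_aff_weyl] .

text \<open>The reversed ray passes from \<open>rback j\<close> to \<open>rback (Suc j)\<close>
  where the forward ray entered \<open>uu (bi j)\<close>, at time \<open>tt (bi j)\<close>. Removing
  the lead and reversing time gives the second case.\<close>

definition bt :: "nat \<Rightarrow> real" where "bt j = (case j of 0 \<Rightarrow> 0 | Suc j \<Rightarrow> real (j + 1) - tt (bi j))"

lemma bt_Suc: "bt (Suc j) = real (j + 2) - tt (Suc (bi (Suc j)))"
proof -
  obtain m where m: "bi j = Suc m" using bi_pos[of j] by (cases "bi j") auto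
  have "Suc (bi (Suc j)) = Suc m + per" using m by (simp add: bi_Suc)
  then show ?thesis using tt_shift[of m] m by (simp add: bt_def del: tt.simps)
qed

lemma ray_seq_back: "ray_seq \<Phi> \<Delta> z (- \<eta>) rback"
  unfolding ray_seq_def
proof (intro conjI allI exI[of _ bt] ballI)
  have b0: "bi 0 = per" by (simp add: bi_def)
  show "rback 0 = id" using uu_shift[of 0] b0 tau_simps(1)[of "-1" 1] tau_simps(2) by (simp add: rback_def)
  show "bt 0 = 0" by (simp add: bt_def)
  show "strict_mono bt"
  proof (unfold strict_mono_Suc_iff, intro allI)
    fix j show "bt j < bt (Suc j)"
    proof (cases j)
      case 0 then show ?thesis using tt_per_less b0 by (simp add: bt_def)
    next
      case (Suc k)
      have "bt (Suc j) = real (k + 2) - tt (bi (Suc k))" using Suc by (simp add: bt_def)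
      then show ?thesis using bt_Suc[of k] Suc strict_monoD[OF tt_mono, of "bi (Suc k)" "Suc (bi (Suc k))"] by simp
    qed
  qed
  fix j
  show "rback j \<in> AW" using rback_aff_weyl .
  show "alcove \<Phi> \<Delta> (rback (Suc j)) \<noteq> alcove \<Phi> \<Delta> (rback j)"
    using alcove_inj[OF rback_aff_weyl rback_aff_weyl] sref_ne_id[OF word(1) rback_aff_weyl] rback_Suc(2) by metis
  fix r assume r: "r \<in> {bt j..bt (Suc j)}"
  have iv: "ival (rback j) (tt (bi j) + of_int (- int (j + 1))) (tt (Suc (bi j)) + of_int (- int (j + 1)))"
    unfolding rback_def by (rule ival_shift[OF uu_ival])
  have lo: "tt (bi j) - real (j + 1) \<le> - r" using r by (simp add: bt_def)
  have hi: "- r \<le> tt (Suc (bi j)) - real (j + 1)"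
  proof (cases j)
    case 0 then show ?thesis using r tt_per tt_nonneg[of 1] b0 by (simp add: bt_def del: tt.simps)
  next
    case (Suc k) then show ?thesis using r bt_Suc[of k] by (simp del: tt.simps)
  qed
  have lt: "tt (bi j) < tt (Suc (bi j))" using tt_mono by (simp add: strict_mono_Suc_iff del: tt.simps)
  have "inv (rback j) (pt (- r)) \<in> A"
    unfolding fund_alcove_iff using ival_closed[OF iv _ _ _, of "- r"] lo hi lt by (simp del: tt.simps)
  then show "z + r *\<^sub>R - \<eta> \<in> alcove \<Phi> \<Delta> (rback j)" using mem_alcove[OF rback_aff_weyl] by simp
qed

text \<open>A double crossing at time \<open>- t\<close> recurs an integer number of time units
  later at a nonnegative time, where it is excluded for \<eta>.\<close>

lemma neg_Upsilon: "- \<eta> \<in> Upsilon \<Phi> \<Delta> z"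
  unfolding Upsilon_def
proof (intro CollectI conjI allI impI notI DiffI)
  show "- \<eta> \<in> coroot_lattice \<Phi>" using lattice_neg[OF eta_lattice] .
  show "- \<eta> \<in> {0} \<Longrightarrow> False" using eta_nonzero by simp
  fix t :: real assume t: "t \<ge> 0"
    and "\<exists>H1\<in>hyps \<Phi> \<Delta>. \<exists>H2\<in>hyps \<Phi> \<Delta>. H1 \<noteq> H2 \<and> z + t *\<^sub>R - \<eta> \<in> H1 \<and> z + t *\<^sub>R - \<eta> \<in> H2"
  then obtain \<beta> \<gamma> k l where b: "\<beta> \<in> Pos" "\<gamma> \<in> Pos" "hyp \<beta> k \<noteq> hyp \<gamma> l"
    "z + t *\<^sub>R - \<eta> \<in> hyp \<beta> k" "z + t *\<^sub>R - \<eta> \<in> hyp \<gamma> l" unfolding hyps_def by blast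
  obtain m where m: "\<eta> \<bullet> \<beta> = of_int m" using eta_int[OF pos_root[OF b(1)]] by (auto elim: Ints_cases)
  obtain m' where m': "\<eta> \<bullet> \<gamma> = of_int m'" using eta_int[OF pos_root[OF b(2)]] by (auto elim: Ints_cases)
  define n where "n = \<lceil>t\<rceil>"
  have "pt (of_int n - t) \<bullet> \<beta> = of_int (k + n * m)" "pt (of_int n - t) \<bullet> \<gamma> = of_int (l + n * m')"
    using b(4,5) unfolding pt_inner m m' by (auto simp: hyp_def inner_add_left m m' algebra_simps)
  moreover have "of_int n - t \<ge> 0" by (simp add: n_def)
  ultimately have "(\<gamma> = \<beta> \<and> l + n * m' = k + n * m) \<or> \<gamma> = - \<beta>"
    using crossing_unique[OF _ pos_root[OF b(1)] pos_root[OF b(2)]] by blast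
  then have "\<gamma> = \<beta> \<and> l + n * m' = k + n * m" using not_pos_and_neg b by auto
  then show False using b(3) m m' by auto
qed

section \<open>Least periods and the reversed word\<close>

abbreviation "N \<equiv> period \<Phi> \<Delta> z \<eta>"

lemma period: "N > 0" "word (j + N) = word j"
proof -
  have "N > 0 \<and> (\<forall>j. word (j + N) = word j)"
    unfolding period_def by (rule LeastI[of _ per]) (use per_pos word_per in auto)
  then show "N > 0" "word (j + N) = word j" by auto
qed

lemma periodic_mult:
  assumes "\<And>j::nat. f (j + p) = f j" shows "f (j + n * p) = f j"
proof (induction n)
  case (Suc n)
  have "f (j + Suc n * p) = f ((j + n * p) + p)" by (simp add: algebra_simps)
  then show ?case using Suc assms by simp
qed simp

lemma period_mult: "word (j + n * N) = word j" "word (j + n * per) = word j"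
  using periodic_mult[of word] period(2) word_per by blast+

lemma word_mod: "word (M mod N) = word M"
  using period_mult(1)[of "M mod N" "M div N"] by simp

end

context ray
begin

interpretation neg: ray \<Phi> \<Delta> z "- \<eta>"
  by unfold_locales (rule neg_Upsilon)

lemma neg_word_bi: "ray_word \<Phi> \<Delta> z (- \<eta>) j = word (bi j - 1)"
  using neg.wordI[OF word(1), of j "bi j - 1"] neg.ray_seq_unique[OF ray_seq_back] rback_Suc(2) by metis

lemma neg_word: assumes "j < n * N" shows "ray_word \<Phi> \<Delta> z (- \<eta>) j = word (n * N - 1 - j)"
proof -
  \<comment> \<open>The two positions agree up to whole periods, multiples of \<open>N\<close> on
    one side and of \<open>per\<close> on the other.\<close>
  have "bi j - 1 + n * N = n * N - 1 - j + (j + 1) * per"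
  proof -
    have "j + 1 \<le> (j + 1) * per" using per_pos by (metis mult.right_neutral mult_le_mono2)
    then show ?thesis using assms unfolding bi_def by linarith
  qed
  then show ?thesis using neg_word_bi[of j] period_mult by metis
qed

lemma neg_period_le: "period \<Phi> \<Delta> z (- \<eta>) \<le> N"
  unfolding period_def[of _ _ _ "- \<eta>"]
proof (rule Least_le, intro conjI allI)
  show "0 < N" using period by simp
  fix j
  have 1: "j < (j + 1) * N" using period(1) by (metis Suc_eq_plus1 lessI less_le_trans mult_le_mono2 mult.right_neutral Suc_leI One_nat_def)
  have 2: "j + N < (j + 2) * N" using 1 by simp
  have "(j + 2) * N - 1 - (j + N) = (j + 1) * N - 1 - j" by simp
  then show "ray_word \<Phi> \<Delta> z (- \<eta>) (j + N) = ray_word \<Phi> \<Delta> z (- \<eta>) j"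
    using neg_word[OF 1] neg_word[OF 2] by simp
qed

end

context ray
begin

interpretation neg: ray \<Phi> \<Delta> z "- \<eta>"
  by unfold_locales (rule neg_Upsilon)

text \<open>Negating twice returns \<eta>, so the inequality applied to \<open>- \<eta>\<close> is
  the converse one.\<close>

lemma neg_period: "period \<Phi> \<Delta> z (- \<eta>) = N"
  using neg_period_le neg.neg_period_le by simp

end

section \<open>Coin sequences and finite Markov chains\<close>

text \<open>Expectation over \<open>n\<close> independent coins of bias \<open>p\<close>.\<close>

fun cexp :: "real \<Rightarrow> nat \<Rightarrow> (bool list \<Rightarrow> real) \<Rightarrow> real" where
  "cexp p 0 F = F []"
| "cexp p (Suc n) F = p * cexp p n (\<lambda>bs. F (True # bs)) + (1 - p) * cexp p n (\<lambda>bs. F (False # bs))"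

lemma cexp_cong: "(\<And>bs. length bs = n \<Longrightarrow> F bs = G bs) \<Longrightarrow> cexp p n F = cexp p n G"
proof (induction n arbitrary: F G)
  case (Suc n)
  have "cexp p n (\<lambda>bs. F (b # bs)) = cexp p n (\<lambda>bs. G (b # bs))" for b
    using Suc.prems by (intro Suc.IH) simp
  then show ?case by simp
qed simp

lemma cexp_mono:
  assumes "0 \<le> p" "p \<le> 1"
  shows "(\<And>bs. length bs = n \<Longrightarrow> F bs \<le> G bs) \<Longrightarrow> cexp p n F \<le> cexp p n G"
proof (induction n arbitrary: F G)
  case (Suc n)
  have "cexp p n (\<lambda>bs. F (b # bs)) \<le> cexp p n (\<lambda>bs. G (b # bs))" for b
    using Suc.prems by (intro Suc.IH) simp
  then show ?case using assms by (auto intro!: add_mono mult_left_mono)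
qed simp

lemma cexp_add: "cexp p n (\<lambda>bs. F bs + G bs) = cexp p n F + cexp p n G"
  by (induction n arbitrary: F G) (simp_all add: algebra_simps)

lemma cexp_scale: "cexp p n (\<lambda>bs. c * F bs) = c * cexp p n F"
  by (induction n arbitrary: F) (simp_all add: algebra_simps)

lemma cexp_const: "cexp p n (\<lambda>_. c) = c"
  by (induction n) (simp_all add: algebra_simps)

lemma cexp_sum: "cexp p n (\<lambda>bs. \<Sum>i\<in>A. F i bs) = (\<Sum>i\<in>A. cexp p n (F i))"
proof (induction A rule: infinite_finite_induct)
  case (insert a A)
  then show ?case using cexp_add[of p n "F a" "\<lambda>bs. \<Sum>i\<in>A. F i bs"] by simp
qed (simp_all add: cexp_const)

text \<open>The recursion of \<open>cexp\<close> reads coins from the front, whereas the walk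
  appends them at the back.\<close>

lemma cexp_snoc:
  "cexp p (Suc n) F = p * cexp p n (\<lambda>bs. F (bs @ [True])) + (1 - p) * cexp p n (\<lambda>bs. F (bs @ [False]))"
proof (induction n arbitrary: F)
  case (Suc n)
  have "cexp p (Suc (Suc n)) F = p * cexp p (Suc n) (\<lambda>bs. F (True # bs)) + (1 - p) * cexp p (Suc n) (\<lambda>bs. F (False # bs))"
    by (rule cexp.simps)
  also have "\<dots> = p * cexp p (Suc n) (\<lambda>bs. F (bs @ [True])) + (1 - p) * cexp p (Suc n) (\<lambda>bs. F (bs @ [False]))"
    unfolding Suc[of "\<lambda>bs. F (True # bs)"] Suc[of "\<lambda>bs. F (False # bs)"] by (simp add: algebra_simps)
  finally show ?case .
qed simp

lemma cexp_snoc':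
  "cexp p (Suc n) F = cexp p n (\<lambda>bs. p * F (bs @ [True]) + (1 - p) * F (bs @ [False]))"
  unfolding cexp_snoc by (simp add: cexp_add cexp_scale)

text \<open>The probabilistic half of the reversal argument: the coins are independent with equal
  bias.\<close>

lemma cexp_rev: "cexp p n (\<lambda>bs. F (rev bs)) = cexp p n F"
proof (induction n arbitrary: F)
  case (Suc n)
  show ?case unfolding cexp.simps(2) rev.simps
    unfolding Suc[of "\<lambda>bs. F (bs @ [True])"] Suc[of "\<lambda>bs. F (bs @ [False])"] cexp_snoc[of p n F, unfolded cexp.simps(2), symmetric]
    by simp
qed simp

section \<open>The coin measure and finite prefixes\<close>

abbreviation coins :: "real \<Rightarrow> (nat \<Rightarrow> bool) measure" where
  "coins p \<equiv> (\<Pi>\<^sub>M n\<in>(UNIV::nat set). measure_pmf (bernoulli_pmf p))"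

lemma prob_space_coins: "prob_space (coins p)"
  by (intro prob_space_PiM measure_pmf.prob_space_axioms)

lemma space_coins: "space (coins p) = UNIV"
  by (auto simp: space_PiM)

lemma prefix_measurable: "Measurable.pred (coins p) (\<lambda>c. Q (map c [0..<n]))"
proof (induction n arbitrary: Q)
  case (Suc n)
  have c: "Measurable.pred (coins p) (\<lambda>c. c n)"
    using measurable_component_singleton[of n UNIV "\<lambda>_. measure_pmf (bernoulli_pmf p)"]
    by (simp cong: measurable_cong_sets)
  have "(\<lambda>c. Q (map c [0..<Suc n])) = (\<lambda>c. (c n \<longrightarrow> Q (map c [0..<n] @ [True])) \<and> (\<not> c n \<longrightarrow> Q (map c [0..<n] @ [False])))"
  proof
    fix c show "Q (map c [0..<Suc n]) \<longleftrightarrow> (c n \<longrightarrow> Q (map c [0..<n] @ [True])) \<and> (\<not> c n \<longrightarrow> Q (map c [0..<n] @ [False]))"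
      by (cases "c n") simp_all
  qed
  moreover have "Measurable.pred (coins p) \<dots>"
    using c Suc[of "\<lambda>bs. Q (bs @ [True])"] Suc[of "\<lambda>bs. Q (bs @ [False])"] by measurable
  ultimately show ?case by simp
qed simp

lemma prefix_sets: "{c. Q (map c [0..<n])} \<in> sets (coins p)"
  using prefix_measurable[where p = p and Q = Q and n = n] by (simp add: pred_def space_coins)

text \<open>Serves twice: to split off the first coin of a sequence and to split off the random
  sign.\<close>

lemma measure_bernoulli_pair:
  assumes S: "prob_space S" and X: "X \<in> sets (measure_pmf (bernoulli_pmf q) \<Otimes>\<^sub>M S)" and q: "0 \<le> q" "q \<le> 1"
  shows "measure (measure_pmf (bernoulli_pmf q) \<Otimes>\<^sub>M S) X
    = q * measure S (Pair True -` X) + (1 - q) * measure S (Pair False -` X)"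
proof -
  interpret S: prob_space S by (rule S)
  have "emeasure (measure_pmf (bernoulli_pmf q) \<Otimes>\<^sub>M S) X = (\<integral>\<^sup>+b. emeasure S (Pair b -` X) \<partial>measure_pmf (bernoulli_pmf q))"
    using X by (rule S.emeasure_pair_measure_alt)
  also have "\<dots> = emeasure S (Pair True -` X) * ennreal q + emeasure S (Pair False -` X) * ennreal (1 - q)"
    using q by simp
  also have "\<dots> = ennreal (q * measure S (Pair True -` X) + (1 - q) * measure S (Pair False -` X))"
    using q by (simp add: S.emeasure_eq_measure ennreal_mult'[symmetric] ennreal_plus[symmetric] mult.commute del: ennreal_plus)
  finally show ?thesis by (rule measure_eq_emeasure_eq_ennreal[rotated]) (use q in simp)
qed

text \<open>The sequence space is the product of one coin with itself, which matches the recursion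
  of \<open>cexp\<close>.\<close>

lemma coins_prefix:
  assumes p: "0 \<le> p" "p \<le> 1"
  shows "measure (coins p) {c. Q (map c [0..<n])} = cexp p n (\<lambda>bs. of_bool (Q bs))"
proof (induction n arbitrary: Q)
  case 0
  interpret prob_space "coins p" by (rule prob_space_coins)
  show ?case using prob_space by (simp add: space_coins)
next
  case (Suc n)
  interpret S: sequence_space "measure_pmf (bernoulli_pmf p)" ..
  let ?f = "\<lambda>(b, c). case_nat b c" and ?E = "{c. Q (map c [0..<Suc n])}"
  let ?MS = "measure_pmf (bernoulli_pmf p) \<Otimes>\<^sub>M coins p"
  have map_nat: "map (case_nat b c) [0..<Suc n] = b # map c [0..<n]" for b :: bool and c
    by (simp add: map_upt_Suc del: upt_Suc)
  have f: "?f \<in> ?MS \<rightarrow>\<^sub>M coins p" by measurable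
  have X: "?f -` ?E \<inter> space ?MS \<in> sets ?MS" using f prefix_sets by (rule measurable_sets)
  have P: "Pair b -` (?f -` ?E \<inter> space ?MS) = {c. Q (b # map c [0..<n])}" for b
    by (auto simp: map_nat space_pair_measure space_coins simp del: upt_Suc)
  have "measure (coins p) ?E = measure (distr ?MS (coins p) ?f) ?E" unfolding S.PiM_iter ..
  also have "\<dots> = measure ?MS (?f -` ?E \<inter> space ?MS)" using f prefix_sets by (rule measure_distr)
  also have "\<dots> = p * measure (coins p) (Pair True -` (?f -` ?E \<inter> space ?MS)) + (1 - p) * measure (coins p) (Pair False -` (?f -` ?E \<inter> space ?MS))"
    by (rule measure_bernoulli_pair[OF prob_space_coins X p])
  also have "\<dots> = p * measure (coins p) {c. Q (True # map c [0..<n])} + (1 - p) * measure (coins p) {c. Q (False # map c [0..<n])}"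
    by (simp only: P)
  finally show ?case using Suc[of "\<lambda>bs. Q (True # bs)"] Suc[of "\<lambda>bs. Q (False # bs)"] by simp
qed

section \<open>Stationary vectors of finite irreducible chains\<close>

definition support_rel :: "'s set \<Rightarrow> ('s \<Rightarrow> 's \<Rightarrow> real) \<Rightarrow> ('s \<times> 's) set" where
  "support_rel S K = {(x, y). x \<in> S \<and> y \<in> S \<and> K x y > 0}"

text \<open>A zero of a nonnegative stationary vector forces zeros at all predecessors, and every
  state reaches \<open>y\<close>.\<close>

lemma stationary_zero:
  assumes S: "finite S" and irr: "\<And>x y. x \<in> S \<Longrightarrow> y \<in> S \<Longrightarrow> (x, y) \<in> (support_rel S K)\<^sup>*"
    and K: "\<And>x y. x \<in> S \<Longrightarrow> y \<in> S \<Longrightarrow> K x y \<ge> 0" and h: "\<And>x. x \<in> S \<Longrightarrow> h x \<ge> (0::real)"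
    and st: "\<And>y. y \<in> S \<Longrightarrow> (\<Sum>x\<in>S. h x * K x y) = h y" and y: "y \<in> S" "h y = 0" and x: "x \<in> S"
  shows "h x = 0"
  using irr[OF x y(1)]
proof (induction rule: converse_rtrancl_induct)
  case (step a b)
  then have ab: "a \<in> S" "b \<in> S" "K a b > 0" by (auto simp: support_rel_def)
  have "h a * K a b \<le> (\<Sum>x\<in>S. h x * K x b)"
    using S ab h K by (intro member_le_sum) auto
  then have "h a * K a b \<le> 0" using st[OF ab(2)] step by simp
  then show ?case using ab h[OF ab(1)] by (simp add: mult_le_0_iff)
qed (rule y)

text \<open>Subtract from \<open>f\<close> the largest multiple of \<open>g\<close> that keeps it
  nonnegative. The difference satisfies the stationary equations and has a zero, so it vanishes, and
  comparing masses gives \<open>c = 1\<close>. The argument also covers periodic chains.\<close>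

lemma stationary_unique:
  assumes S: "finite S" and irr: "\<And>x y. x \<in> S \<Longrightarrow> y \<in> S \<Longrightarrow> (x, y) \<in> (support_rel S K)\<^sup>*"
    and K: "\<And>x y. x \<in> S \<Longrightarrow> y \<in> S \<Longrightarrow> K x y \<ge> 0"
    and f: "\<And>x. x \<in> S \<Longrightarrow> f x \<ge> (0::real)" "(\<Sum>x\<in>S. f x) = 1" "\<And>y. y \<in> S \<Longrightarrow> (\<Sum>x\<in>S. f x * K x y) = f y"
    and g: "\<And>x. x \<in> S \<Longrightarrow> g x \<ge> (0::real)" "(\<Sum>x\<in>S. g x) = 1" "\<And>y. y \<in> S \<Longrightarrow> (\<Sum>x\<in>S. g x * K x y) = g y"
    and x: "x \<in> S"
  shows "f x = g x"
proof -
  have gp: "g y > 0" if "y \<in> S" for y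
  proof (rule ccontr)
    assume "\<not> ?thesis"
    then have "g y = 0" using g(1)[OF that] by simp
    then have "g w = 0" if "w \<in> S" for w using stationary_zero[OF S irr K g(1,3)] that \<open>y \<in> S\<close> by blast
    then show False using g(2) by simp
  qed
  define c where "c = Min ((\<lambda>x. f x / g x) ` S)"
  have ne: "S \<noteq> {}" using x by auto
  have cle: "c \<le> f y / g y" if "y \<in> S" for y unfolding c_def using S that by simp
  have "c \<in> (\<lambda>x. f x / g x) ` S" unfolding c_def using S ne by (intro Min_in) auto
  then obtain y where y: "y \<in> S" "f y / g y = c" by auto
  have h0: "f w - c * g w \<ge> 0" if "w \<in> S" for w using cle[OF that] gp[OF that] by (simp add: pos_le_divide_eq)
  have hst: "(\<Sum>w\<in>S. (f w - c * g w) * K w v) = f v - c * g v" if "v \<in> S" for v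
  proof -
    have "(\<Sum>w\<in>S. (f w - c * g w) * K w v) = (\<Sum>w\<in>S. f w * K w v) - c * (\<Sum>w\<in>S. g w * K w v)"
      by (simp add: algebra_simps sum_subtractf sum_distrib_left)
    then show ?thesis using f(3) g(3) that by simp
  qed
  have "f y - c * g y = 0" using y gp[OF y(1)] by (auto simp: field_simps)
  then have z: "f w - c * g w = 0" if "w \<in> S" for w
    using stationary_zero[OF S irr K h0 hst y(1) _ that] by blast
  then have "(\<Sum>w\<in>S. f w) = c * (\<Sum>w\<in>S. g w)" by (simp add: sum_distrib_left)
  then have "c = 1" using f g by simp
  then show ?thesis using z[OF x] by simp
qed

text \<open>Maximum principle: a positive maximum propagates along all transitions, but cannot be
  attained at the state \<open>x0\<close> where mass is killed.\<close>

lemma killed_chain_zero: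
  fixes f :: "'s \<Rightarrow> real"
  assumes S: "finite S" and irr: "\<And>x y. x \<in> S \<Longrightarrow> y \<in> S \<Longrightarrow> (x, y) \<in> R\<^sup>*"
    and RS: "\<And>x y. (x, y) \<in> R \<Longrightarrow> y \<in> S"
    and step: "\<And>x y m. x \<in> S \<Longrightarrow> (x, y) \<in> R \<Longrightarrow> m > 0 \<Longrightarrow> (\<And>w. w \<in> S \<Longrightarrow> f w \<le> m) \<Longrightarrow> f x = m \<Longrightarrow> f y = m"
    and kill: "x0 \<in> S" "\<And>m. m > 0 \<Longrightarrow> (\<And>w. w \<in> S \<Longrightarrow> f w \<le> m) \<Longrightarrow> f x0 \<noteq> m"
    and x: "x \<in> S"
  shows "f x \<le> 0"
proof (rule ccontr)
  assume n: "\<not> ?thesis"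
  define m where "m = Max (f ` S)"
  have le: "f w \<le> m" if "w \<in> S" for w unfolding m_def using S that by simp
  have m: "m > 0" using le[OF x] n by simp
  have "m \<in> f ` S" unfolding m_def using S x by (intro Max_in) auto
  then obtain y where y: "y \<in> S" "f y = m" by auto
  have "f w = m \<and> w \<in> S" if "(y, w) \<in> R\<^sup>*" for w
    using that by (induction rule: rtrancl_induct) (use y step RS m le in blast)+
  then show False using irr[OF y(1) kill(1)] kill(2)[OF m le] by blast
qed

section \<open>The billiard walk and its projection\<close>

text \<open>The coins select a subword, and the ascent test is left to the Demazure product, in
  which a selected letter that is no ascent acts trivially. The selection alone does not look at the
  current alcove, so it can be reversed.\<close>

definition letters :: "(nat \<Rightarrow> 'b) \<Rightarrow> bool list \<Rightarrow> 'b list" where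
  "letters f bs = map fst (filter snd (zip (map f [0..<length bs]) bs))"

lemma letters_Nil: "letters f [] = []"
  by (simp add: letters_def)

lemma letters_snoc: "letters f (bs @ [b]) = letters f bs @ (if b then [f (length bs)] else [])"
  by (simp add: letters_def)

lemma letters_cong: "(\<And>j. j < length bs \<Longrightarrow> f j = g j) \<Longrightarrow> letters f bs = letters g bs"
proof -
  assume "\<And>j. j < length bs \<Longrightarrow> f j = g j"
  then have "map f [0..<length bs] = map g [0..<length bs]" by (intro map_cong) auto
  then show ?thesis by (simp only: letters_def)
qed

lemma set_letters: "set (letters f bs) \<subseteq> range f"
  by (auto simp: letters_def dest!: set_zip_leftD)

lemma rev_letters: "rev (letters f bs) = letters (\<lambda>j. f (length bs - 1 - j)) (rev bs)"
proof -
  have "rev (map f [0..<length bs]) = map (\<lambda>j. f (length bs - 1 - j)) [0..<length bs]"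
    by (rule nth_equalityI) (auto simp: rev_nth)
  moreover have "rev (letters f bs) = map fst (filter snd (zip (rev (map f [0..<length bs])) (rev bs)))"
    unfolding letters_def by (subst zip_rev) (simp_all add: rev_map rev_filter)
  ultimately show ?thesis by (simp add: letters_def)
qed

context alcove_point
begin

section \<open>Dominant lifts and the effect of allowed steps\<close>

lemma chm_sign:
  assumes u: "u \<in> AW" and v: "v \<in> AW" and eq: "\<And>\<beta>. \<beta> \<in> Pos \<Longrightarrow> u z \<bullet> \<beta> < 0 \<longleftrightarrow> v z \<bullet> \<beta> < 0"
  shows "chm u = chm v"
proof -
  have w: "chm u \<in> W" and d: "dominant (inv (chm u) \<circ> u)" using chm[OF u] by auto
  have "(inv (chm u) \<circ> v) z \<bullet> \<beta> > 0" if b: "\<beta> \<in> Pos" for \<beta>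
  proof -
    let ?g = "chm u \<beta>"
    have g: "?g \<in> \<Phi>" using weyl_root[OF w pos_root[OF b]] .
    have ug: "u z \<bullet> ?g > 0" using d b by (auto simp: dominant_def weyl_inv_inner[OF w])
    have "v z \<bullet> ?g > 0"
    proof (cases "?g \<in> Pos")
      case True then show ?thesis using eq[OF True] ug generic[OF v g, of 0] by auto
    next
      case False
      then have "- ?g \<in> Pos" using neg_pos_iff[OF g] by simp
      then show ?thesis using eq[of "- ?g"] ug by simp
    qed
    then show ?thesis by (simp add: weyl_inv_inner[OF w])
  qed
  then have "dominant (inv (chm u) \<circ> v)" by (simp add: dominant_def)
  then show ?thesis using chm_eqI[OF v w] by simp
qed

lemma finite_Pos: "finite Pos"
  using finite_roots pos_root by (auto intro: finite_subset)

lemma ex_strictly_dominant: "\<exists>\<xi>\<in>coroot_lattice \<Phi>. \<forall>\<alpha>\<in>\<Delta>. \<xi> \<bullet> \<alpha> = 2"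
proof
  \<comment> \<open>The sum of the positive coroots. A simple reflection permutes all of them except
    its own coroot, so the others together pair to 0 with \<alpha>.\<close>
  define \<xi> where "\<xi> = (\<Sum>\<beta>\<in>Pos. coroot \<beta>)"
  show "\<xi> \<in> coroot_lattice \<Phi>" unfolding coroot_lattice_def
  proof (intro CollectI exI)
    have "(\<Sum>\<alpha>\<in>\<Phi>. of_int (if \<alpha> \<in> Pos then 1 else 0) *\<^sub>R coroot \<alpha>) = (\<Sum>\<alpha>\<in>\<Phi> \<inter> Pos. coroot \<alpha>)"
      using finite_roots by (subst sum.inter_restrict) (auto intro: sum.cong)
    moreover have "\<Phi> \<inter> Pos = Pos" using pos_root by auto
    ultimately show "\<xi> = (\<Sum>\<alpha>\<in>\<Phi>. of_int (if \<alpha> \<in> Pos then 1 else 0) *\<^sub>R coroot \<alpha>)" by (simp add: \<xi>_def)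
  qed
  show "\<forall>\<alpha>\<in>\<Delta>. \<xi> \<bullet> \<alpha> = 2"
  proof
    fix \<alpha> assume a: "\<alpha> \<in> \<Delta>"
    have a0: "\<alpha> \<noteq> 0" using root_nonzero[OF simple_root[OF a]] .
    define S where "S = (\<Sum>\<beta>\<in>Pos - {\<alpha>}. coroot \<beta>)"
    have pr: "refl \<alpha> \<beta> \<in> Pos - {\<alpha>}" if "\<beta> \<in> Pos - {\<alpha>}" for \<beta>
    proof -
      have "refl \<alpha> \<beta> \<noteq> \<alpha>"
      proof
        assume "refl \<alpha> \<beta> = \<alpha>"
        then have "\<beta> = - \<alpha>" using refl_refl[OF a0, of \<beta>] refl_self[OF a0] by simp
        then show False using that not_pos_and_neg[OF simple_pos[OF a]] by auto
      qed
      then show ?thesis using refl_simple_pos[OF a] that by auto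
    qed
    have cr: "refl \<alpha> (coroot \<beta>) = coroot (refl \<alpha> \<beta>)" for \<beta>
      by (simp add: coroot_def inner_refl_refl[OF a0] linear_scale[OF linear_refl])
    have "refl \<alpha> S = (\<Sum>\<beta>\<in>Pos - {\<alpha>}. coroot (refl \<alpha> \<beta>))"
      unfolding S_def by (simp add: linear_sum[OF linear_refl] cr)
    also have "\<dots> = S" unfolding S_def
      by (rule sum.reindex_bij_witness[of _ "refl \<alpha>" "refl \<alpha>"]) (use pr refl_refl[OF a0] in auto)
    finally have "(2 * (S \<bullet> \<alpha>) / (\<alpha> \<bullet> \<alpha>)) *\<^sub>R \<alpha> = 0" by (simp add: refl_def)
    then have "S \<bullet> \<alpha> = 0" using a0 by auto
    moreover have "\<xi> = coroot \<alpha> + S"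
      unfolding \<xi>_def S_def using finite_Pos simple_pos[OF a] by (rule sum.remove)
    moreover have "coroot \<alpha> \<bullet> \<alpha> = 2" using a0 by (simp add: coroot_def)
    ultimately show "\<xi> \<bullet> \<alpha> = 2" by (simp add: inner_add_left)
  qed
qed

text \<open>Ensures that the choice in \<open>M_trans\<close> has a witness. Translating by a vector
  with pairing 2 against each simple root outweighs the linear part, whose pairings exceed
  -1.\<close>

lemma ex_dominant_lift: assumes v: "v \<in> W" shows "\<exists>h. h \<in> AW \<and> dominant h \<and> wbar h = v"
proof -
  obtain \<xi> where x: "\<xi> \<in> coroot_lattice \<Phi>" "\<forall>\<alpha>\<in>\<Delta>. \<xi> \<bullet> \<alpha> = 2" using ex_strictly_dominant by auto
  let ?h = "(\<lambda>y. y + \<xi>) \<circ> v"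
  have "?h \<in> AW" using aff_weyl_comp[OF lattice_translation[OF x(1)] weyl_aff_weyl[OF v]] .
  moreover have "wbar ?h = v" by (simp add: wbar_def weyl_zero[OF v])
  moreover have "?h z \<bullet> \<alpha> > 0" if a: "\<alpha> \<in> \<Delta>" for \<alpha>
  proof -
    have "v z \<bullet> \<alpha> = z \<bullet> inv v \<alpha>" using weyl_inv_inner[OF weyl_inv(2)[OF v], of z \<alpha>] inv_inv_eq[OF weyl_inv(1)[OF v]] by simp
    then have "v z \<bullet> \<alpha> > -1" using root_bounds[OF weyl_root[OF weyl_inv(2)[OF v] simple_root[OF a]]] by simp
    then show ?thesis using x(2) a by (simp add: inner_add_left)
  qed
  ultimately show ?thesis unfolding dominant_simple by blast
qed

text \<open>An allowed step crosses a single hyperplane, upwards in a positive direction; levels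
  once passed stay passed.\<close>

lemma step_keeps_above:
  assumes h: "h \<in> AW" and i: "i \<in> I" and b: "wbar h (nrm i) \<in> Pos" and d: "\<delta> \<in> Pos" "h z \<bullet> \<delta> > of_int k"
  shows "h (s i z) \<bullet> \<delta> > of_int k"
proof (rule ccontr)
  assume n: "\<not> ?thesis"
  have "h (s i z) \<bullet> \<delta> \<noteq> of_int k"
    using generic[OF aff_weyl_comp[OF h sref_aff_weyl[OF i]] pos_root[OF d(1)], of k] by simp
  then have "(h z \<bullet> \<delta> < of_int k) \<noteq> (h (s i z) \<bullet> \<delta> < of_int k)" using n d by auto
  from crossing[OF z h i pos_root[OF d(1)] this] show False
    using d(1) b not_pos_and_neg cross_side[OF h i] n d(2) by auto
qed

lemma step_keeps_below:
  assumes h: "h \<in> AW" and i: "i \<in> I" and b: "wbar h (nrm i) \<in> Pos"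
    and d: "\<delta> \<in> Pos" "\<delta> \<noteq> wbar h (nrm i)" "h z \<bullet> \<delta> < of_int k"
  shows "h (s i z) \<bullet> \<delta> < of_int k"
proof (rule ccontr)
  assume "\<not> ?thesis"
  then have "(h z \<bullet> \<delta> < of_int k) \<noteq> (h (s i z) \<bullet> \<delta> < of_int k)" using d by auto
  from crossing[OF z h i pos_root[OF d(1)] this] show False
    using d b not_pos_and_neg by auto
qed

lemma step_crosses:
  assumes h: "h \<in> AW" "dominant h" and i: "i \<in> I" and b: "wbar h (nrm i) \<in> Pos"
  shows "h (s i z) \<bullet> wbar h (nrm i) > 1"
proof -
  have "real_of_int 1 \<le> of_int (tr h (nrm i) (lev i))"
    using dominant_step(1)[OF h i b] by (simp only: of_int_le_iff)
  moreover have "h (s i z) \<bullet> wbar h (nrm i) \<noteq> of_int 1"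
    using generic[OF aff_weyl_comp[OF h(1) sref_aff_weyl[OF i]] pos_root[OF b], of 1] by simp
  ultimately show ?thesis using cross_side(2)[OF h(1) i] by simp
qed

text \<open>Every root lies in the span of the orbit or is orthogonal to the orbit, and
  irreducibility leaves no room for the second class.\<close>

lemma span_weyl_orbit: assumes b: "\<beta> \<in> \<Phi>" shows "span {w \<beta> | w. w \<in> W} = UNIV"
proof -
  let ?Orb = "{w \<beta> | w. w \<in> W}"
  define A where "A = {\<gamma>\<in>\<Phi>. \<gamma> \<in> span ?Orb}"
  define B where "B = {\<gamma>\<in>\<Phi>. \<forall>y\<in>?Orb. \<gamma> \<bullet> y = 0}"
  have OA: "?Orb \<subseteq> A" 
  proof
    fix y assume y: "y \<in> ?Orb"
    then obtain w where "w \<in> W" "y = w \<beta>" by blast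
    then show "y \<in> A" using weyl_root[of w \<beta>] b span_base[OF y] by (simp add: A_def)
  qed
  have orth: "\<gamma> \<bullet> y = 0" if "\<gamma> \<in> B" "y \<in> span ?Orb" for \<gamma> y
  proof -
    have "span ?Orb \<subseteq> {y. \<gamma> \<bullet> y = 0}"
      using that(1) by (intro span_minimal) (auto simp: subspace_def inner_add_right B_def)
    then show ?thesis using that(2) by blast
  qed
  \<comment> \<open>A root that pairs nontrivially with an orbit element is a multiple of the
    difference between that element and its reflection.\<close>
  have "\<gamma> \<in> A" if g: "\<gamma> \<in> \<Phi>" "\<gamma> \<notin> B" for \<gamma>
  proof -
    obtain w where w: "w \<in> W" "\<gamma> \<bullet> w \<beta> \<noteq> 0" using g by (auto simp: B_def)
    have "refl \<gamma> \<circ> w \<in> W" using weyl_comp[OF weyl_refl[OF g(1)] w(1)] .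
    then have "refl \<gamma> (w \<beta>) \<in> ?Orb" by (auto intro!: exI[of _ "refl \<gamma> \<circ> w"])
    then have "refl \<gamma> (w \<beta>) \<in> span ?Orb" "w \<beta> \<in> span ?Orb" using w by (auto intro: span_base)
    then have "w \<beta> - refl \<gamma> (w \<beta>) \<in> span ?Orb" by (intro span_diff)
    then have "(2 * (w \<beta> \<bullet> \<gamma>) / (\<gamma> \<bullet> \<gamma>)) *\<^sub>R \<gamma> \<in> span ?Orb" by (simp add: refl_def)
    moreover have "2 * (w \<beta> \<bullet> \<gamma>) / (\<gamma> \<bullet> \<gamma>) \<noteq> 0" using w root_nonzero[OF g(1)] by (simp add: inner_commute)
    ultimately have "\<gamma> \<in> span ?Orb" using span_scale[of "(2 * (w \<beta> \<bullet> \<gamma>) / (\<gamma> \<bullet> \<gamma>)) *\<^sub>R \<gamma>" ?Orb "1 / (2 * (w \<beta> \<bullet> \<gamma>) / (\<gamma> \<bullet> \<gamma>))"] by simp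
    then show ?thesis using g by (simp add: A_def)
  qed
  then have AB: "A \<union> B = \<Phi>" by (auto simp: A_def B_def)
  have "A \<inter> B = {}"
  proof -
    have "\<gamma> = 0" if "\<gamma> \<in> A" "\<gamma> \<in> B" for \<gamma> using orth[OF that(2), of \<gamma>] that(1) by (simp add: A_def)
    then show ?thesis using zero_not_root by (auto simp: A_def)
  qed
  moreover have "\<forall>a\<in>A. \<forall>b\<in>B. a \<bullet> b = 0"
  proof (intro ballI)
    fix a b assume "a \<in> A" "b \<in> B"
    then show "a \<bullet> b = 0" using orth[of b a] by (simp add: A_def inner_commute)
  qed
  moreover have "id \<beta> \<in> A" using OA id_weyl by blast
  then have "A \<noteq> {}" by blast
  ultimately have "B = {}" using irreducible AB unfolding irreducible_rs_def by blast
  then have "\<Phi> \<subseteq> span ?Orb" using AB by (auto simp: A_def)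
  then show ?thesis using span_roots span_minimal[of \<Phi> "span ?Orb"] by auto
qed

end

context ray
begin

section \<open>The walk as a random Demazure product\<close>

definition U :: "bool list \<Rightarrow> 'a \<Rightarrow> 'a" where "U bs = foldl dstep id (letters word bs)"

lemma set_letters_word: "set (letters word bs) \<subseteq> I"
  using set_letters[of word bs] word(1) by auto

lemma U_aff_weyl: "U bs \<in> AW"
  unfolding U_def using foldl_dstep_aff_weyl[OF id_aff_weyl set_letters_word] .

lemma U_Nil: "U [] = id"
  by (simp add: U_def letters_Nil)

lemma U_snoc: "U (bs @ [b]) = (if b then dstep (U bs) (word (length bs)) else U bs)"
  by (simp add: U_def letters_snoc)

lemma walk_eq: "walk \<Phi> \<Delta> z \<eta> c M = U (map c [0..<M])"
proof (induction M)
  case (Suc M)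
  let ?u = "U (map c [0..<M])"
  have "walk \<Phi> \<Delta> z \<eta> c (Suc M) = (if asc ?u (word M) \<and> c M then ?u \<circ> s (word M) else ?u)"
    using Suc by (simp add: word_mod Let_def separates_sep_hyp[OF U_aff_weyl word(1)] sleft_eq)
  also have "\<dots> = U (map c [0..<M] @ [c M])" by (simp add: U_snoc dstep_def)
  finally show ?case by simp
qed (simp add: U_Nil)

text \<open>The base alcove lies on the positive side of every level 0 hyperplane, so a negative
  sign is a separation, and ascents keep separations.\<close>

lemma sign_persists:
  assumes b: "\<beta> \<in> Pos" and n: "U bs z \<bullet> \<beta> < 0" shows "U (bs @ [b]) z \<bullet> \<beta> < 0"
proof (cases "b \<and> asc (U bs) (word (length bs))")
  case True
  have "(U bs z \<bullet> \<beta> < of_int 0) \<noteq> (z \<bullet> \<beta> < of_int 0)" using n open_alcove_bounds[OF z b] by simp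
  from asc_mono[OF U_aff_weyl word(1) _ pos_root[OF b] this, of "length bs"] show ?thesis
    using True open_alcove_bounds[OF z b] by (simp add: U_snoc dstep_def)
qed (use n in \<open>auto simp: U_snoc dstep_def\<close>)

lemma chamber_stabilises: "\<exists>w\<in>W. \<exists>M0. \<forall>M\<ge>M0. chm (U (map c [0..<M])) = w"
proof -
  let ?V = "\<lambda>M. U (map c [0..<M])"
  have "\<exists>M0. \<forall>M\<ge>M0. (?V M z \<bullet> \<beta> < 0) = (?V M0 z \<bullet> \<beta> < 0)" if b: "\<beta> \<in> Pos" for \<beta>
  proof (cases "\<exists>M0. ?V M0 z \<bullet> \<beta> < 0")
    case True
    then obtain M0 where M0: "?V M0 z \<bullet> \<beta> < 0" by auto
    have "?V M z \<bullet> \<beta> < 0" if "M \<ge> M0" for M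
      using that by (induction rule: dec_induct) (use M0 sign_persists[OF b] in auto)
    then show ?thesis using M0 by blast
  qed auto
  then obtain m where m: "\<And>\<beta> M. \<beta> \<in> Pos \<Longrightarrow> M \<ge> m \<beta> \<Longrightarrow> (?V M z \<bullet> \<beta> < 0) = (?V (m \<beta>) z \<bullet> \<beta> < 0)" by metis
  define M0 where "M0 = Max (insert 0 (m ` Pos))"
  have le: "m \<beta> \<le> M0" if "\<beta> \<in> Pos" for \<beta> unfolding M0_def using finite_Pos that by simp
  have "chm (?V M) = chm (?V M0)" if "M \<ge> M0" for M
  proof (rule chm_sign[OF U_aff_weyl U_aff_weyl])
    fix \<beta> assume "\<beta> \<in> Pos"
    then show "(?V M z \<bullet> \<beta> < 0) = (?V M0 z \<bullet> \<beta> < 0)" using m[of \<beta> M] m[of \<beta> M0] le[of \<beta>] that by auto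
  qed
  then show ?thesis using chm(1)[OF U_aff_weyl] by blast
qed

definition limit_event :: "('a \<Rightarrow> 'a) \<Rightarrow> (nat \<Rightarrow> bool) set" where
  "limit_event w = {c. \<exists>M0. \<forall>M\<ge>M0. chm (U (map c [0..<M])) = w}"

lemma limit_event_sets: "limit_event w \<in> sets (coins q)"
proof -
  have "limit_event w = (\<Union>M0. \<Inter>M\<in>{M0..}. {c. chm (U (map c [0..<M])) = w})"
    by (auto simp: limit_event_def)
  also have "\<dots> \<in> sets (coins q)"
    by (intro sets.countable_UN sets.countable_INT' image_subsetI) (auto intro: prefix_sets[of "\<lambda>bs. chm (U bs) = w"])
  finally show ?thesis .
qed

text \<open>Along every coin sequence the indicators of the prefix events are eventually constant,
  so dominated convergence applies with bound 1.\<close>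

lemma limit_event_tendsto:
  assumes q: "0 \<le> q" "q \<le> 1"
  shows "(\<lambda>M. cexp q M (\<lambda>bs. of_bool (chm (U bs) = w))) \<longlonglongrightarrow> measure (coins q) (limit_event w)"
proof -
  interpret prob_space "coins q" by (rule prob_space_coins)
  let ?A = "\<lambda>M. {c. chm (U (map c [0..<M])) = w}"
  have A: "?A M \<in> sets (coins q)" for M using prefix_sets[of "\<lambda>bs. chm (U bs) = w"] .
  have "(\<lambda>M. integral\<^sup>L (coins q) (indicator (?A M))) \<longlonglongrightarrow> integral\<^sup>L (coins q) (indicator (limit_event w) :: _ \<Rightarrow> real)"
  proof (rule integral_dominated_convergence[where w = "\<lambda>_. 1"])
    show "AE c in coins q. (\<lambda>M. indicator (?A M) c :: real) \<longlonglongrightarrow> indicator (limit_event w) c"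
    proof (rule AE_I2)
      fix c
      obtain v M0 where v: "\<And>M. M \<ge> M0 \<Longrightarrow> chm (U (map c [0..<M])) = v" using chamber_stabilises by blast
      have "c \<in> limit_event w \<longleftrightarrow> v = w"
      proof
        assume "c \<in> limit_event w"
        then obtain M1 where "\<And>M. M \<ge> M1 \<Longrightarrow> chm (U (map c [0..<M])) = w" by (auto simp: limit_event_def)
        then show "v = w" using v[of "max M0 M1"] by simp
      qed (use v in \<open>auto simp: limit_event_def\<close>)
      then have "\<forall>\<^sub>F M in sequentially. indicator (?A M) c = (indicator (limit_event w) c :: real)"
        using v by (intro eventually_sequentiallyI[of M0]) (auto simp: indicator_def)
      then show "(\<lambda>M. indicator (?A M) c :: real) \<longlonglongrightarrow> indicator (limit_event w) c" by (rule tendsto_eventually)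
    qed
  qed (use A limit_event_sets in \<open>auto simp: indicator_def\<close>)
  then show ?thesis using coins_prefix[OF q, of "\<lambda>bs. chm (U bs) = w"] by (simp add: space_coins)
qed

end

section \<open>The projected chain\<close>

locale billiard = ray +
  fixes p :: real
  assumes p0: "0 < p" and p1: "p < 1" and M_irr: "M_irreducible \<Phi> \<Delta> z p \<eta>"
begin

abbreviation "S \<equiv> M_states \<Phi> \<Delta> z \<eta>"
abbreviation "K \<equiv> M_trans \<Phi> \<Delta> z p \<eta>"
abbreviation "R \<equiv> support_rel S K"

lemma S_iff: "(v, k) \<in> S \<longleftrightarrow> v \<in> W \<and> k < N"
  by (auto simp: M_states_def)

lemma finite_S: "finite S"
  using finite_weyl by (simp add: M_states_def)

lemma irr: "x \<in> S \<Longrightarrow> y \<in> S \<Longrightarrow> (x, y) \<in> R\<^sup>*"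
  using M_irr by (auto simp: M_irreducible_def support_rel_def Let_def)

text \<open>For a lift \<open>h\<close> with \<open>wbar h = v\<close> this is the direction of the
  wall that \<open>h\<close> faces at letter \<open>k\<close>.\<close>

abbreviation "crossed v k \<equiv> v (nrm (word k))"
abbreviation "move v k \<equiv> v \<circ> wbar (s (word k))"

lemma move_weyl: "v \<in> W \<Longrightarrow> move v k \<in> W"
  using weyl_comp wbar_weyl[OF sref_aff_weyl[OF word(1)]] by simp

text \<open>The chosen lift drops out, because permission to move depends on the linear part
  alone.\<close>

lemma trans_eq:
  assumes v: "v \<in> W"
  shows "K (v, k) (v', k') = (if k' \<noteq> Suc k mod N then 0
    else if crossed v k \<in> Pos then p * of_bool (move v k = v') + (1 - p) * of_bool (v' = v)
    else of_bool (v' = v))"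
proof -
  define w where "w = (SOME w. w \<in> dom_weyl \<Phi> \<Delta> \<and> wbar w = v)"
  have "\<exists>w. w \<in> dom_weyl \<Phi> \<Delta> \<and> wbar w = v" using ex_dominant_lift[OF v] by (auto simp: dom_weyl_iff)
  from someI_ex[OF this] have w: "w \<in> AW" "dominant w" "wbar w = v" by (auto simp: w_def dom_weyl_iff)
  have "hat_allowed \<Phi> \<Delta> z \<eta> w k \<longleftrightarrow> crossed v k \<in> Pos"
    using allowed_iff[OF w(1,2) word(1)[of k]] separates_sep_hyp[OF w(1) word(1)[of k]] w(3)
    by (simp add: hat_allowed_def Let_def sleft_eq)
  moreover have "wbar (sleft \<Phi> \<Delta> (word k) w) = move v k" using wbar_comp[OF w(1)] w(3) by (simp add: sleft_eq)
  ultimately show ?thesis unfolding M_trans_def Let_def prod.case w_def[symmetric] by simp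
qed

lemma K_nonneg: "x \<in> S \<Longrightarrow> K x y \<ge> 0"
  using trans_eq p0 p1 by (cases x; cases y) (auto simp: S_iff)

lemma R_iff:
  assumes "v \<in> W" "k < N"
  shows "((v, k), y) \<in> R \<longleftrightarrow> y = (v, Suc k mod N) \<or> (crossed v k \<in> Pos \<and> y = (move v k, Suc k mod N))"
proof -
  obtain v' k' where [simp]: "y = (v', k')" by fastforce
  have sN: "Suc k mod N < N" using period(1) by simp
  show ?thesis
    using assms move_weyl[OF assms(1), of k] p0 p1 sN
    by (auto simp: support_rel_def S_iff trans_eq[OF assms(1)] of_bool_def add_pos_nonneg add_nonneg_pos split: if_splits)
qed

text \<open>Paths in the projected chain lift to dominant elements. If no root of the Weyl orbit of
  \<open>\<beta>\<close> were ever crossed, a loop through some crossing would lift to a nonzero translation that is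
  orthogonal to the orbit, which spans the space.\<close>

lemma lift_path:
  assumes path: "(a, b) \<in> R\<^sup>*" and aS: "a \<in> S" and g: "h \<in> AW" "dominant h" "wbar h = fst a"
    and Orb: "\<forall>v\<in>W. \<forall>k<N. crossed v k \<notin> Orb"
  shows "b \<in> S \<and> (\<exists>h'. h' \<in> AW \<and> dominant h' \<and> wbar h' = fst b \<and>
    (\<forall>\<delta>\<in>Pos. \<forall>l::int. h z \<bullet> \<delta> > of_int l \<longrightarrow> h' z \<bullet> \<delta> > of_int l) \<and>
    (\<forall>\<gamma>\<in>Pos \<inter> Orb. h z \<bullet> \<gamma> < 1 \<longrightarrow> h' z \<bullet> \<gamma> < 1))"
  using path
proof (induction rule: rtrancl_induct)
  case base
  then show ?case using aS g by blast
next
  case (step b c)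
  then obtain h' where bS: "b \<in> S" and h': "h' \<in> AW" "dominant h'" "wbar h' = fst b"
    and up: "\<forall>\<delta>\<in>Pos. \<forall>l::int. h z \<bullet> \<delta> > of_int l \<longrightarrow> h' z \<bullet> \<delta> > of_int l"
    and dn: "\<forall>\<gamma>\<in>Pos \<inter> Orb. h z \<bullet> \<gamma> < 1 \<longrightarrow> h' z \<bullet> \<gamma> < 1" by blast
  obtain v k where b: "b = (v, k)" by fastforce
  have vk: "v \<in> W" "k < N" using bS b by (auto simp: S_iff)
  have cS: "c \<in> S" using step(2) by (auto simp: support_rel_def)
  from step(2) consider "c = (v, Suc k mod N)" | "crossed v k \<in> Pos" "c = (move v k, Suc k mod N)"
    using R_iff[OF vk] b by blast
  then show ?case
  proof cases
    case 1
    then show ?thesis using cS h' up dn b by auto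
  next
    case 2
    let ?h = "h' \<circ> s (word k)"
    have i: "word k \<in> I" using word(1) .
    have cr: "wbar h' (nrm (word k)) \<in> Pos" using 2 h'(3) b by simp
    have "?h \<in> AW" using aff_weyl_comp[OF h'(1) sref_aff_weyl[OF i]] .
    moreover have "dominant ?h" using dominant_step(2)[OF h'(1,2) i cr] .
    moreover have "wbar ?h = fst c" using wbar_comp[OF h'(1)] h'(3) b 2 by simp
    moreover have "\<forall>\<delta>\<in>Pos. \<forall>l::int. h z \<bullet> \<delta> > of_int l \<longrightarrow> ?h z \<bullet> \<delta> > of_int l"
      using step_keeps_above[OF h'(1) i cr] up by simp
    moreover have "\<forall>\<gamma>\<in>Pos \<inter> Orb. h z \<bullet> \<gamma> < 1 \<longrightarrow> ?h z \<bullet> \<gamma> < 1"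
    proof (intro ballI impI)
      fix \<gamma> assume gam: "\<gamma> \<in> Pos \<inter> Orb" "h z \<bullet> \<gamma> < 1"
      then have "\<gamma> \<noteq> wbar h' (nrm (word k))" using Orb vk h'(3) b by auto
      then show "?h z \<bullet> \<gamma> < 1" using step_keeps_below[OF h'(1) i cr, of \<gamma> 1] gam dn by simp
    qed
    ultimately show ?thesis using cS by blast
  qed
qed

lemma start_S: "(id, 0) \<in> S"
  using id_weyl period(1) by (simp add: S_iff)

lemma dominant_id: "dominant id"
  using open_alcove_bounds[OF z] by (simp add: dominant_def)

lemma every_root_crossed:
  assumes b: "\<beta> \<in> Pos" shows "\<exists>v\<in>W. \<exists>k<N. crossed v k = \<beta>"
proof (rule ccontr)
  assume none: "\<not> ?thesis"
  define Orb where "Orb = {w \<beta> | w. w \<in> W}"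
  have Orb: "\<forall>v\<in>W. \<forall>k<N. crossed v k \<notin> Orb"
  proof (intro ballI allI impI notI)
    fix v k assume vk: "v \<in> W" "k < N" and gO: "crossed v k \<in> Orb"
    obtain w where w: "w \<in> W" "crossed v k = w \<beta>" using gO by (auto simp: Orb_def)
    have "inv w \<circ> v \<in> W" using weyl_comp weyl_inv w vk by auto
    moreover have "crossed (inv w \<circ> v) k = \<beta>" using w weyl_inv_apply[OF w(1)] by simp
    ultimately show False using none vk by blast
  qed
  \<comment> \<open>Some state faces a positive direction: \<open>id\<close> does, or else the
    reflection in the normal of the wall.\<close>
  obtain v where v: "v \<in> W" "crossed v 0 \<in> Pos"
  proof (cases "nrm (word 0) \<in> Pos")
    case True then show ?thesis using that[of id] id_weyl by simp
  next
    case False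
    have r: "nrm (word 0) \<in> \<Phi>" using nrm_root[OF word(1)] .
    then have "refl (nrm (word 0)) (nrm (word 0)) \<in> Pos"
      using refl_self[OF root_nonzero] neg_pos_iff False by simp
    then show ?thesis using that weyl_refl[OF r] by blast
  qed
  let ?d = "crossed v 0"
  have vS: "(v, 0) \<in> S" using v period(1) by (simp add: S_iff)
  obtain h where h: "h \<in> AW" "dominant h" "wbar h = v" and hO: "\<And>\<gamma>. \<gamma> \<in> Pos \<inter> Orb \<Longrightarrow> h z \<bullet> \<gamma> < 1"
    using lift_path[OF irr[OF start_S vS] start_S id_aff_weyl dominant_id _ Orb, unfolded weyl_wbar[OF id_weyl] fst_conv id_apply, OF refl]
      open_alcove_bounds(2)[OF z] by blast
  let ?h1 = "h \<circ> s (word 0)"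
  have i: "word 0 \<in> I" using word(1) .
  have cr: "wbar h (nrm (word 0)) \<in> Pos" using v h by simp
  have h1: "?h1 \<in> AW" "dominant ?h1" "wbar ?h1 = move v 0"
    using aff_weyl_comp[OF h(1) sref_aff_weyl[OF i]] dominant_step(2)[OF h(1,2) i cr] wbar_comp[OF h(1)] h(3) by auto
  have d1: "?h1 z \<bullet> ?d > of_int 1" using step_crosses[OF h(1,2) i cr] h(3) by simp
  have h1O: "?h1 z \<bullet> \<gamma> < 1" if "\<gamma> \<in> Pos \<inter> Orb" for \<gamma>
    using step_keeps_below[OF h(1) i cr, of \<gamma> 1] hO[OF that] Orb v(1) period(1) that h(3) by auto
  have mS: "(move v 0, Suc 0 mod N) \<in> S" using move_weyl[OF v(1)] period(1) by (simp add: S_iff)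
  \<comment> \<open>Returning to \<open>(id, 0)\<close> yields a lift with trivial linear part, that
    is, a translation, and it has passed level 1 in direction \<open>?d\<close>.\<close>
  obtain g where g: "g \<in> AW" "wbar g = id" "dominant g" and gd: "g z \<bullet> ?d > of_int 1" and gO: "\<And>\<gamma>. \<gamma> \<in> Pos \<inter> Orb \<Longrightarrow> g z \<bullet> \<gamma> < 1"
    using lift_path[OF irr[OF mS start_S] mS h1(1,2) _ Orb, unfolded fst_conv, OF h1(3)] d1 h1O v(2) by blast
  have gz: "g z = z + g 0" using wbar_plus[of g z] g(2) by simp
  \<comment> \<open>Both \<open>z\<close> and \<open>g z\<close> lie strictly between levels 0 and
    1, which leaves 0 as the only integer for the difference.\<close>
  have z0: "g 0 \<bullet> \<gamma> = 0" if gam: "\<gamma> \<in> Pos \<inter> Orb" for \<gamma>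
  proof -
    have "g z \<bullet> \<gamma> > 0" using g(3) gam by (simp add: dominant_def)
    then have "-1 < g 0 \<bullet> \<gamma>" "g 0 \<bullet> \<gamma> < 1"
      using gO[OF gam] open_alcove_bounds[OF z, of \<gamma>] gam gz by (auto simp: inner_add_left)
    moreover obtain n :: int where "g 0 \<bullet> \<gamma> = of_int n" using aff_weyl_int[OF g(1) pos_root, of \<gamma>] gam by (auto elim: Ints_cases)
    ultimately show ?thesis by simp
  qed
  have "g 0 \<bullet> \<gamma> = 0" if gam: "\<gamma> \<in> Orb" for \<gamma>
  proof -
    obtain w where w: "w \<in> W" "\<gamma> = w \<beta>" using gam by (auto simp: Orb_def)
    have r: "\<gamma> \<in> \<Phi>" using weyl_root[OF w(1) pos_root[OF b]] w(2) by simp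
    have "refl \<gamma> \<circ> w \<in> W" using weyl_comp[OF weyl_refl[OF r] w(1)] .
    then have "refl \<gamma> \<gamma> \<in> Orb" using w(2) unfolding Orb_def by (intro CollectI exI[of _ "refl \<gamma> \<circ> w"]) auto
    then have "- \<gamma> \<in> Orb" using refl_self[OF root_nonzero[OF r]] by simp
    then show ?thesis using z0[of \<gamma>] z0[of "- \<gamma>"] gam pos_or_neg[OF r] by auto
  qed
  then have "Orb \<subseteq> {y. g 0 \<bullet> y = 0}" by auto
  then have "span Orb \<subseteq> {y. g 0 \<bullet> y = 0}" by (intro span_minimal) (auto simp: subspace_def inner_add_right)
  then have "g 0 \<bullet> ?d = 0" using span_weyl_orbit[OF pos_root[OF b]] unfolding Orb_def by blast
  then have "g z \<bullet> ?d = z \<bullet> ?d" using gz by (simp add: inner_add_left)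
  then show False using gd open_alcove_bounds[OF z v(2)] by simp
qed

text \<open>\<open>surv \<beta> m x\<close> is the probability that the projected chain started at \<open>x\<close> crosses no
  hyperplane of direction \<open>\<beta>\<close> in its first \<open>m\<close> steps.\<close>

primrec surv :: "'a \<Rightarrow> nat \<Rightarrow> ('a \<Rightarrow> 'a) \<times> nat \<Rightarrow> real" where
  "surv \<beta> 0 x = 1"
| "surv \<beta> (Suc m) x = (if crossed (fst x) (snd x) \<in> Pos
     then p * (if crossed (fst x) (snd x) = \<beta> then 0 else surv \<beta> m (move (fst x) (snd x), Suc (snd x) mod N))
       + (1 - p) * surv \<beta> m (fst x, Suc (snd x) mod N)
     else surv \<beta> m (fst x, Suc (snd x) mod N))"

lemma surv_bounds: "0 \<le> surv \<beta> m x \<and> surv \<beta> m x \<le> 1"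
proof (induction m arbitrary: x)
  case (Suc m)
  have "p * a + (1 - p) * b \<le> 1 \<and> 0 \<le> p * a + (1 - p) * b" if "0 \<le> a" "a \<le> 1" "0 \<le> b" "b \<le> 1" for a b
    using that p0 p1 convex_bound_le[of a 1 b p "1 - p"] by auto
  then show ?case using Suc by auto
qed simp

lemma surv_decreasing: "surv \<beta> (Suc m) x \<le> surv \<beta> m x"
proof (induction m arbitrary: x)
  case 0 show ?case using surv_bounds[of \<beta> "Suc 0" x] by simp
next
  case (Suc m)
  have "surv \<beta> (Suc (Suc m)) x = (if crossed (fst x) (snd x) \<in> Pos
     then p * (if crossed (fst x) (snd x) = \<beta> then 0 else surv \<beta> (Suc m) (move (fst x) (snd x), Suc (snd x) mod N))
       + (1 - p) * surv \<beta> (Suc m) (fst x, Suc (snd x) mod N)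
     else surv \<beta> (Suc m) (fst x, Suc (snd x) mod N))" by (rule surv.simps(2))
  also have "\<dots> \<le> surv \<beta> (Suc m) x"
    unfolding surv.simps(2)[of \<beta> m x] using Suc p0 p1 by (auto intro!: add_mono mult_left_mono simp del: surv.simps(2))
  finally show ?case .
qed

definition surv_lim :: "'a \<Rightarrow> ('a \<Rightarrow> 'a) \<times> nat \<Rightarrow> real" where "surv_lim \<beta> x = lim (\<lambda>m. surv \<beta> m x)"

lemma surv_lim: "(\<lambda>m. surv \<beta> m x) \<longlonglongrightarrow> surv_lim \<beta> x"
proof -
  have "decseq (\<lambda>m. surv \<beta> m x)" using surv_decreasing by (intro decseq_SucI)
  then have "convergent (\<lambda>m. surv \<beta> m x)"
    using surv_bounds decseq_convergent[of "\<lambda>m. surv \<beta> m x" 0] by (metis convergentI)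
  then show ?thesis unfolding surv_lim_def by (simp add: convergent_LIMSEQ_iff)
qed

lemma surv_lim_eq:
  "surv_lim \<beta> x = (if crossed (fst x) (snd x) \<in> Pos
     then p * (if crossed (fst x) (snd x) = \<beta> then 0 else surv_lim \<beta> (move (fst x) (snd x), Suc (snd x) mod N))
       + (1 - p) * surv_lim \<beta> (fst x, Suc (snd x) mod N)
     else surv_lim \<beta> (fst x, Suc (snd x) mod N))"
proof (rule LIMSEQ_unique[OF LIMSEQ_Suc[OF surv_lim]])
  show "(\<lambda>m. surv \<beta> (Suc m) x) \<longlonglongrightarrow> (if crossed (fst x) (snd x) \<in> Pos
     then p * (if crossed (fst x) (snd x) = \<beta> then 0 else surv_lim \<beta> (move (fst x) (snd x), Suc (snd x) mod N))
       + (1 - p) * surv_lim \<beta> (fst x, Suc (snd x) mod N)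
     else surv_lim \<beta> (fst x, Suc (snd x) mod N))"
    unfolding surv.simps(2) by (auto intro!: tendsto_intros surv_lim)
qed

lemma surv_lim_nonneg: "surv_lim \<beta> x \<ge> 0"
  by (rule LIMSEQ_le_const[OF surv_lim]) (use surv_bounds in blast)

text \<open>The limit is harmonic except for the mass killed at crossings of direction \<beta>, and
  \<open>every_root_crossed\<close> supplies a state with such a crossing. So a positive maximum is
  impossible.\<close>

lemma surv_lim_zero: assumes b: "\<beta> \<in> Pos" and x: "x \<in> S" shows "surv_lim \<beta> x = 0"
proof -
  obtain v0 k0 where v0: "v0 \<in> W" "k0 < N" "crossed v0 k0 = \<beta>" using every_root_crossed[OF b] by blast
  have sN: "Suc k mod N < N" for k using period(1) by simp
  \<comment> \<open>A convex combination with positive weights attains a common upper bound only if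
    both terms do.\<close>
  have conv: "a = m \<and> b = m" if "m = p * a + (1 - p) * b" "a \<le> m" "b \<le> m" for a b m
  proof -
    have "p * (m - a) + (1 - p) * (m - b) = 0" using that by (simp add: algebra_simps)
    moreover have "p * (m - a) \<ge> 0" "(1 - p) * (m - b) \<ge> 0" using that p0 p1 by auto
    ultimately have "p * (m - a) = 0" "(1 - p) * (m - b) = 0" by linarith+
    then show ?thesis using p0 p1 by auto
  qed
  have "surv_lim \<beta> x \<le> 0"
  proof (rule killed_chain_zero[OF finite_S irr _ _ _ _ x, where ?x0.0 = "(v0, k0)"])
    fix y w m assume y: "y \<in> S" "(y, w) \<in> R" and m: "m > 0" "\<And>w. w \<in> S \<Longrightarrow> surv_lim \<beta> w \<le> m" "surv_lim \<beta> y = m"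
    obtain v k where [simp]: "y = (v, k)" by fastforce
    have vk: "v \<in> W" "k < N" using y by (auto simp: S_iff)
    have in1: "surv_lim \<beta> (v, Suc k mod N) \<le> m" and in2: "surv_lim \<beta> (move v k, Suc k mod N) \<le> m"
      using m(2) vk move_weyl[OF vk(1)] sN by (auto simp: S_iff)
    show "surv_lim \<beta> w = m"
    proof (cases "crossed v k \<in> Pos")
      case True
      have "m = p * (if crossed v k = \<beta> then 0 else surv_lim \<beta> (move v k, Suc k mod N)) + (1 - p) * surv_lim \<beta> (v, Suc k mod N)"
        using m(3) surv_lim_eq[of \<beta> y] True by simp
      from conv[OF this _ in1] have "(if crossed v k = \<beta> then 0 else surv_lim \<beta> (move v k, Suc k mod N)) = m" "surv_lim \<beta> (v, Suc k mod N) = m"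
        using m(1) in2 by auto
      then show ?thesis using R_iff[OF vk] y(2) m(1) by (auto split: if_splits)
    next
      case False
      then show ?thesis using R_iff[OF vk] y(2) m(3) surv_lim_eq[of \<beta> y] by auto
    qed
  next
    fix m :: real assume m: "m > 0" "\<And>w. w \<in> S \<Longrightarrow> surv_lim \<beta> w \<le> m"
    have "surv_lim \<beta> (v0, k0) = p * 0 + (1 - p) * surv_lim \<beta> (v0, Suc k0 mod N)"
      using surv_lim_eq[of \<beta> "(v0, k0)"] v0 b by simp
    moreover have "surv_lim \<beta> (v0, Suc k0 mod N) \<le> m" using m(2) v0 sN by (auto simp: S_iff)
    ultimately show "surv_lim \<beta> (v0, k0) \<noteq> m" using conv[of m 0 "surv_lim \<beta> (v0, Suc k0 mod N)"] m(1) by auto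
  qed (use v0 in \<open>auto simp: S_iff support_rel_def\<close>)
  then show ?thesis using surv_lim_nonneg[of \<beta> x] by simp
qed

section \<open>Escape of the dominant walk from the walls\<close>

lemma hat_U_snoc:
  "hat (U (bs @ [b])) = (if b \<and> crossed (wbar (hat (U bs))) (length bs) \<in> Pos
     then hat (U bs) \<circ> s (word (length bs)) else hat (U bs))"
  using hat_dstep[OF U_aff_weyl word(1)] by (simp add: U_snoc)

lemma wbar_hat_snoc:
  "wbar (hat (U (bs @ [b]))) = (if b \<and> crossed (wbar (hat (U bs))) (length bs) \<in> Pos
     then move (wbar (hat (U bs))) (length bs) else wbar (hat (U bs)))"
  using wbar_comp[OF hat(1)[OF U_aff_weyl]] by (simp add: hat_U_snoc)

lemma wbar_hat_U: "wbar (hat (U bs)) \<in> W"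
  using wbar_weyl[OF hat(1)[OF U_aff_weyl]] .

lemma hat_id: "hat id = id"
  using chm_comp(2)[OF id_weyl id_aff_weyl dominant_id] by simp

text \<open>A supermartingale inequality. Crossing a hyperplane of direction \<beta> puts the walk
  above level 1, where it remains, so the event of still being below 1 is controlled by survival
  without such crossings.\<close>

lemma surv_step:
  assumes b: "\<beta> \<in> Pos" and n: "length bs = n"
  shows "p * (of_bool (hat (U (bs @ [True])) z \<bullet> \<beta> < 1) * surv \<beta> m (wbar (hat (U (bs @ [True]))), Suc n mod N))
      + (1 - p) * (of_bool (hat (U (bs @ [False])) z \<bullet> \<beta> < 1) * surv \<beta> m (wbar (hat (U (bs @ [False]))), Suc n mod N))
    \<le> of_bool (hat (U bs) z \<bullet> \<beta> < 1) * surv \<beta> (Suc m) (wbar (hat (U bs)), n mod N)"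
proof -
  define h where "h = hat (U bs)"
  have h: "h \<in> AW" "dominant h" using hat[OF U_aff_weyl] by (auto simp: h_def)
  have i: "word n \<in> I" using word(1) .
  have sm: "Suc (n mod N) mod N = Suc n mod N" by (simp add: mod_Suc_eq)
  have F: "hat (U (bs @ [False])) = h" by (simp add: hat_U_snoc h_def)
  have e: "crossed (wbar h) (n mod N) = wbar h (nrm (word n))" by (simp add: word_mod)
  show ?thesis
  proof (cases "wbar h (nrm (word n)) \<in> Pos")
    case False
    then have T: "hat (U (bs @ [True])) = h" using n by (simp add: hat_U_snoc h_def)
    have "surv \<beta> (Suc m) (wbar h, n mod N) = surv \<beta> m (wbar h, Suc n mod N)" using False e sm by simp
    then show ?thesis unfolding T F h_def[symmetric] by (simp add: algebra_simps)
  next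
    case True
    then have T: "hat (U (bs @ [True])) = h \<circ> s (word n)" using n by (simp add: hat_U_snoc h_def)
    have wT: "wbar (h \<circ> s (word n)) = move (wbar h) n" using wbar_comp[OF h(1)] by simp
    have mv: "move (wbar h) (n mod N) = move (wbar h) n" by (simp add: word_mod)
    have sv: "surv \<beta> (Suc m) (wbar h, n mod N) =
      p * (if wbar h (nrm (word n)) = \<beta> then 0 else surv \<beta> m (move (wbar h) n, Suc n mod N)) + (1 - p) * surv \<beta> m (wbar h, Suc n mod N)"
      using True e sm mv by simp
    have "of_bool ((h \<circ> s (word n)) z \<bullet> \<beta> < 1) * surv \<beta> m (move (wbar h) n, Suc n mod N)
      \<le> of_bool (h z \<bullet> \<beta> < 1) * (if wbar h (nrm (word n)) = \<beta> then 0 else surv \<beta> m (move (wbar h) n, Suc n mod N))"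
    proof (cases "wbar h (nrm (word n)) = \<beta>")
      case eq: True
      then show ?thesis using step_crosses[OF h i True] by simp
    next
      case neq: False
      have "h z \<bullet> \<beta> < 1" if "(h \<circ> s (word n)) z \<bullet> \<beta> < 1"
      proof (rule ccontr)
        assume "\<not> h z \<bullet> \<beta> < 1"
        then have "h z \<bullet> \<beta> > of_int 1" using generic[OF h(1) pos_root[OF b], of 1] by simp
        then show False using step_keeps_above[OF h(1) i True b, of 1] that by simp
      qed
      then show ?thesis using neq surv_bounds[of \<beta> m] by (auto simp: of_bool_def)
    qed
    then have "p * (of_bool ((h \<circ> s (word n)) z \<bullet> \<beta> < 1) * surv \<beta> m (move (wbar h) n, Suc n mod N))
      \<le> p * (of_bool (h z \<bullet> \<beta> < 1) * (if wbar h (nrm (word n)) = \<beta> then 0 else surv \<beta> m (move (wbar h) n, Suc n mod N)))"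
      using p0 by (intro mult_left_mono) auto
    then show ?thesis unfolding T F h_def[symmetric] wT sv by (simp add: algebra_simps)
  qed
qed

text \<open>Iterating \<open>surv_step\<close> trades the steps already taken by the walk for
  survival steps counted from the start.\<close>

lemma near_wall_le:
  assumes b: "\<beta> \<in> Pos" shows "cexp p n (\<lambda>bs. of_bool (hat (U bs) z \<bullet> \<beta> < 1)) \<le> surv \<beta> n (id, 0)"
proof -
  let ?P = "\<lambda>n m. cexp p n (\<lambda>bs. of_bool (hat (U bs) z \<bullet> \<beta> < 1) * surv \<beta> m (wbar (hat (U bs)), n mod N))"
  have st: "?P (Suc n) m \<le> ?P n (Suc m)" for n m
    unfolding cexp_snoc' using p0 p1 surv_step[OF b] by (intro cexp_mono) auto
  have "?P n m \<le> ?P 0 (n + m)" for m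
  proof (induction n arbitrary: m)
    case (Suc n) show ?case using order_trans[OF st Suc[of "Suc m"]] by simp
  qed simp
  from this[of 0] show ?thesis
    using weyl_wbar[OF id_weyl] open_alcove_bounds[OF z b] by (simp add: U_Nil hat_id)
qed

lemma near_wall_tendsto:
  assumes b: "\<beta> \<in> Pos" shows "(\<lambda>n. cexp p n (\<lambda>bs. of_bool (hat (U bs) z \<bullet> \<beta> < 1))) \<longlonglongrightarrow> 0"
proof (rule tendsto_sandwich[OF _ _ tendsto_const])
  show "(\<lambda>n. surv \<beta> n (id, 0)) \<longlonglongrightarrow> 0" using surv_lim[of \<beta> "(id, 0)"] surv_lim_zero[OF b start_S] by simp
  have "cexp p n (\<lambda>_. 0) \<le> cexp p n (\<lambda>bs. of_bool (hat (U bs) z \<bullet> \<beta> < 1))" for n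
    using p0 p1 by (intro cexp_mono) auto
  then show "\<forall>\<^sub>F n in sequentially. 0 \<le> cexp p n (\<lambda>bs. of_bool (hat (U bs) z \<bullet> \<beta> < 1))"
    by (simp add: cexp_const)
qed (use near_wall_le[OF b] in simp)

section \<open>The law of the linear part and the stationary distribution\<close>

definition \<mu> :: "nat \<Rightarrow> ('a \<Rightarrow> 'a) \<Rightarrow> real" where
  "\<mu> n v = cexp p n (\<lambda>bs. of_bool (wbar (hat (U bs)) = v))"

lemma mu_nonneg: "\<mu> n v \<ge> 0"
proof -
  have "cexp p n (\<lambda>_. 0) \<le> \<mu> n v" unfolding \<mu>_def using p0 p1 by (intro cexp_mono) auto
  then show ?thesis by (simp add: cexp_const)
qed

lemma mu_sum: "(\<Sum>v\<in>W. \<mu> n v) = 1"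
proof -
  have "(\<Sum>v\<in>W. \<mu> n v) = cexp p n (\<lambda>bs. \<Sum>v\<in>W. of_bool (wbar (hat (U bs)) = v))"
    by (simp add: \<mu>_def cexp_sum)
  also have "\<dots> = cexp p n (\<lambda>_. 1)"
    using wbar_hat_U finite_weyl by (intro cexp_cong) (simp add: of_bool_def)
  finally show ?thesis by (simp add: cexp_const)
qed

text \<open>Identifies the linear part of the dominant factor as the projected chain: the last coin
  is split off and compared with the cases of \<open>trans_eq\<close>.\<close>

lemma mu_Suc: "\<mu> (Suc n) v' = (\<Sum>v\<in>W. \<mu> n v * K (v, n mod N) (v', Suc n mod N))"
proof -
  have sm: "Suc (n mod N) mod N = Suc n mod N" by (simp add: mod_Suc_eq)
  have "\<mu> (Suc n) v' = cexp p n (\<lambda>bs. K (wbar (hat (U bs)), n mod N) (v', Suc n mod N))"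
    unfolding \<mu>_def cexp_snoc'
    by (intro cexp_cong) (auto simp: trans_eq[OF wbar_hat_U] sm word_mod wbar_hat_snoc of_bool_def simp del: o_apply)
  also have "\<dots> = cexp p n (\<lambda>bs. \<Sum>v\<in>W. of_bool (wbar (hat (U bs)) = v) * K (v, n mod N) (v', Suc n mod N))"
    using wbar_hat_U finite_weyl by (intro cexp_cong) (simp add: of_bool_def if_distrib[of "\<lambda>x. x * _"] cong: if_cong)
  also have "\<dots> = (\<Sum>v\<in>W. cexp p n (\<lambda>bs. of_bool (wbar (hat (U bs)) = v) * K (v, n mod N) (v', Suc n mod N)))"
    by (rule cexp_sum)
  also have "\<dots> = (\<Sum>v\<in>W. \<mu> n v * K (v, n mod N) (v', Suc n mod N))"
    unfolding \<mu>_def by (intro sum.cong refl) (simp add: mult.commute[of _ "K _ _"] cexp_scale)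
  finally show ?thesis .
qed

text \<open>Convergence along multiples of the period suffices: the limits at all residues then form
  the stationary distribution.\<close>

lemma zeta_limit:
  assumes lim: "\<And>v. v \<in> W \<Longrightarrow> (\<lambda>n. \<mu> (n * N) v) \<longlonglongrightarrow> l v" and v: "v \<in> W"
  shows "zeta \<Phi> \<Delta> z p \<eta> (v, 0) = l v / N"
proof -
  have Np: "N > 0" using period(1) .
  \<comment> \<open>Limits pass from one residue to the next through the finite sum over
    \<open>W\<close>.\<close>
  have ex: "\<exists>L. \<forall>v\<in>W. (\<lambda>n. \<mu> (n * N + k) v) \<longlonglongrightarrow> L v" for k
  proof (induction k)
    case 0 show ?case using lim by (intro exI[of _ l]) simp
  next
    case (Suc k)
    then obtain L where L: "\<forall>v\<in>W. (\<lambda>n. \<mu> (n * N + k) v) \<longlonglongrightarrow> L v" by auto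
    have md: "(n * N + k) mod N = k mod N" "Suc (n * N + k) mod N = Suc k mod N" for n
      by (metis mod_mult_self3 add.commute, metis mod_mult_self3 add_Suc_right)
    have "(\<lambda>n. \<mu> (n * N + Suc k) v') \<longlonglongrightarrow> (\<Sum>v\<in>W. L v * K (v, k mod N) (v', Suc k mod N))" for v'
      unfolding add_Suc_right mu_Suc md using L by (intro tendsto_intros) auto
    then show ?case by (intro exI[of _ "\<lambda>v'. \<Sum>v\<in>W. L v * K (v, k mod N) (v', Suc k mod N)"]) blast
  qed
  then obtain L where L: "\<And>k v. v \<in> W \<Longrightarrow> (\<lambda>n. \<mu> (n * N + k) v) \<longlonglongrightarrow> L k v" by metis
  have L0: "L 0 v = l v" if "v \<in> W" for v
    using LIMSEQ_unique[OF L[OF that, of 0]] lim[OF that] by simp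
  have LSuc: "L (Suc k) v' = (\<Sum>v\<in>W. L k v * K (v, k) (v', Suc k mod N))" if "k < N" "v' \<in> W" for k v'
  proof (rule LIMSEQ_unique[OF L[OF that(2), of "Suc k"]])
    have md: "(n * N + k) mod N = k" "Suc (n * N + k) mod N = Suc k mod N" for n
      using that(1) by (simp, metis mod_mult_self3 add_Suc_right)
    show "(\<lambda>n. \<mu> (n * N + Suc k) v') \<longlonglongrightarrow> (\<Sum>v\<in>W. L k v * K (v, k) (v', Suc k mod N))"
      unfolding add_Suc_right mu_Suc md using L by (intro tendsto_intros) auto
  qed
  \<comment> \<open>After \<open>N\<close> steps the subsequence is the original one with its index
    shifted by one, which closes the cycle of residues.\<close>
  have LN: "L N v = L 0 v" if "v \<in> W" for v
  proof (rule LIMSEQ_unique[OF L[OF that, of N]])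
    have "(\<lambda>n. \<mu> (Suc n * N) v) \<longlonglongrightarrow> L 0 v" using LIMSEQ_Suc[OF L[OF that, of 0]] by simp
    then show "(\<lambda>n. \<mu> (n * N + N) v) \<longlonglongrightarrow> L 0 v" by (simp add: add.commute)
  qed
  have Lmod: "L (Suc k mod N) v' = (\<Sum>v\<in>W. L k v * K (v, k) (v', Suc k mod N))" if "k < N" "v' \<in> W" for k v'
    using LSuc[OF that] LN[OF that(2)] that(1) by (cases "Suc k = N") auto
  have Lnn: "L k v \<ge> 0" if "v \<in> W" for k v by (rule LIMSEQ_le_const[OF L[OF that]]) (use mu_nonneg in blast)
  have Lsum: "(\<Sum>v\<in>W. L k v) = 1" for k
  proof (rule LIMSEQ_unique)
    show "(\<lambda>n. \<Sum>v\<in>W. \<mu> (n * N + k) v) \<longlonglongrightarrow> (\<Sum>v\<in>W. L k v)" using L by (intro tendsto_sum) auto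
    show "(\<lambda>n. \<Sum>v\<in>W. \<mu> (n * N + k) v) \<longlonglongrightarrow> 1" by (simp add: mu_sum)
  qed
  define f where "f x = (if x \<in> S then L (snd x) (fst x) / N else 0)" for x
  have "M_stationary \<Phi> \<Delta> z p \<eta> f"
    unfolding M_stationary_def Let_def
  proof (intro conjI allI ballI impI)
    show "f x \<ge> 0" for x using Lnn by (cases x) (auto simp: f_def S_iff)
    show "f x = 0" if "x \<notin> S" for x using that by (simp add: f_def)
    have "(\<Sum>x\<in>S. f x) = (\<Sum>v\<in>W. \<Sum>k<N. L k v / N)"
      unfolding M_states_def sum.cartesian_product by (intro sum.cong refl) (auto simp: f_def M_states_def)
    also have "\<dots> = (\<Sum>k<N. (\<Sum>v\<in>W. L k v) / N)" by (subst sum.swap) (simp add: sum_divide_distrib)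
    finally show "(\<Sum>x\<in>S. f x) = 1" using Np by (simp add: Lsum)
    fix y assume y: "y \<in> S"
    obtain v' k' where [simp]: "y = (v', k')" by fastforce
    have vk': "v' \<in> W" "k' < N" using y by (auto simp: S_iff)
    \<comment> \<open>The unique predecessor of \<open>k'\<close> modulo \<open>N\<close>, wrapping
      around at 0.\<close>
    define k where "k = (if k' = 0 then N - 1 else k' - 1)"
    have k: "k < N" "Suc k mod N = k'" using vk' Np by (auto simp: k_def)
    have uniq: "j = k" if "j < N" "Suc j mod N = k'" for j
      using that k by (cases "Suc j = N"; cases "Suc k = N") auto
    have "(\<Sum>x\<in>S. f x * K x y) = (\<Sum>v\<in>W. \<Sum>j<N. L j v / N * K (v, j) (v', k'))"
      unfolding M_states_def sum.cartesian_product by (intro sum.cong refl) (auto simp: f_def M_states_def)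
    also have "\<dots> = (\<Sum>v\<in>W. L k v / N * K (v, k) (v', k'))"
    proof (rule sum.cong[OF refl])
      fix v assume "v \<in> W"
      then have "K (v, j) (v', k') = 0" if "j < N" "j \<noteq> k" for j
        using trans_eq[of v j v' k'] uniq[OF that(1)] that(2) by auto
      then have "(\<Sum>j<N. L j v / N * K (v, j) (v', k')) = (\<Sum>j\<in>{k}. L j v / N * K (v, j) (v', k'))"
        using k by (intro sum.mono_neutral_right) auto
      then show "(\<Sum>j<N. L j v / N * K (v, j) (v', k')) = L k v / N * K (v, k) (v', k')" by simp
    qed
    also have "\<dots> = (\<Sum>v\<in>W. L k v * K (v, k) (v', Suc k mod N)) / N" unfolding k(2) by (simp add: sum_divide_distrib)
    also have "\<dots> = L k' v' / N" using Lmod[OF k(1) vk'(1)] k(2) by simp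
    finally show "(\<Sum>x\<in>S. f x * K x y) = f y" using y by (simp add: f_def)
  qed
  moreover have "g = f" if st: "M_stationary \<Phi> \<Delta> z p \<eta> g" for g
  proof
    fix x
    show "g x = f x"
    proof (cases "x \<in> S")
      case True
      note gs = st[unfolded M_stationary_def Let_def]
      note fs = \<open>M_stationary \<Phi> \<Delta> z p \<eta> f\<close>[unfolded M_stationary_def Let_def]
      show ?thesis using stationary_unique[OF finite_S irr K_nonneg, of g f x] gs fs True by blast
    next
      case False
      then have "g x = 0" using st unfolding M_stationary_def Let_def by blast
      then show ?thesis using False by (simp add: f_def)
    qed
  qed
  ultimately have "zeta \<Phi> \<Delta> z p \<eta> = f" unfolding zeta_def by (intro the_equality)
  then show ?thesis using v Np L0[OF v] by (simp add: f_def S_iff)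
qed

end

section \<open>Limiting chambers\<close>

context ray
begin

text \<open>The sign of the direction changes because the inverse of the walk at multiples of
  \<open>N\<close> follows the word of \<open>- \<eta>\<close>.\<close>

lemma limit_probability:
  assumes p: "0 < p" "p < 1" and irr: "M_irreducible \<Phi> \<Delta> z p (- \<eta>)" and w: "w \<in> W"
  shows "measure (coins p) (limit_event w) = N * zeta \<Phi> \<Delta> z p (- \<eta>) (longest \<Phi> \<Delta> \<circ> inv w, 0)"
proof -
  interpret neg: billiard \<Phi> \<Delta> z "- \<eta>" p
    using neg_Upsilon p irr by unfold_locales auto
  let ?w0 = "longest \<Phi> \<Delta>"
  \<comment> \<open>The length has to be a multiple of \<open>N\<close> for the reversed prefix to
    begin at letter 0 of the opposite word.\<close>
  have neg_U: "neg.U (rev bs) = inv (U bs)" if len: "length bs = n * N" for bs n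
  proof -
    have "letters (\<lambda>j. word (length bs - 1 - j)) (rev bs) = letters neg.word (rev bs)"
      using neg_word[of _ n] len by (intro letters_cong) simp
    then have "neg.U (rev bs) = foldl dstep id (rev (letters word bs))"
      by (simp add: neg.U_def rev_letters)
    then show ?thesis using demazure_rev[OF set_letters_word] by (simp add: U_def)
  qed
  have lim: "(\<lambda>n. neg.\<mu> (n * N) (?w0 \<circ> inv w)) \<longlonglongrightarrow> measure (coins p) (limit_event w)" if w: "w \<in> W" for w
  proof -
    let ?a = "\<lambda>n. cexp p (n * N) (\<lambda>bs. of_bool (chm (U bs) = w))"
    \<comment> \<open>Union bound for the dominant factor being still below level 1 in some positive
      direction.\<close>
    let ?e = "\<lambda>n. \<Sum>\<beta>\<in>Pos. cexp p (n * N) (\<lambda>bs. of_bool (hat (neg.U bs) z \<bullet> \<beta> < 1))"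
    have sub: "filterlim (\<lambda>n. n * N) at_top sequentially"
      using period(1) by (intro filterlim_subseq) (auto simp: strict_mono_def)
    have a: "?a \<longlonglongrightarrow> measure (coins p) (limit_event w)"
      using filterlim_compose[OF limit_event_tendsto sub] p by auto
    have a': "?a n = cexp p (n * N) (\<lambda>bs. of_bool (chm (inv (neg.U bs)) = w))" for n
    proof -
      have "?a n = cexp p (n * N) (\<lambda>bs. of_bool (chm (inv (neg.U (rev bs))) = w))"
        by (intro cexp_cong) (metis neg_U inv_inv_aff[OF U_aff_weyl])
      then show ?thesis using cexp_rev[of p "n * N" "\<lambda>bs. of_bool (chm (inv (neg.U bs)) = w)"] by simp
    qed
    \<comment> \<open>Beyond level 1 in all directions the two events coincide by
      \<open>chm_inv\<close>; otherwise the right-hand side is at least 1.\<close>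
    have pw: "\<bar>of_bool (wbar (hat (neg.U bs)) = ?w0 \<circ> inv w) - of_bool (chm (inv (neg.U bs)) = w)\<bar>
        \<le> (\<Sum>\<beta>\<in>Pos. of_bool (hat (neg.U bs) z \<bullet> \<beta> < 1) :: real)" for bs
    proof (cases "\<exists>\<beta>\<in>Pos. hat (neg.U bs) z \<bullet> \<beta> < 1")
      case True
      then obtain \<beta> where b: "\<beta> \<in> Pos" "hat (neg.U bs) z \<bullet> \<beta> < 1" by auto
      have "1 \<le> (\<Sum>\<beta>\<in>Pos. of_bool (hat (neg.U bs) z \<bullet> \<beta> < 1) :: real)"
        using member_le_sum[OF b(1) _ finite_Pos, of "\<lambda>\<beta>. of_bool (hat (neg.U bs) z \<bullet> \<beta> < 1) :: real"] b(2) by simp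
      moreover have "\<bar>of_bool P - of_bool Q\<bar> \<le> (1::real)" for P Q by (cases P; cases Q) auto
      ultimately show ?thesis using order_trans by blast
    next
      case False
      let ?L = "wbar (hat (neg.U bs))"
      have L: "?L \<in> W" using neg.wbar_hat_U .
      have "hat (neg.U bs) z \<bullet> \<beta> > 1" if "\<beta> \<in> Pos" for \<beta>
        using False that generic[OF hat(1)[OF neg.U_aff_weyl] pos_root[OF that], of bs 1] by force
      then have ch: "chm (inv (neg.U bs)) = inv ?L \<circ> ?w0" using chm_inv[OF neg.U_aff_weyl] by blast
      have "inv ?L \<circ> ?w0 = w \<longleftrightarrow> ?L = ?w0 \<circ> inv w"
      proof
        assume e: "inv ?L \<circ> ?w0 = w"
        have "inv w = inv ?w0 \<circ> inv (inv ?L)"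
          unfolding e[symmetric] using o_inv_distrib weyl_inv(1)[OF weyl_inv(2)[OF L]] weyl_inv(1)[OF longest(1)] by blast
        moreover have "inv (inv ?L) = ?L" using inv_inv_aff[OF weyl_aff_weyl[OF L]] .
        ultimately have "?w0 \<circ> inv w = (?w0 \<circ> inv ?w0) \<circ> ?L" by (simp only: comp_assoc)
        then show "?L = ?w0 \<circ> inv w" using weyl_inv_apply(3)[OF longest(1)] by simp
      next
        assume e: "?L = ?w0 \<circ> inv w"
        have "inv ?L = inv (inv w) \<circ> inv ?w0"
          unfolding e using o_inv_distrib weyl_inv(1)[OF weyl_inv(2)[OF w]] weyl_inv(1)[OF longest(1)] by blast
        moreover have "inv (inv w) = w" using inv_inv_aff[OF weyl_aff_weyl[OF w]] .
        ultimately have "inv ?L \<circ> ?w0 = w \<circ> (inv ?w0 \<circ> ?w0)" by (simp only: comp_assoc)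
        then show "inv ?L \<circ> ?w0 = w" using weyl_inv_apply(4)[OF longest(1)] by simp
      qed
      then show ?thesis using ch by (simp add: sum_nonneg)
    qed
    have diff: "\<bar>neg.\<mu> (n * N) (?w0 \<circ> inv w) - ?a n\<bar> \<le> ?e n" for n
    proof -
      let ?F = "\<lambda>bs. of_bool (wbar (hat (neg.U bs)) = ?w0 \<circ> inv w) :: real"
      let ?G = "\<lambda>bs. of_bool (chm (inv (neg.U bs)) = w) :: real"
      let ?H = "\<lambda>bs. \<Sum>\<beta>\<in>Pos. of_bool (hat (neg.U bs) z \<bullet> \<beta> < 1) :: real"
      have "cexp p (n * N) ?F \<le> cexp p (n * N) (\<lambda>bs. ?G bs + ?H bs)"
        using p pw by (intro cexp_mono) (auto simp: abs_le_iff algebra_simps)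
      moreover have "cexp p (n * N) ?G \<le> cexp p (n * N) (\<lambda>bs. ?F bs + ?H bs)"
        using p pw by (intro cexp_mono) (auto simp: abs_le_iff algebra_simps)
      ultimately show ?thesis unfolding a' neg.\<mu>_def cexp_add cexp_sum by (simp add: abs_le_iff)
    qed
    have "?e \<longlonglongrightarrow> (\<Sum>\<beta>\<in>Pos. 0)"
      using filterlim_compose[OF neg.near_wall_tendsto sub] by (intro tendsto_sum) auto
    then have e: "?e \<longlonglongrightarrow> 0" by simp
    have "(\<lambda>n. neg.\<mu> (n * N) (?w0 \<circ> inv w) - ?a n) \<longlonglongrightarrow> 0"
    proof (rule Lim_null_comparison[OF _ e], intro always_eventually allI)
      show "norm (neg.\<mu> (n * N) (?w0 \<circ> inv w) - ?a n) \<le> ?e n" for n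
        unfolding real_norm_def by (rule diff)
    qed
    from tendsto_add[OF this a] show ?thesis by simp
  qed
  \<comment> \<open>The hypothesis of \<open>zeta_limit\<close> ranges over all \<open>v\<close>, so
    the correspondence between \<open>w\<close> and \<open>v\<close> is solved for
    \<open>w\<close>.\<close>
  have "(\<lambda>n. neg.\<mu> (n * neg.N) v) \<longlonglongrightarrow> measure (coins p) (limit_event (inv v \<circ> ?w0))" if v: "v \<in> W" for v
  proof -
    have "inv v \<circ> ?w0 \<in> W" using weyl_comp weyl_inv v longest by auto
    moreover have "?w0 \<circ> inv (inv v \<circ> ?w0) = v"
    proof -
      have "inv (inv v \<circ> ?w0) = inv ?w0 \<circ> inv (inv v)"
        using o_inv_distrib weyl_inv(1)[OF weyl_inv(2)[OF v]] weyl_inv(1)[OF longest(1)] by blast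
      then show ?thesis
        using inv_inv_aff[OF weyl_aff_weyl[OF v]] weyl_inv_apply(3)[OF longest(1)] by (metis comp_assoc id_comp)
    qed
    ultimately show ?thesis using lim[of "inv v \<circ> ?w0"] neg_period by simp
  qed
  moreover have ww: "?w0 \<circ> inv w \<in> W" using weyl_comp weyl_inv w longest by auto
  ultimately have "zeta \<Phi> \<Delta> z p (- \<eta>) (?w0 \<circ> inv w, 0) = measure (coins p) (limit_event (inv (?w0 \<circ> inv w) \<circ> ?w0)) / neg.N"
    by (rule neg.zeta_limit)
  moreover have "inv (?w0 \<circ> inv w) \<circ> ?w0 = w"
  proof -
    have "inv (?w0 \<circ> inv w) = inv (inv w) \<circ> inv ?w0"
      using o_inv_distrib weyl_inv(1)[OF weyl_inv(2)[OF w]] weyl_inv(1)[OF longest(1)] by blast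
    then show ?thesis
      using inv_inv_aff[OF weyl_aff_weyl[OF w]] weyl_inv_apply(4)[OF longest(1)] by (metis comp_assoc comp_id)
  qed
  ultimately show ?thesis using neg_period period(1) by simp
qed

end

theorem theorem1p3:
  fixes \<Phi> \<Delta> :: "'v::euclidean_space set" and z0 \<eta> :: 'v and p :: real
  assumes "root_system \<Phi>" and "crystallographic \<Phi>" and "irreducible_rs \<Phi>"
    and "simple_system \<Phi> \<Delta>"
    and "z0 \<in> interior (fund_alcove \<Phi> \<Delta>)"
    and "0 < p" and "p < 1"
    and "\<eta> \<in> Upsilon \<Phi> \<Delta> z0"
    and "M_irreducible \<Phi> \<Delta> z0 p \<eta>" and "M_irreducible \<Phi> \<Delta> z0 p (- \<eta>)"
  shows "- \<eta> \<in> Upsilon \<Phi> \<Delta> z0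
    \<and> period \<Phi> \<Delta> z0 (- \<eta>) = period \<Phi> \<Delta> z0 \<eta>
    \<and> (AE \<omega> in coin_space p. \<exists>w\<in>weyl \<Phi>. \<exists>M0. \<forall>M\<ge>M0.
          alcove \<Phi> \<Delta> (eps_walk \<Phi> \<Delta> z0 \<eta> \<omega> M) \<subseteq> chamber \<Delta> w)
    \<and> (\<forall>w\<in>weyl \<Phi>.
          measure (coin_space p) {\<omega>\<in>space (coin_space p). \<exists>M0. \<forall>M\<ge>M0.
             alcove \<Phi> \<Delta> (eps_walk \<Phi> \<Delta> z0 \<eta> \<omega> M) \<subseteq> chamber \<Delta> w}
          = real (period \<Phi> \<Delta> z0 \<eta>) / 2 *
            (zeta \<Phi> \<Delta> z0 p \<eta> (gmult (ginv w) (longest \<Phi> \<Delta>), 0)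
             + zeta \<Phi> \<Delta> z0 p (- \<eta>) (gmult (ginv w) (longest \<Phi> \<Delta>), 0)))"
proof -
  interpret irreducible_root_system \<Phi> \<Delta> by unfold_locales fact+
  interpret alcove_point \<Phi> \<Delta> z0 using assms(5) interior_fund_alcove by unfold_locales auto
  interpret ray \<Phi> \<Delta> z0 \<eta> by unfold_locales fact
  interpret neg: ray \<Phi> \<Delta> z0 "- \<eta>" by unfold_locales (rule neg_Upsilon)
  let ?ev = "\<lambda>\<omega> w. \<exists>M0. \<forall>M\<ge>M0. alcove \<Phi> \<Delta> (eps_walk \<Phi> \<Delta> z0 \<eta> \<omega> M) \<subseteq> chamber \<Delta> w"
  have ev: "?ev \<omega> w \<longleftrightarrow> (if fst \<omega> then snd \<omega> \<in> limit_event w else snd \<omega> \<in> neg.limit_event w)" if "w \<in> W" for \<omega> w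
    using alcove_chamber[OF U_aff_weyl that] alcove_chamber[OF neg.U_aff_weyl that]
    by (simp add: eps_walk_def walk_eq neg.walk_eq limit_event_def neg.limit_event_def)
  have "\<exists>w\<in>W. ?ev \<omega> w" for \<omega>
  proof -
    obtain w where "w \<in> W" "snd \<omega> \<in> limit_event w" using chamber_stabilises[of "snd \<omega>"] by (auto simp: limit_event_def)
    moreover obtain w' where "w' \<in> W" "snd \<omega> \<in> neg.limit_event w'"
      using neg.chamber_stabilises[of "snd \<omega>"] by (auto simp: neg.limit_event_def)
    ultimately show ?thesis using ev by (cases "fst \<omega>") metis+
  qed
  \<comment> \<open>Stabilisation has been shown for every outcome, so the almost sure statement is
    immediate.\<close>
  then have AE: "AE \<omega> in coin_space p. \<exists>w\<in>W. ?ev \<omega> w" by simp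
  have "measure (coin_space p) {\<omega>\<in>space (coin_space p). ?ev \<omega> w}
      = N / 2 * (zeta \<Phi> \<Delta> z0 p \<eta> (gmult (ginv w) (longest \<Phi> \<Delta>), 0) + zeta \<Phi> \<Delta> z0 p (- \<eta>) (gmult (ginv w) (longest \<Phi> \<Delta>), 0))"
    if w: "w \<in> W" for w
  proof -
    let ?X = "{\<omega>\<in>space (coin_space p). ?ev \<omega> w}"
    have sp: "space (coin_space p) = UNIV" by (simp add: coin_space_def space_pair_measure space_coins)
    have X: "?X = {True} \<times> limit_event w \<union> {False} \<times> neg.limit_event w"
      unfolding sp using ev[OF w] by (auto split: if_splits)
    define v where "v = longest \<Phi> \<Delta> \<circ> inv w"
    have v: "gmult (ginv w) (longest \<Phi> \<Delta>) = v" by (simp only: gmult_def ginv_def v_def)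
    define E where "E = {True} \<times> limit_event w \<union> {False} \<times> neg.limit_event w"
    have "E \<in> sets (measure_pmf (bernoulli_pmf (1 / 2)) \<Otimes>\<^sub>M coins p)"
      unfolding E_def using limit_event_sets neg.limit_event_sets by (intro sets.Un pair_measureI) auto
    from measure_bernoulli_pair[OF prob_space_coins this, folded coin_space_def]
    have "measure (coin_space p) E = 1 / 2 * measure (coins p) (Pair True -` E) + (1 - 1 / 2) * measure (coins p) (Pair False -` E)"
      by simp
    also have "Pair True -` E = limit_event w" unfolding E_def by auto
    also have "Pair False -` E = neg.limit_event w" unfolding E_def by auto
    \<comment> \<open>Each sign contributes the stationary value of the opposite direction; with
      equal weights the sum is symmetric in the two.\<close>
    also have "measure (coins p) (limit_event w) = N * zeta \<Phi> \<Delta> z0 p (- \<eta>) (v, 0)"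
      unfolding v_def using limit_probability assms w by auto
    also have "measure (coins p) (neg.limit_event w) = N * zeta \<Phi> \<Delta> z0 p \<eta> (v, 0)"
      unfolding v_def using neg.limit_probability[of p w] assms w neg_period by simp
    finally show ?thesis unfolding X E_def[symmetric] v by (simp add: algebra_simps)
  qed
  then show ?thesis using neg_Upsilon neg_period AE by (intro conjI ballI)
qed

end
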